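(* Let $\Bbbk$ be a field of characteristic $p>0$, let $\ell=(\ell_1,\ldots,\ell_n)$ be pairwise prime linear forms in $\Bbbk[x,y]$, let $\mathbf{a}=(a_1,\ldots,a_n)$ be positive integers, and let $G=\ell_1^{a_1}\cdots\ell_n^{a_n}$. Then the "Improved FPT Algorithm" described in the context, applied to the input $(\ell,\mathbf{a})$, works: all its steps can be carried out, it terminates, and the value it returns is $\operatorname{fpt}(G)$.
   Context: $\mathfrak{m}=\langle x,y\rangle$; $\operatorname{fpt}(G)=\inf\{k/q:k\in\mathbb{N},\ q=p^s,\ s\geq 0,\ G^k\in\mathfrak{m}^{[q]}\}$, where $\mathfrak{a}^{[q]}=\langle f^q:f\in\mathfrak{a}\rangle$. $\|\mathbf{a}\|=\sum_i|a_i|$; $\mathbf{u}\le\mathbf{v}$ means $u_i\le v_i$ for all $i$; $\ell^{\mathbf{d}}=\prod_i\ell_i^{d_i}$; for $\lambda>0$, $\langle\lambda\rangle_e=(\lceil\lambda p^e\rceil-1)/p^e$, applied componentwise to vectors. Critical points. A form is a nonzero homogeneous polynomial of $R=\Bbbk[x,y]$. For forms $F,G,H$ with no common non-constant factor there is a graded exact sequence $0\to R(-m)\oplus R(-n')\to R(-\deg F)\oplus R(-\deg G)\oplus R(-\deg H)\to R\to R/\langle F,G,H\rangle\to0$, and $\delta(F,G,H)=|m-n'|$. Let $\mathfrak{b}=\langle U,V\rangle$ with $U,V$ relatively prime non-constant forms, and let $\Delta_{\mathfrak{b}}:\mathbb{R}_{\ge0}^n\to\mathbb{R}$ be the unique continuous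 function with $\Delta_{\mathfrak{b}}(\mathbf{a}/q)=\frac1q\delta(U^q,V^q,\ell^{\mathbf{a}})$ for all powers $q$ of $p$ and all $\mathbf{a}\in\mathbb{N}^n$. A $\mathfrak{b}$-critical point is a point $\mathbf{c}\in\mathbb{R}_{\ge0}^n$ at which $\Delta_{\mathfrak{b}}$ attains a local maximum and $\Delta_{\mathfrak{b}}(\mathbf{c})=\deg(UV)-\|\mathbf{c}\|$. A critical point under $\mathbf{u}$ is a critical point $\mathbf{c}$ with $\mathbf{c}\le\mathbf{u}$. Improved FPT Algorithm. Input: $\ell$, $\mathbf{a}$. 1. If $a_i\ge\|\mathbf{a}\|/2$ for some $i$, return $1/a_i$. 2. Set $\lambda=2/\|\mathbf{a}\|$ and let $m$ be the minimal denominator of $\lambda$. 3. If $p\mid m$: if $\operatorname{fpt}(G)=\lambda$ (tested by some independent method), return $\lambda$; else set $\mu=\infty$. If $p\nmid m$: set $\mu$ equal to the multiplicative order of $p$ modulo $m$. 4. Set $\mathfrak{b}_0=\mathfrak{m}$ and $e=0$. 5. While $\mathfrak{b}_e\ne\langle1\rangle$ and $e<\mu$: replace $e$ by $e+1$; let $\mathbf{d}_e$ be the $e$th digit of the unique componentwise non-terminating base $p$ expansion $\lambda\mathbf{a}=\sum_{s\ge1}\mathbf{d}_s/p^s$ (digits in $\{0,\ldots,p-1\}$, not eventually zero in any component); set $\mathfrak{b}_e=(\mathfrak{b}_{e-1}^{[p]}:\ell^{\mathbf{d}_e})$. 6. If $\mathfrak{b}_e\ne\langle1\rangle$, return $\lambda$.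 7. Set $j=e-1$, $\mathbf{v}_j=\mathbf{d}_e/p$, and let $\mathbf{c}_j$ be a $\mathfrak{b}_j$-critical point under $\mathbf{v}_j$. 8. While some component of $\mathbf{c}_j$ is $0$ and $j>0$: set $\mathbf{v}_{j-1}=(\mathbf{c}_j+\mathbf{d}_j)/p$; replace $j$ by $j-1$; let $\mathbf{c}_j$ be a $\mathfrak{b}_j$-critical point under $\mathbf{v}_j$. 9. Set $\mathbf{c}=\mathbf{c}_j/p^j+\langle\lambda\mathbf{a}\rangle_j$ and return $\max\{c_1/a_1,\ldots,c_n/a_n\}$. *)

theory Defs
  imports
    "HOL-Analysis.Analysis"
    "HOL-Number_Theory.Pocklington"
    "HOL-Computational_Algebra.Polynomial"
    "HOL-Library.Extended_Nat"
begin

hide_const (open) up_ring.coeff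

section \<open>The ring \<open>R = k[x,y]\<close> and its grading\<close>

text \<open>
  \<open>k[x,y]\<close> is represented as \<open>k[x][y]\<close>: the coefficient of \<open>x\<^sup>j y\<^sup>i\<close> in \<open>F\<close> is
  \<open>coeff (coeff F i) j\<close>.
\<close>

type_synonym 'k bipoly = "'k poly poly"

definition var_x :: "'k::field bipoly" where
  "var_x = [:[:0, 1:]:]"

definition var_y :: "'k::field bipoly" where
  "var_y = [:0, 1:]"

text \<open>The graded piece \<open>R\<^sub>d\<close>; integer degrees make the shift \<open>R(-m)\<^sub>d = R\<^sub>d\<^sub>-\<^sub>m\<close> literal.\<close>

definition homog_part :: "int \<Rightarrow> 'k::field bipoly set" where
  "homog_part d = {F. \<forall>i j. coeff (coeff F i) j \<noteq> 0 \<longrightarrow> int (i + j) = d}"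

definition total_degree :: "'k::field bipoly \<Rightarrow> nat" where
  "total_degree F = Max {i + j | i j. coeff (coeff F i) j \<noteq> 0}"

definition is_form :: "'k::field bipoly \<Rightarrow> bool" where
  "is_form F \<longleftrightarrow> F \<noteq> 0 \<and> (\<exists>d. F \<in> homog_part d)"

definition linear_form :: "'k::field bipoly \<Rightarrow> bool" where
  "linear_form F \<longleftrightarrow> is_form F \<and> total_degree F = 1"


section \<open>Ideals and the F-pure threshold\<close>

abbreviation ideal_gen :: "'a::comm_ring_1 set \<Rightarrow> 'a set" where
  "ideal_gen S \<equiv> module.span (*) S"

definition max_ideal :: "'k::field bipoly set" where
  "max_ideal = ideal_gen {var_x, var_y}"

definition frob_power :: "nat \<Rightarrow> 'a::comm_ring_1 set \<Rightarrow> 'a set" where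
  "frob_power q I = ideal_gen {f ^ q | f. f \<in> I}"

definition ideal_colon :: "'a::comm_ring_1 set \<Rightarrow> 'a \<Rightarrow> 'a set" where
  "ideal_colon I f = {g. g * f \<in> I}"

definition fpt :: "nat \<Rightarrow> 'k::field bipoly \<Rightarrow> real" where
  "fpt p G = Inf {real k / real (p ^ s) | k s. G ^ k \<in> frob_power (p ^ s) max_ideal}"


section \<open>Vectors\<close>

definition norm1 :: "real ^ 'n::finite \<Rightarrow> real" where
  "norm1 u = (\<Sum>i\<in>UNIV. \<bar>u $ i\<bar>)"

definition real_vec :: "nat ^ 'n::finite \<Rightarrow> real ^ 'n" where
  "real_vec d = (\<chi> i. real (d $ i))"

definition ell_pow :: "'k::field bipoly ^ 'n::finite \<Rightarrow> nat ^ 'n \<Rightarrow> 'k bipoly" where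
  "ell_pow ell d = (\<Prod>i\<in>UNIV. (ell $ i) ^ (d $ i))"

definition trunc :: "nat \<Rightarrow> nat \<Rightarrow> real ^ 'n::finite \<Rightarrow> real ^ 'n" where
  "trunc p e u = (\<chi> i. real_of_int (\<lceil>u $ i * real p ^ e\<rceil> - 1) / real p ^ e)"


section \<open>Syzygy gaps and critical points\<close>

text \<open>
  \<open>\<phi>\<close> is a graded homomorphism \<open>R(-m) \<oplus> R(-n) \<rightarrow> R(-deg F) \<oplus> R(-deg G) \<oplus> R(-deg H)\<close> which is
  injective and whose image is the kernel of \<open>(A,B,C) \<mapsto> AF + BG + CH\<close>.  The rest of the sequence
  \<open>\<rightarrow> R \<rightarrow> R/\<langle>F,G,H\<rangle> \<rightarrow> 0\<close> is exact in any case.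
\<close>

definition graded_resolution ::
  "'k::field bipoly \<Rightarrow> 'k bipoly \<Rightarrow> 'k bipoly \<Rightarrow> int \<Rightarrow> int \<Rightarrow>
    ('k bipoly \<times> 'k bipoly \<Rightarrow> 'k bipoly \<times> 'k bipoly \<times> 'k bipoly) \<Rightarrow> bool" where
  "graded_resolution F G H m n \<phi> \<longleftrightarrow>
     module_hom (\<lambda>r (A, B). (r * A, r * B)) (\<lambda>r (A, B, C). (r * A, r * B, r * C)) \<phi> \<and>
     (\<forall>d. \<phi> ` (homog_part (d - m) \<times> homog_part (d - n)) \<subseteq>
        homog_part (d - int (total_degree F)) \<times> homog_part (d - int (total_degree G)) \<times>
        homog_part (d - int (total_degree H))) \<and>
     inj \<phi> \<and>
     range \<phi> = {(A, B, C). A * F + B * G + C * H = 0}"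

text \<open>
  The pair \<open>{m, n}\<close> is determined by \<open>F, G, H\<close>, and exists if these are forms without common
  non-constant factor.
\<close>

definition syzygy_gap :: "'k::field bipoly \<Rightarrow> 'k bipoly \<Rightarrow> 'k bipoly \<Rightarrow> int" where
  "syzygy_gap F G H = (THE r. \<exists>m n \<phi>. graded_resolution F G H m n \<phi> \<and> r = \<bar>m - n\<bar>)"

abbreviation orthant :: "(real ^ 'n::finite) set" where
  "orthant \<equiv> {u. 0 \<le> u}"

text \<open>
  \<open>D\<close> restricts to \<open>\<Delta>\<^sub>b\<close>, \<open>b = \<langle>U,V\<rangle>\<close>, on the orthant; its values elsewhere are irrelevant.
\<close>

definition is_Delta ::
  "nat \<Rightarrow> 'k::field bipoly ^ 'n::finite \<Rightarrow> 'k bipoly \<Rightarrow> 'k bipoly \<Rightarrow> (real ^ 'n \<Rightarrow> real) \<Rightarrow> bool"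
where
  "is_Delta p ell U V D \<longleftrightarrow>
     continuous_on orthant D \<and>
     (\<forall>s a. D ((1 / real (p ^ s)) *\<^sub>R real_vec a) =
        real_of_int (syzygy_gap (U ^ p ^ s) (V ^ p ^ s) (ell_pow ell a)) / real (p ^ s))"

lemma is_Delta_unique:
  fixes ell :: "'k::field bipoly ^ 'n::finite"
  assumes "p > 1" "is_Delta p ell U V D" "is_Delta p ell U V D'" "u \<in> orthant"
  shows "D u = D' u"
proof -
  define w where "w s = (1 / real (p ^ s)) *\<^sub>R real_vec (\<chi> i. nat \<lfloor>u $ i * real (p ^ s)\<rfloor>)" for s
  have u0: "0 \<le> u $ i" for i
    using assms(4) by (simp add: less_eq_vec_def)
  have w_orth: "w s \<in> orthant" for s
    by (simp add: w_def real_vec_def less_eq_vec_def)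
  have "(\<lambda>s. w s $ i) \<longlonglongrightarrow> u $ i" for i
  proof (rule tendsto_sandwich)
    have *: "(\<lambda>s. inverse (real p ^ s)) \<longlonglongrightarrow> 0"
      using assms(1) by (intro LIMSEQ_inverse_realpow_zero) simp
    show "(\<lambda>s. u $ i - inverse (real p ^ s)) \<longlonglongrightarrow> u $ i"
      using tendsto_diff[OF tendsto_const *] by simp
    have le: "u $ i - inverse (real p ^ s) \<le> w s $ i" "w s $ i \<le> u $ i" for s
    proof -
      have pos: "real p ^ s > 0" using assms(1) by simp
      have f0: "0 \<le> \<lfloor>u $ i * real p ^ s\<rfloor>" using u0[of i] by simp
      have eq: "w s $ i = real_of_int \<lfloor>u $ i * real p ^ s\<rfloor> / real p ^ s"
        using f0 by (simp add: w_def real_vec_def)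
      show "w s $ i \<le> u $ i"
        unfolding eq using pos by (simp add: pos_divide_le_eq)
      have "u $ i * real p ^ s - 1 \<le> real_of_int \<lfloor>u $ i * real p ^ s\<rfloor>" by linarith
      then have "(u $ i * real p ^ s - 1) / real p ^ s \<le> w s $ i"
        unfolding eq using pos by (intro divide_right_mono) auto
      then show "u $ i - inverse (real p ^ s) \<le> w s $ i"
        using pos by (simp add: field_simps)
    qed
    show "\<forall>\<^sub>F s in sequentially. u $ i - inverse (real p ^ s) \<le> w s $ i"
      using le(1) by simp
    show "\<forall>\<^sub>F s in sequentially. w s $ i \<le> u $ i"
      using le(2) by simp
    show "(\<lambda>s. u $ i) \<longlonglongrightarrow> u $ i" by simp
  qed
  then have lim: "w \<longlonglongrightarrow> u"
    by (intro vec_tendstoI) auto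
  have "(\<lambda>s. D (w s)) \<longlonglongrightarrow> D u"
    by (rule continuous_on_tendsto_compose[of orthant, OF _ lim assms(4)])
      (use assms(2) w_orth in \<open>auto simp only: is_Delta_def eventually_sequentially\<close>)
  moreover have "(\<lambda>s. D' (w s)) \<longlonglongrightarrow> D' u"
    by (rule continuous_on_tendsto_compose[of orthant, OF _ lim assms(4)])
      (use assms(3) w_orth in \<open>auto simp only: is_Delta_def eventually_sequentially\<close>)
  moreover have "D (w s) = D' (w s)" for s
    using assms(2,3) unfolding is_Delta_def w_def by presburger
  ultimately show ?thesis
    by (simp only: LIMSEQ_unique)
qed

text \<open>
  A \<open>b\<close>-critical point; in particular \<open>b\<close> is generated by two relatively prime non-constant forms.
  The local maximum is relative to the orthant, the domain of \<open>\<Delta>\<^sub>b\<close>.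
\<close>

definition critical_point ::
  "nat \<Rightarrow> 'k::field bipoly ^ 'n::finite \<Rightarrow> 'k bipoly set \<Rightarrow> real ^ 'n \<Rightarrow> bool" where
  "critical_point p ell b c \<longleftrightarrow>
     (\<exists>U V D.
        is_form U \<and> is_form V \<and> total_degree U > 0 \<and> total_degree V > 0 \<and> coprime U V \<and>
        b = ideal_gen {U, V} \<and> is_Delta p ell U V D \<and>
        c \<in> orthant \<and>
        (\<forall>\<^sub>F u in at c within orthant. D u \<le> D c) \<and>
        D c = real (total_degree (U * V)) - norm1 c)"

definition critical_point_under ::
  "nat \<Rightarrow> 'k::field bipoly ^ 'n::finite \<Rightarrow> 'k bipoly set \<Rightarrow> real ^ 'n \<Rightarrow> real ^ 'n \<Rightarrow> bool" where
  "critical_point_under p ell b v c \<longleftrightarrow> critical_point p ell b c \<and> c \<le> v"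


section \<open>The algorithm\<close>

text \<open>
  Digits are indexed from \<open>1\<close>; the value at \<open>0\<close> is a dummy, fixed so that the expansion is unique
  as a function.
\<close>

definition nonterm_expansion :: "nat \<Rightarrow> real \<Rightarrow> (nat \<Rightarrow> nat) \<Rightarrow> bool" where
  "nonterm_expansion p t f \<longleftrightarrow>
     f 0 = 0 \<and> (\<forall>s. f s < p) \<and> infinite {s. f s \<noteq> 0} \<and>
     (\<lambda>s. real (f (Suc s)) / real p ^ Suc s) sums t"

definition digit :: "nat \<Rightarrow> real \<Rightarrow> nat \<Rightarrow> nat" where
  "digit p t = (THE f. nonterm_expansion p t f)"

definition lam :: "nat ^ 'n::finite \<Rightarrow> real" where
  "lam a = 2 / norm1 (real_vec a)"

definition min_denom :: "real \<Rightarrow> nat" where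
  "min_denom t = (LEAST m. m > 0 \<and> real m * t \<in> \<int>)"

definition digit_vec :: "nat \<Rightarrow> nat ^ 'n::finite \<Rightarrow> nat \<Rightarrow> nat ^ 'n" where
  "digit_vec p a e = (\<chi> i. digit p (lam a * real (a $ i)) e)"

fun b_ideal :: "nat \<Rightarrow> 'k::field bipoly ^ 'n::finite \<Rightarrow> nat ^ 'n \<Rightarrow> nat \<Rightarrow> 'k bipoly set" where
  "b_ideal p ell a 0 = max_ideal"
| "b_ideal p ell a (Suc e) =
     ideal_colon (frob_power p (b_ideal p ell a e)) (ell_pow ell (digit_vec p a (Suc e)))"

text \<open>
  Control states: \<open>Setup\<close> is reached when no exponent is at least half of the total;
  \<open>Ascend \<mu> e\<close> is the head of the loop that computes the ideals \<open>b\<^sub>e\<close>, and \<open>Exit e\<close> the point just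
  after it; \<open>Descend j c\<^sub>j\<close> is the head of the loop that descends through the critical points
  \<open>c\<^sub>j\<close>; \<open>Return r\<close> is termination with output \<open>r\<close>.
\<close>

datatype 'v state =
    Start
  | Setup
  | Ascend enat nat
  | Exit nat
  | Descend nat 'v
  | Return real

text \<open>
  The transition relation is nondeterministic where the algorithm leaves a choice: the index in
  \<open>large_exponent\<close> and the critical points in \<open>first_critical\<close> and \<open>next_critical\<close>.  A step demanding
  an object is blocked if that object does not exist, so progress of the relation includes the
  unique existence of the base \<open>p\<close> expansions and the existence of the critical points.
\<close>

inductive step ::
  "nat \<Rightarrow> 'k::field bipoly ^ 'n::finite \<Rightarrow> nat ^ 'n \<Rightarrow>
    (real ^ 'n) state \<Rightarrow> (real ^ 'n) state \<Rightarrow> bool"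
  for p :: nat and ell :: "'k::field bipoly ^ 'n::finite" and a :: "nat ^ 'n"
where
  large_exponent:
    "real (a $ i) \<ge> norm1 (real_vec a) / 2 \<Longrightarrow> step p ell a Start (Return (1 / real (a $ i)))"
| no_large_exponent:
    "\<forall>i. real (a $ i) < norm1 (real_vec a) / 2 \<Longrightarrow> step p ell a Start Setup"
| bad_denom_equal:
    "p dvd min_denom (lam a) \<Longrightarrow> fpt p (ell_pow ell a) = lam a \<Longrightarrow>
     step p ell a Setup (Return (lam a))"
| bad_denom_unequal:
    "p dvd min_denom (lam a) \<Longrightarrow> fpt p (ell_pow ell a) \<noteq> lam a \<Longrightarrow>
     step p ell a Setup (Ascend \<infinity> 0)"
| good_denom:
    "\<not> p dvd min_denom (lam a) \<Longrightarrow>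
     step p ell a Setup (Ascend (enat (ord (min_denom (lam a)) p)) 0)"
| ascend:
    "b_ideal p ell a e \<noteq> ideal_gen {1} \<Longrightarrow> enat e < \<mu> \<Longrightarrow>
     \<forall>i. \<exists>!f. nonterm_expansion p (lam a * real (a $ i)) f \<Longrightarrow>
     step p ell a (Ascend \<mu> e) (Ascend \<mu> (Suc e))"
| ascend_exit:
    "b_ideal p ell a e = ideal_gen {1} \<or> \<not> enat e < \<mu> \<Longrightarrow>
     step p ell a (Ascend \<mu> e) (Exit e)"
| return_lam:
    "b_ideal p ell a e \<noteq> ideal_gen {1} \<Longrightarrow> step p ell a (Exit e) (Return (lam a))"
| first_critical:
    "b_ideal p ell a (Suc j) = ideal_gen {1} \<Longrightarrow>
     critical_point_under p ell (b_ideal p ell a j)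
       ((1 / real p) *\<^sub>R real_vec (digit_vec p a (Suc j))) c \<Longrightarrow>
     step p ell a (Exit (Suc j)) (Descend j c)"
| next_critical:
    "\<exists>i. c $ i = 0 \<Longrightarrow>
     critical_point_under p ell (b_ideal p ell a j)
       ((1 / real p) *\<^sub>R (c + real_vec (digit_vec p a (Suc j)))) c' \<Longrightarrow>
     step p ell a (Descend (Suc j) c) (Descend j c')"
| return_critical:
    "\<not> ((\<exists>i. c $ i = 0) \<and> j > 0) \<Longrightarrow>
     c' = (1 / real p ^ j) *\<^sub>R c + trunc p j (lam a *\<^sub>R real_vec a) \<Longrightarrow>
     step p ell a (Descend j c) (Return (Max (range (\<lambda>i. c' $ i / real (a $ i)))))"

end

theory Submission
  imports Defs "HOL-Computational_Algebra.Polynomial_Factorial"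
begin

text \<open>
  Write \<open>\<mm>\<^sup>[\<^sup>q\<^sup>]\<close> for the ideal generated by \<open>x\<^sup>q\<close> and \<open>y\<^sup>q\<close>, where \<open>q\<close> is a power of \<open>p\<close>.  The proof reduces every
  question about the ideals \<open>b\<^sub>e\<close> and their critical points to the question which products \<open>\<ell>\<^sup>a\<close> lie in
  which \<open>\<mm>\<^sup>[\<^sup>q\<^sup>]\<close>, and answers that question with one divisibility lemma.

  The algebra rests on Hilbert--Burch matrices.  The syzygies of \<open>(F, G, \<ell>\<^sup>a)\<close> have a homogeneous basis whose
  \<open>2 \<times> 2\<close> minors are \<open>F, G, \<ell>\<^sup>a\<close>; such a matrix is built by multiplying in one linear form at a time
  (\<open>hb_linear_step\<close>), and taking \<open>p\<close>-th powers of its entries gives the matrix of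
  \<open>(F\<^sup>p, G\<^sup>p, \<ell>\<^sup>p\<^sup>a)\<close>.  Hence the syzygy gap is \<open>1\<close>-Lipschitz in \<open>a\<close> and scales with \<open>p\<close>, so that \<open>\<Delta>\<close> exists
  (\<open>ex_Delta\<close>); colon ideals by \<open>\<ell>\<^sup>a\<close> are generated by two forms and commute with Frobenius powers
  (\<open>colon_gen\<close>); and every \<open>b\<^sub>e\<close> is the colon of \<open>\<mm>\<^sup>[\<^sup>q\<^sup>]\<close>, \<open>q = p\<^sup>e\<close>, by a single product, with exponents
  \<open>q\<langle>\<lambda>a\<rangle>\<^sub>e\<close> (\<open>b_ideal_eq\<close>).

  The main lemma is \<open>tight_dvd\<close>.  Call \<open>a\<close> tight for \<open>F, G\<close> if \<open>\<ell>\<^sup>a = A F + B G\<close> and no \<open>\<ell>\<^sub>i\<close> divides both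
  \<open>A\<close> and \<open>B\<close>.  If \<open>\<ell>\<^sup>b\<close> is also in \<open>\<langle>F, G\<rangle>\<close> and the least common multiple of \<open>\<ell>\<^sup>a\<close> and \<open>\<ell>\<^sup>b\<close> has degree less
  than \<open>deg F + deg G\<close>, then expressing this multiple in two ways gives a relation between \<open>F\<close> and \<open>G\<close> in
  a degree in which only the zero relation exists; comparing coefficients gives \<open>a \<le> b\<close>.  It has three uses.
  Tight exponents give local maxima of \<open>\<Delta>\<close>, which yields the critical points required by the algorithm
  (\<open>tight_local_max\<close>, \<open>critical_point_of_tight\<close>).  Conversely every critical point, a priori a real
  vector, is \<open>a/q\<close> with \<open>a\<close> tight (\<open>critical_is_tight\<close>).  Finally it computes the threshold: from a
  dominating exponent (\<open>fpt_large_exponent\<close>) and from a critical point \<open>c < \<lambda>a\<close> for \<open>\<mm>\<close>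
  (\<open>fpt_of_critical\<close>).

  As for the loops, \<open>fpt(G) < \<lambda>\<close> puts some \<open>G\<^sup>k\<close> with \<open>k/q < \<lambda>\<close> into \<open>\<mm>\<^sup>[\<^sup>q\<^sup>]\<close>, so some \<open>b\<^sub>e\<close> is the unit ideal
  (\<open>fpt_eq_lam\<close>); if the denominator of \<open>\<lambda>\<close> is prime to \<open>p\<close>, the expansions of \<open>\<lambda>a\<close> are periodic and it
  suffices to look at one period (\<open>periodic_not_unit\<close>).  During the descent the point
  \<open>c\<^sub>j/p\<^sup>j + \<langle>\<lambda>a\<rangle>\<^sub>j\<close> only moves down, hence stays below \<open>\<lambda>a\<close>, whose coordinates add up to \<open>2\<close>; this is the degree
  bound needed for the next critical point.  At the end it is critical for \<open>\<mm>\<close> itself, because either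
  \<open>j = 0\<close> or every coordinate of \<open>c\<^sub>j\<close> can be lowered.
\<close>

hide_const (open) up_ring.monom

section \<open>Graded pieces and linear forms\<close>

lemma homog_partD:
  "F \<in> homog_part d \<Longrightarrow> int (i + j) \<noteq> d \<Longrightarrow> coeff (coeff F i) j = 0"
  by (auto simp: homog_part_def)

lemma homog_part_degree:
  "F \<in> homog_part d \<Longrightarrow> coeff (coeff F i) j \<noteq> 0 \<Longrightarrow> int (i + j) = d"
  by (auto simp: homog_part_def)

lemma coeff_coeff_mult:
  "coeff (coeff (F * G) i) j =
     (\<Sum>i'\<le>i. \<Sum>j'\<le>j. coeff (coeff F i') j' * coeff (coeff G (i - i')) (j - j'))"
  by (simp add: coeff_mult coeff_sum)

lemma bipoly_eqI: "(\<And>i j. coeff (coeff F i) j = coeff (coeff G i) j) \<Longrightarrow> F = G"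
  by (simp add: poly_eq_iff)

lemma homog_part_0 [simp]: "0 \<in> homog_part d"
  by (simp add: homog_part_def)

lemma homog_part_add: "F \<in> homog_part d \<Longrightarrow> G \<in> homog_part d \<Longrightarrow> F + G \<in> homog_part d"
  unfolding homog_part_def
proof (clarify)
  fix i j
  assume *: "\<forall>i j. coeff (coeff F i) j \<noteq> 0 \<longrightarrow> int (i + j) = d"
    "\<forall>i j. coeff (coeff G i) j \<noteq> 0 \<longrightarrow> int (i + j) = d" "coeff (coeff (F + G) i) j \<noteq> 0"
  then show "int (i + j) = d" by (cases "coeff (coeff F i) j = 0") auto
qed

lemma homog_part_uminus: "F \<in> homog_part d \<Longrightarrow> - F \<in> homog_part d"
  by (auto simp: homog_part_def)

lemma homog_part_diff: "F \<in> homog_part d \<Longrightarrow> G \<in> homog_part d \<Longrightarrow> F - G \<in> homog_part d"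
  using homog_part_add[of F d "- G"] homog_part_uminus[of G d] by simp

lemma homog_part_mult:
  assumes "F \<in> homog_part d" "G \<in> homog_part e"
  shows "F * G \<in> homog_part (d + e)"
  unfolding homog_part_def
proof (intro CollectI allI impI)
  fix i j assume "coeff (coeff (F * G) i) j \<noteq> 0"
  then obtain i' j' where "i' \<le> i" "j' \<le> j"
      "coeff (coeff F i') j' * coeff (coeff G (i - i')) (j - j') \<noteq> 0"
    unfolding coeff_coeff_mult by (meson atMost_iff sum.not_neutral_contains_not_neutral)
  moreover from this have "coeff (coeff F i') j' \<noteq> 0" "coeff (coeff G (i - i')) (j - j') \<noteq> 0"
    by auto
  then have "int (i' + j') = d" "int (i - i' + (j - j')) = e"
    by (auto dest: homog_part_degree[OF assms(1)] homog_part_degree[OF assms(2)] simp del: of_nat_add)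
  ultimately show "int (i + j) = d + e" by linarith
qed

lemma homog_part_mult':
  "F \<in> homog_part d \<Longrightarrow> G \<in> homog_part e \<Longrightarrow> d + e = c \<Longrightarrow> F * G \<in> homog_part c"
  using homog_part_mult by blast

lemma homog_part_const: "[:[:c:]:] \<in> homog_part 0"
  by (auto simp: homog_part_def coeff_pCons split: nat.splits)

lemma homog_part_1: "1 \<in> homog_part 0"
  using homog_part_const[of 1] by (simp add: one_pCons)

lemma homog_part_power: "F \<in> homog_part d \<Longrightarrow> F ^ n \<in> homog_part (int n * d)"
  by (induction n) (auto simp: homog_part_1 algebra_simps intro: homog_part_mult')

lemma homog_part_neg: "F \<in> homog_part d \<Longrightarrow> d < 0 \<Longrightarrow> F = 0"
  by (rule bipoly_eqI) (simp add: homog_partD)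

lemma homog_part_zeroD:
  assumes "F \<in> homog_part 0" shows "\<exists>c. F = [:[:c:]:]"
proof
  show "F = [:[:coeff (coeff F 0) 0:]:]"
    using assms by (intro bipoly_eqI) (auto simp: coeff_pCons homog_partD split: nat.splits)
qed

lemma homog_part_nonneg: "F \<in> homog_part d \<Longrightarrow> F \<noteq> 0 \<Longrightarrow> 0 \<le> d"
  using homog_part_neg by force

lemma total_degree_homog:
  assumes "F \<in> homog_part d" "F \<noteq> 0"
  shows "int (total_degree F) = d"
proof -
  obtain i j where ij: "coeff (coeff F i) j \<noteq> 0"
    using assms(2) by (metis bipoly_eqI coeff_0)
  have "i' + j' = i + j" if "coeff (coeff F i') j' \<noteq> 0" for i' j'
    using homog_part_degree[OF assms(1) that] homog_part_degree[OF assms(1) ij] by linarith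
  then have "{i + j | i j. coeff (coeff F i) j \<noteq> 0} = {i + j}"
    using ij by blast
  then show ?thesis
    using assms(1) ij by (simp add: total_degree_def homog_part_def)
qed

lemma var_x_homog: "var_x \<in> homog_part 1"
  and var_y_homog: "var_y \<in> homog_part 1"
  by (auto simp: homog_part_def var_x_def var_y_def coeff_pCons split: nat.splits)

definition homog_comp :: "int \<Rightarrow> 'k::field bipoly \<Rightarrow> 'k bipoly" where
  "homog_comp d F = (\<Sum>i\<le>degree F.
     monom (if int i \<le> d then monom (coeff (coeff F i) (nat (d - int i))) (nat (d - int i)) else 0) i)"

lemma coeff_homog_comp:
  "coeff (coeff (homog_comp d F) i) j = (if int (i + j) = d then coeff (coeff F i) j else 0)"
proof -
  have "coeff (homog_comp d F) i = (\<Sum>i'\<le>degree F. if i' = i then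
      (if int i' \<le> d then monom (coeff (coeff F i') (nat (d - int i'))) (nat (d - int i')) else 0) else 0)"
    unfolding homog_comp_def coeff_sum by (intro sum.cong) auto
  also have "\<dots> = (if i \<le> degree F \<and> int i \<le> d
      then monom (coeff (coeff F i) (nat (d - int i))) (nat (d - int i)) else 0)"
    by (auto simp: sum.delta')
  finally show ?thesis
    by (auto simp: coeff_eq_0)
qed

lemma homog_comp_in [simp]: "homog_comp d F \<in> homog_part d"
  by (simp add: homog_part_def coeff_homog_comp)

lemma homog_comp_id: "F \<in> homog_part d \<Longrightarrow> homog_comp d F = F"
  by (rule bipoly_eqI) (auto simp: coeff_homog_comp homog_part_def)

lemma homog_comp_add: "homog_comp d (F + G) = homog_comp d F + homog_comp d G"
  by (rule bipoly_eqI) (simp add: coeff_homog_comp)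

lemma homog_comp_mult:
  assumes "G \<in> homog_part e"
  shows "homog_comp d (F * G) = homog_comp (d - e) F * G"
proof (rule bipoly_eqI)
  fix i j
  have *: "(if int (i + j) = d then coeff (coeff F i') j' * coeff (coeff G (i - i')) (j - j') else 0)
      = coeff (coeff (homog_comp (d - e) F) i') j' * coeff (coeff G (i - i')) (j - j')"
    if "i' \<le> i" "j' \<le> j" for i' j'
  proof (cases "coeff (coeff G (i - i')) (j - j') = 0")
    case False
    then have "int (i - i' + (j - j')) = e"
      by (rule homog_part_degree[OF assms])
    then have "int (i + j) = d \<longleftrightarrow> int (i' + j') = d - e" using that by linarith
    then show ?thesis unfolding coeff_homog_comp by (cases "int (i + j) = d") (simp_all del: of_nat_add)
  qed simp
  have "coeff (coeff (homog_comp d (F * G)) i) j = (\<Sum>i'\<le>i. \<Sum>j'\<le>j.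
     (if int (i + j) = d then coeff (coeff F i') j' * coeff (coeff G (i - i')) (j - j') else 0))"
    by (simp add: coeff_homog_comp coeff_coeff_mult)
  also have "\<dots> = coeff (coeff (homog_comp (d - e) F * G) i) j"
    unfolding coeff_coeff_mult by (intro sum.cong refl *) auto
  finally show "coeff (coeff (homog_comp d (F * G)) i) j
    = coeff (coeff (homog_comp (d - e) F * G) i) j" .
qed

lemma homog_part_cancel:
  assumes "F * G \<in> homog_part d" "G \<in> homog_part e" "G \<noteq> 0"
  shows "F \<in> homog_part (d - e)"
proof -
  have "homog_comp (d - e) F * G = F * G"
    using homog_comp_mult[OF assms(2), of d F] homog_comp_id[OF assms(1)] by metis
  then have "homog_comp (d - e) F = F" using assms(3) mult_right_cancel by blast
  then show ?thesis using homog_comp_in[of "d - e" F] by simp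
qed

lemma linear_formE:
  assumes "linear_form l"
  obtains \<alpha> \<beta> where "l = [:[:0, \<alpha>:], [:\<beta>:]:]" "\<alpha> \<noteq> 0 \<or> \<beta> \<noteq> 0"
proof -
  obtain d where d: "l \<noteq> 0" "l \<in> homog_part d"
    using assms by (auto simp: linear_form_def is_form_def)
  then have 1: "l \<in> homog_part 1"
    using total_degree_homog[OF d(2,1)] assms by (auto simp: linear_form_def)
  have "l = [:[:0, coeff (coeff l 0) 1:], [:coeff (coeff l 1) 0:]:]"
    using 1 by (intro bipoly_eqI) (auto simp: coeff_pCons homog_partD split: nat.splits)
  then show ?thesis using that d(1) by (metis pCons_0_0)
qed

lemma linear_form_homog: "linear_form l \<Longrightarrow> l \<in> homog_part 1" and linear_form_nz: "linear_form l \<Longrightarrow> l \<noteq> 0"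
  using total_degree_homog by (fastforce simp: linear_form_def is_form_def)+

lemma linear_form_not_unit: "linear_form l \<Longrightarrow> \<not> l dvd 1"
  by (erule linear_formE) (auto simp: is_unit_poly_iff)

lemma unit_mult_dvd: "l = u * v \<Longrightarrow> u dvd 1 \<Longrightarrow> l dvd X \<longleftrightarrow> v dvd X"
  for l :: "'a::algebraic_semidom"
  by (simp add: mult_unit_dvd_iff')

lemma linear_form_prime:
  assumes "linear_form l" "l dvd P * Q"
  shows "l dvd P \<or> l dvd Q"
proof -
  obtain \<alpha> \<beta> where l: "l = [:[:0, \<alpha>:], [:\<beta>:]:]" "\<alpha> \<noteq> 0 \<or> \<beta> \<noteq> 0"
    using linear_formE[OF assms(1)] .
  show ?thesis
  proof (cases "\<beta> = 0")
    case True
    then have "prime_elem l"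
      using l by (auto simp: prime_elem_const_poly_iff prime_elem_linear_field_poly)
    then show ?thesis using assms(2) by (simp add: prime_elem_dvd_mult_iff)
  next
    case False
    have "l = [:[:\<beta>:]:] * [:- [:0, - \<alpha> / \<beta>:], 1:]"
      using False l by simp
    moreover have "[:[:\<beta>:]:] dvd 1"
      using False by (simp add: is_unit_poly_iff dvd_field_iff)
    ultimately have *: "l dvd X \<longleftrightarrow> poly X [:0, - \<alpha> / \<beta>:] = 0" for X
      by (subst poly_eq_0_iff_dvd) (rule unit_mult_dvd)
    show ?thesis using assms(2) by (simp add: *)
  qed
qed

lemma linear_form_dvd_power:
  "linear_form l \<Longrightarrow> l dvd P ^ n \<Longrightarrow> l dvd P"
  by (induction n) (auto dest: linear_form_prime linear_form_not_unit)

text \<open>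
  The quotient by a linear form is a polynomial ring in one variable, so each of its graded pieces is
  spanned by a power of the image of a second linear form.
\<close>

lemma linear_form_reduce:
  assumes "linear_form l"
  obtains w where "w \<in> homog_part 1" "\<And>C d. C \<in> homog_part (int d) \<Longrightarrow> \<exists>\<kappa>. l dvd C - [:[:\<kappa>:]:] * w ^ d"
proof -
  obtain \<alpha> \<beta> where l: "l = [:[:0, \<alpha>:], [:\<beta>:]:]" "\<alpha> \<noteq> 0 \<or> \<beta> \<noteq> 0"
    using linear_formE[OF assms] .
  show ?thesis
  proof (cases "\<beta> = 0")
    case True
    show ?thesis
    proof (rule that[OF var_y_homog])
      fix C :: "'a bipoly" and d assume C: "C \<in> homog_part (int d)"
      let ?E = "C - [:[:coeff (coeff C d) 0:]:] * var_y ^ d"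
      have y: "var_y ^ d = (monom 1 d :: 'a bipoly)" 
        by (simp add: var_y_def monom_altdef)
      have "[:0, \<alpha>:] dvd coeff ?E i" for i
      proof -
        have z: "coeff (coeff ?E i) 0 = 0"
          using C by (auto simp: y homog_partD smult_monom)
        have "[:- 0, 1:] dvd coeff ?E i" 
          using z by (subst poly_eq_0_iff_dvd[symmetric]) (simp only: poly_0_coeff_0)
        moreover have "[:0, \<alpha>:] = [:\<alpha>:] * [:- 0, 1:]" "[:\<alpha>:] dvd 1"
          using l True by (auto simp: is_unit_poly_iff dvd_field_iff)
        ultimately show ?thesis using unit_mult_dvd by blast
      qed
      then have "l dvd ?E" using l True by (simp add: const_poly_dvd_iff)
      then show "\<exists>\<kappa>. l dvd C - [:[:\<kappa>:]:] * var_y ^ d" by blast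
    qed
  next
    case False
    show ?thesis
    proof (rule that[OF var_x_homog])
      fix C :: "'a bipoly" and d assume C: "C \<in> homog_part (int d)"
      let ?c = "[:0, - \<alpha> / \<beta>:]"
      let ?k = "\<Sum>i\<le>degree C. coeff (coeff C i) (d - i) * (- \<alpha> / \<beta>) ^ i"
      have c: "?c ^ i = monom ((- \<alpha> / \<beta>) ^ i) i" for i
      proof -
        have "?c = monom (- \<alpha> / \<beta>) 1" by (simp add: monom_Suc monom_0)
        then show ?thesis by (simp only: monom_power mult_1)
      qed
      have co: "coeff C i = (if i \<le> d then monom (coeff (coeff C i) (d - i)) (d - i) else 0)" for i
        using C by (auto simp: poly_eq_iff homog_partD)
      have "poly C ?c = (\<Sum>i\<le>degree C. monom (coeff (coeff C i) (d - i) * (- \<alpha> / \<beta>) ^ i) d)"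
        unfolding poly_altdef
      proof (intro sum.cong refl)
        fix i
        show "coeff C i * ?c ^ i = monom (coeff (coeff C i) (d - i) * (- \<alpha> / \<beta>) ^ i) d"
        proof (cases "i \<le> d")
          case True
          then have "coeff C i = monom (coeff (coeff C i) (d - i)) (d - i)" using co[of i] by simp
          then have "coeff C i * ?c ^ i = monom (coeff (coeff C i) (d - i)) (d - i) * monom ((- \<alpha> / \<beta>) ^ i) i"
            using c by metis
          then show ?thesis using True by (simp add: mult_monom)
        next
          case False
          then have "coeff C i = 0" using co[of i] by simp
          then show ?thesis by simp
        qed
      qed
      also have "\<dots> = monom ?k d"
        by (simp add: monom_sum)
      also have "\<dots> = poly ([:[:?k:]:] * var_x ^ d) ?c"
        by (simp add: var_x_def monom_altdef)
      finally have "poly (C - [:[:?k:]:] * var_x ^ d) ?c = 0" by simp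
      then have "[:- ?c, 1:] dvd C - [:[:?k:]:] * var_x ^ d"
        by (simp only: poly_eq_0_iff_dvd)
      moreover have "l = [:[:\<beta>:]:] * [:- ?c, 1:]" "[:[:\<beta>:]:] dvd 1"
        using False l by (auto simp: is_unit_poly_iff dvd_field_iff)
      ultimately have "l dvd C - [:[:?k:]:] * var_x ^ d"
        using unit_mult_dvd by blast
      then show "\<exists>\<kappa>. l dvd C - [:[:\<kappa>:]:] * var_x ^ d" by blast
    qed
  qed
qed

lemma linear_form_eliminate:
  assumes "linear_form l" "C1 \<in> homog_part d1" "C2 \<in> homog_part d2" "d1 \<le> d2" "\<not> l dvd C1"
  obtains w where "w \<in> homog_part (d2 - d1)" "l dvd C2 - w * C1"
proof -
  obtain w where w: "w \<in> homog_part 1"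
      "\<And>C d. C \<in> homog_part (int d) \<Longrightarrow> \<exists>\<kappa>. l dvd C - [:[:\<kappa>:]:] * w ^ d"
    using linear_form_reduce[OF assms(1)] by metis
  have "0 \<le> d1" using homog_part_nonneg[OF assms(2)] assms(5) by auto
  define e1 where "e1 = nat d1"
  define e2 where "e2 = nat (d2 - d1)"
  have e: "d1 = int e1" "d2 = int (e1 + e2)"
    using assms(4) \<open>0 \<le> d1\<close> by (auto simp: e1_def e2_def)
  obtain k1 where k1: "l dvd C1 - [:[:k1:]:] * w ^ e1"
    using w(2)[of C1 e1] assms(2) e(1) by auto
  obtain k2 where k2: "l dvd C2 - [:[:k2:]:] * w ^ (e1 + e2)"
    using w(2)[of C2 "e1 + e2"] assms(3) e(2) by auto
  have "k1 \<noteq> 0" using k1 assms(5) by auto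
  define X where "X = [:[:k2 / k1:]:]"
  define K1 where "K1 = [:[:k1:]:]"
  define K2 where "K2 = [:[:k2:]:]"
  have XK: "X * K1 = K2" using \<open>k1 \<noteq> 0\<close> by (simp add: X_def K1_def K2_def)
  have X: "X \<in> homog_part 0" unfolding X_def by (rule homog_part_const)
  define v where "v = X * w ^ e2"
  have "v * (K1 * w ^ e1) = K2 * w ^ (e1 + e2)"
    unfolding XK[symmetric] v_def power_add by (simp only: mult_ac)
  then have "C2 - v * C1 = (C2 - K2 * w ^ (e1 + e2)) - v * (C1 - K1 * w ^ e1)"
    by (simp add: algebra_simps)
  then have "l dvd C2 - v * C1" 
    using k1 k2 dvd_diff dvd_mult unfolding K1_def[symmetric] K2_def[symmetric] by metis
  moreover have "v \<in> homog_part (d2 - d1)"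
    unfolding v_def using homog_part_power[OF w(1), of e2] e
    by (auto intro: homog_part_mult'[OF X])
  ultimately show ?thesis using that by blast
qed

section \<open>Ideals with two generators\<close>

lemma module_mult: "Modules.module ((*) :: 'a::comm_ring_1 \<Rightarrow> 'a \<Rightarrow> 'a)"
  by unfold_locales (auto simp: algebra_simps)

lemma ideal_gen_1: "ideal_gen {1 :: 'a::comm_ring_1} = UNIV"
  using module.span_scale[OF module_mult module.span_base[OF module_mult, of 1 "{1 :: 'a}"]] by auto

lemma in_ideal_gen2:
  fixes U V :: "'a::comm_ring_1"
  shows "f \<in> ideal_gen {U, V} \<longleftrightarrow> (\<exists>r s. f = r * U + s * V)"
proof -
  have "f \<in> ideal_gen {U, V} \<longleftrightarrow> (\<exists>r s. f - r * U - s * V = 0)"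
    by (simp add: module.span_breakdown_eq[OF module_mult] module.span_empty[OF module_mult])
  also have "\<dots> \<longleftrightarrow> (\<exists>r s. f = r * U + s * V)"
    by (simp add: algebra_simps)
  finally show ?thesis .
qed

lemma ideal_gen2_mult: "f \<in> ideal_gen {U, V} \<Longrightarrow> r * f \<in> ideal_gen {U, V :: 'a::comm_ring_1}"
  by (rule module.span_scale[OF module_mult])

lemma frob_power_gen2:
  fixes U V :: "'a::comm_ring_1"
  assumes "prime CHAR('a)" "q = CHAR('a) ^ s"
  shows "frob_power q (ideal_gen {U, V}) = ideal_gen {U ^ q, V ^ q}"
  unfolding frob_power_def
proof (rule antisym)
  show "ideal_gen {f ^ q |f. f \<in> ideal_gen {U, V}} \<subseteq> ideal_gen {U ^ q, V ^ q}"
  proof (rule module.span_minimal[OF module_mult _ module.subspace_span[OF module_mult]])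
    show "{f ^ q |f. f \<in> ideal_gen {U, V}} \<subseteq> ideal_gen {U ^ q, V ^ q}"
      using freshmans_dream'[OF assms] by (auto simp: in_ideal_gen2 power_mult_distrib) blast
  qed
  have "U \<in> ideal_gen {U, V}" "V \<in> ideal_gen {U, V}"
    by (auto intro: module.span_base[OF module_mult])
  then show "ideal_gen {U ^ q, V ^ q} \<subseteq> ideal_gen {f ^ q |f. f \<in> ideal_gen {U, V}}"
    by (intro module.span_mono[OF module_mult]) auto
qed

text \<open>
  Only the trivial relations; for \<open>F \<noteq> 0\<close> in a domain, \<open>G\<close> is then a nonzerodivisor modulo \<open>F\<close>.
\<close>

definition regular_pair :: "'a::comm_ring_1 \<Rightarrow> 'a \<Rightarrow> bool" where
  "regular_pair F G \<longleftrightarrow> (\<forall>A B. A * F + B * G = 0 \<longrightarrow> (\<exists>w. A = w * G \<and> B = - w * F))"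

text \<open>
  For a proper homogeneous ideal: being primary to \<open>\<langle>x, y\<rangle>\<close>.
\<close>

definition irrelevant_primary :: "'k::field bipoly set \<Rightarrow> bool" where
  "irrelevant_primary I \<longleftrightarrow> (\<exists>N. var_x ^ N \<in> I \<and> var_y ^ N \<in> I)"

lemma var_x_power: "var_x ^ N = [:monom 1 N:]"
proof (induction N)
  case (Suc N)
  then show ?case by (simp add: var_x_def monom_Suc)
qed (simp add: one_pCons)

lemma var_y_power: "var_y ^ N = monom 1 N"
  by (simp add: var_y_def monom_altdef)

text \<open>
  From \<open>x\<^sup>N A = V w\<^sub>1\<close> and \<open>y\<^sup>N A = V w\<^sub>2\<close> it follows that \<open>y\<^sup>N w\<^sub>1 = x\<^sup>N w\<^sub>2\<close>, and a comparison of coefficients shows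
  that \<open>x\<^sup>N\<close> divides \<open>w\<^sub>1\<close>.
\<close>

lemma dvd_of_dvd_var_powers:
  assumes "V dvd var_x ^ N * A" "V dvd var_y ^ N * A" "V \<noteq> 0"
  shows "V dvd A"
proof -
  obtain w1 w2 where w: "var_x ^ N * A = V * w1" "var_y ^ N * A = V * w2"
    using assms by (auto simp: dvd_def)
  have "V * (var_y ^ N * w1) = var_y ^ N * (V * w1)" by (simp only: mult_ac)
  also have "\<dots> = var_x ^ N * (V * w2)"
    unfolding w[symmetric] by (simp only: mult_ac)
  also have "\<dots> = V * (var_x ^ N * w2)" by (simp only: mult_ac)
  finally have "var_y ^ N * w1 = var_x ^ N * w2" using assms(3) mult_left_cancel by blast
  then have "var_x ^ N dvd var_y ^ N * w1" by simp
  then have "monom 1 N dvd coeff (monom 1 N * w1) (i + N)" for i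
    unfolding var_x_power var_y_power const_poly_dvd_iff by blast
  then have "var_x ^ N dvd w1"
    by (simp add: var_x_power const_poly_dvd_iff coeff_monom_mult)
  then obtain w where "w1 = var_x ^ N * w" by (auto simp: dvd_def)
  then have "var_x ^ N * A = var_x ^ N * (V * w)" using w(1) by (simp only: mult_ac)
  moreover have "var_x ^ N \<noteq> (0 :: 'a bipoly)" by (simp add: var_x_power)
  ultimately have "A = V * w" using mult_left_cancel by blast
  then show ?thesis by simp
qed

lemma common_divisor_unit:
  assumes "irrelevant_primary (ideal_gen {U, V})" "d dvd U" "d dvd V"
  shows "d dvd 1"
proof -
  obtain N where N: "var_x ^ N \<in> ideal_gen {U, V}" "var_y ^ N \<in> ideal_gen {U, V}"
    using assms(1) by (auto simp: irrelevant_primary_def)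
  have "d dvd var_x ^ N" "d dvd var_y ^ N"
    using N assms(2,3) by (auto simp: in_ideal_gen2)
  moreover have "d \<noteq> 0" using \<open>d dvd var_x ^ N\<close> by (auto simp: var_x_power)
  ultimately show ?thesis using dvd_of_dvd_var_powers[of d N 1] by simp
qed

text \<open>
  If \<open>A U + B V = 0\<close> then \<open>V\<close> divides \<open>A\<close> times every element of \<open>\<langle>U, V\<rangle>\<close>, in particular \<open>x\<^sup>N A\<close> and
  \<open>y\<^sup>N A\<close>.
\<close>

lemma irrelevant_primary_regular:
  assumes "irrelevant_primary (ideal_gen {U, V})"
  shows "regular_pair U V"
  unfolding regular_pair_def
proof (intro allI impI)
  fix A B assume AB: "A * U + B * V = 0"
  obtain N where N: "var_x ^ N \<in> ideal_gen {U, V}" "var_y ^ N \<in> ideal_gen {U, V}"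
    using assms by (auto simp: irrelevant_primary_def)
  have dv: "V dvd r * A" "U dvd r * B" if "r \<in> ideal_gen {U, V}" for r
  proof -
    obtain a b where r: "r = a * U + b * V" using \<open>r \<in> _\<close> by (auto simp: in_ideal_gen2)
    have "r * A = a * (A * U + B * V) + V * (b * A - a * B)"
      "r * B = b * (A * U + B * V) + U * (a * B - b * A)"
      unfolding r by (simp_all add: algebra_simps)
    then show "V dvd r * A" "U dvd r * B" unfolding AB by simp_all
  qed
  show "\<exists>w. A = w * V \<and> B = - w * U"
  proof (cases "V = 0")
    case False
    then have "V dvd A" using dvd_of_dvd_var_powers dv N by blast
    then obtain w where w: "A = V * w" by (auto simp: dvd_def)
    have "V * (w * U + B) = 0" using AB unfolding w by (simp add: algebra_simps)
    then have "w * U + B = 0" using False by simp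
    then show ?thesis using w by (intro exI[of _ w]) (simp add: eq_neg_iff_add_eq_0 add.commute mult.commute)
  next
    case True
    have "U \<noteq> 0" using N(1) True by (auto simp: in_ideal_gen2 var_x_power)
    then have "U dvd B" using dvd_of_dvd_var_powers dv N by blast
    then obtain w where w: "B = U * w" by (auto simp: dvd_def)
    have "A = 0" using AB True \<open>U \<noteq> 0\<close> by simp
    then show ?thesis using w True by (intro exI[of _ "- w"]) simp
  qed
qed

section \<open>Hilbert--Burch matrices\<close>

lemma homog_coefficients:
  assumes "A = r * A1 + s * A2" "A \<in> homog_part (d - f)" "A1 \<in> homog_part (m - f)" "A2 \<in> homog_part (n - f)"
  shows "A = homog_comp (d - m) r * A1 + homog_comp (d - n) s * A2"
  using homog_comp_id[OF assms(2)] unfolding assms(1)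
  by (simp add: homog_comp_add homog_comp_mult[OF assms(3)] homog_comp_mult[OF assms(4)])

lemma regular_pair_degree:
  assumes "regular_pair F G" "A * F + B * G = 0" "A \<in> homog_part (d - f)" "B \<in> homog_part (d - g)"
    and "G \<in> homog_part g" "G \<noteq> 0" "A \<noteq> 0 \<or> B \<noteq> 0"
  shows "f + g \<le> d"
proof -
  obtain w where w: "A = w * G" "B = - w * F" using assms(1,2) unfolding regular_pair_def by blast
  then have "w \<noteq> 0" using assms(7) by auto
  have "w \<in> homog_part (d - f - g)"
    using homog_part_cancel[of w G "d - f" g] w assms(3,5,6) by simp
  then show ?thesis using homog_part_nonneg[of w] \<open>w \<noteq> 0\<close> by force
qed

text \<open>
  As \<open>F, G, H\<close> are the signed minors of the matrix, its two columns are automatically syzygies of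
  \<open>(F, G, H)\<close>, and the equation for the degrees is the homogeneity of the minors.
\<close>

locale hilbert_burch =
  fixes F G H :: "'k::field bipoly" and f g h m n :: int and A1 B1 C1 A2 B2 C2 :: "'k bipoly"
  assumes A1: "A1 \<in> homog_part (m - f)" and B1: "B1 \<in> homog_part (m - g)" and C1: "C1 \<in> homog_part (m - h)"
    and A2: "A2 \<in> homog_part (n - f)" and B2: "B2 \<in> homog_part (n - g)" and C2: "C2 \<in> homog_part (n - h)"
    and F: "F = B1 * C2 - B2 * C1" and G: "G = C1 * A2 - C2 * A1" and H: "H = A1 * B2 - A2 * B1"
    and sum_deg: "m + n = f + g + h"
begin

lemma syz1: "A1 * F + B1 * G + C1 * H = 0" and syz2: "A2 * F + B2 * G + C2 * H = 0"
  unfolding F G H by (simp_all add: algebra_simps)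

lemma syz_combine: "(r * A1 + s * A2) * F + (r * B1 + s * B2) * G + (r * C1 + s * C2) * H = 0"
proof -
  have "(r * A1 + s * A2) * F + (r * B1 + s * B2) * G + (r * C1 + s * C2) * H
    = r * (A1 * F + B1 * G + C1 * H) + s * (A2 * F + B2 * G + C2 * H)"
    by (simp add: algebra_simps)
  then show ?thesis by (simp add: syz1 syz2)
qed

lemma deg_F: "F \<in> homog_part f" and deg_G: "G \<in> homog_part g" and deg_H: "H \<in> homog_part h"
  unfolding F G H using A1 B1 C1 A2 B2 C2 sum_deg
  by (auto intro!: homog_part_diff elim!: homog_part_mult')

lemma swap: "hilbert_burch F G H f g h n m A2 B2 C2 (- A1) (- B1) (- C1)"
  using A1 B1 C1 A2 B2 C2 sum_deg
  by unfold_locales (auto simp: F G H algebra_simps homog_part_uminus)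

lemma power:
  assumes "prime CHAR('k)" "q = CHAR('k) ^ t"
  shows "hilbert_burch (F ^ q) (G ^ q) (H ^ q) (int q * f) (int q * g) (int q * h) (int q * m) (int q * n)
    (A1 ^ q) (B1 ^ q) (C1 ^ q) (A2 ^ q) (B2 ^ q) (C2 ^ q)"
proof
  have minor: "(a * d - b * c) ^ q = a ^ q * d ^ q - b ^ q * c ^ q" for a b c d :: "'k bipoly"
  proof -
    have "((a * d - b * c) + b * c) ^ q = (a * d - b * c) ^ q + (b * c) ^ q"
      by (rule freshmans_dream') (use assms in auto)
    then show ?thesis by (simp add: power_mult_distrib)
  qed
  show "F ^ q = B1 ^ q * C2 ^ q - B2 ^ q * C1 ^ q" unfolding F by (rule minor)
  show "G ^ q = C1 ^ q * A2 ^ q - C2 ^ q * A1 ^ q" unfolding G by (rule minor)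
  show "H ^ q = A1 ^ q * B2 ^ q - A2 ^ q * B1 ^ q" unfolding H by (rule minor)
  show "int q * m + int q * n = int q * f + int q * g + int q * h"
    using sum_deg by (metis distrib_left)
qed (unfold right_diff_distrib[symmetric], (intro homog_part_power A1 B1 C1 A2 B2 C2)+)

lemma eliminate:
  assumes "w \<in> homog_part (n - m)"
  shows "hilbert_burch F G H f g h m n A1 B1 C1 (A2 - w * A1) (B2 - w * B1) (C2 - w * C1)"
  using A1 B1 C1 A2 B2 C2 sum_deg assms
  by unfold_locales (auto simp: F G H algebra_simps intro!: homog_part_diff elim!: homog_part_mult')

lemma divide_column:
  assumes "l \<in> homog_part 1" "l \<noteq> 0" "C2 = D * l"
  shows "hilbert_burch F G (l * H) f g (h + 1) (m + 1) n (l * A1) (l * B1) C1 A2 B2 D"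
proof
  have "D \<in> homog_part (n - h - 1)"
    using homog_part_cancel[of D l "n - h" 1] C2 assms by simp
  then show "D \<in> homog_part (n - (h + 1))" by (simp add: algebra_simps)
  show "F = l * B1 * D - B2 * C1" "G = C1 * A2 - D * (l * A1)" "l * H = l * A1 * B2 - A2 * (l * B1)"
    unfolding F G H assms(3) by (simp_all add: algebra_simps)
qed (use A1 B1 C1 A2 B2 sum_deg assms in \<open>auto elim!: homog_part_mult'[of l 1]\<close>)

end

locale syzygies = hilbert_burch +
  assumes reg: "regular_pair F G" and nonzero: "F \<noteq> 0" "G \<noteq> 0" "H \<noteq> 0"
begin

lemma independent:
  assumes "r * A1 + s * A2 = 0" "r * B1 + s * B2 = 0"
  shows "r = 0 \<and> s = 0"
proof -
  have "r * H = (r * A1 + s * A2) * B2 - A2 * (r * B1 + s * B2)"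
    "s * H = A1 * (r * B1 + s * B2) - (r * A1 + s * A2) * B1"
    unfolding H by (simp_all add: algebra_simps)
  then have "r * H = 0" "s * H = 0" unfolding assms by simp_all
  then show ?thesis using nonzero by simp
qed

text \<open>
  Both syzygies are orthogonal to \<open>(F, G, H)\<close>, so their cross product is proportional to this vector; the
  factor is a polynomial because \<open>F\<close> and \<open>G\<close> have only trivial relations.
\<close>

lemma parallel:
  assumes "A * F + B * G + C * H = 0" "A' * F + B' * G + C' * H = 0"
  obtains w where "A * B' - B * A' = w * H"
proof -
  have "(A * C' - C * A') * F + (B * C' - C * B') * G
    = C' * (A * F + B * G + C * H) - C * (A' * F + B' * G + C' * H)"
    by (simp add: algebra_simps)
  then have "(A * C' - C * A') * F + (B * C' - C * B') * G = 0" unfolding assms by simp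
  then obtain w where w: "B * C' - C * B' = - w * F" using reg unfolding regular_pair_def by blast
  have "F * (A * B' - B * A' - (- w) * H)
    = B' * (A * F + B * G + C * H) - B * (A' * F + B' * G + C' * H) + H * ((B * C' - C * B') + w * F)"
    by (simp add: algebra_simps)
  also have "\<dots> = 0" unfolding assms w by simp
  finally have "A * B' - B * A' = (- w) * H" using nonzero by (simp add: eq_neg_iff_add_eq_0)
  then show ?thesis by (rule that)
qed

text \<open>
  Cramer's rule: the coefficients are, up to sign, the factors in the cross products with the two columns.
\<close>

lemma spanning:
  assumes "A * F + B * G + C * H = 0"
  obtains r s where "A = r * A1 + s * A2" "B = r * B1 + s * B2" "C = r * C1 + s * C2"
proof -
  obtain s where s: "A * B1 - B * A1 = s * H" using parallel[OF assms syz1] .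
  obtain r where r: "A * B2 - B * A2 = r * H" using parallel[OF assms syz2] .
  have "H * A = (A * B2 - B * A2) * A1 - (A * B1 - B * A1) * A2"
    "H * B = (A * B2 - B * A2) * B1 - (A * B1 - B * A1) * B2"
    by (simp_all add: H algebra_simps)
  then have "H * A = H * (r * A1 + (- s) * A2)" "H * B = H * (r * B1 + (- s) * B2)"
    unfolding r s by (simp_all add: algebra_simps)
  then have AB: "A = r * A1 + (- s) * A2" "B = r * B1 + (- s) * B2"
    using nonzero mult_left_cancel by blast+
  have "C * H = (r * C1 + (- s) * C2) * H"
    using assms syz_combine[of r "- s"] unfolding AB by (metis add_left_cancel)
  then have "C = r * C1 + (- s) * C2" using nonzero mult_right_cancel by blast
  then show ?thesis using AB that by blast
qed

lemma spanning_homog: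
  assumes "A * F + B * G + C * H = 0"
    and "A \<in> homog_part (d - f)" "B \<in> homog_part (d - g)" "C \<in> homog_part (d - h)"
  obtains r s where "r \<in> homog_part (d - m)" "s \<in> homog_part (d - n)"
    "A = r * A1 + s * A2" "B = r * B1 + s * B2" "C = r * C1 + s * C2"
proof -
  obtain r s where rs: "A = r * A1 + s * A2" "B = r * B1 + s * B2" "C = r * C1 + s * C2"
    using spanning[OF assms(1)] .
  show ?thesis
    using that[OF homog_comp_in homog_comp_in] homog_coefficients[OF rs(1) assms(2) A1 A2]
      homog_coefficients[OF rs(2) assms(3) B1 B2] homog_coefficients[OF rs(3) assms(4) C1 C2] by blast
qed

lemma colon: "ideal_colon (ideal_gen {F, G}) H = ideal_gen {C1, C2}"
proof (rule antisym; rule subsetI)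
  fix c assume "c \<in> ideal_colon (ideal_gen {F, G}) H"
  then obtain A B where "c * H = A * F + B * G" by (auto simp: ideal_colon_def in_ideal_gen2)
  then have "(- A) * F + (- B) * G + c * H = 0" by simp
  then show "c \<in> ideal_gen {C1, C2}" using spanning in_ideal_gen2 by metis
next
  fix c assume "c \<in> ideal_gen {C1, C2}"
  then obtain r s where c: "c = r * C1 + s * C2" by (auto simp: in_ideal_gen2)
  have "c * H = - (r * A1 + s * A2) * F + - (r * B1 + s * B2) * G"
    using syz_combine[of r s] unfolding c by (simp add: algebra_simps eq_neg_iff_add_eq_0)
  then show "c \<in> ideal_colon (ideal_gen {F, G}) H"
    unfolding ideal_colon_def in_ideal_gen2 by blast
qed

text \<open>
  A syzygy with last component \<open>0\<close> is a relation between \<open>F\<close> and \<open>G\<close>, hence of degree at least \<open>f + g\<close>.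
\<close>

lemma C1_nonzero: "m < f + g \<Longrightarrow> C1 \<noteq> 0"
  using regular_pair_degree[OF reg _ A1 B1 deg_G] syz1 F G nonzero by fastforce

text \<open>
  The syzygy \<open>(G, -F, 0)\<close> has degree \<open>f + g\<close>.
\<close>

lemma min_degree_le: "m \<le> n \<Longrightarrow> m \<le> f + g"
proof -
  assume mn: "m \<le> n"
  have "G * F + (- F) * G + 0 * H = 0" by simp
  moreover have "G \<in> homog_part (f + g - f)" "- F \<in> homog_part (f + g - g)"
    using deg_F deg_G by (auto simp: homog_part_uminus)
  ultimately obtain r s where "r \<in> homog_part (f + g - m)" "s \<in> homog_part (f + g - n)" "G = r * A1 + s * A2"
    using spanning_homog[of G "- F" 0 "f + g"] homog_part_0 by metis
  then show ?thesis using nonzero(2) homog_part_neg[of r "f + g - m"] homog_part_neg[of s "f + g - n"] mn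
    by fastforce
qed

text \<open>
  \<open>H\<close> is in \<open>\<langle>F, G\<rangle>\<close> if and only if some syzygy has last component \<open>1\<close>; if \<open>h \<le> f + g\<close>, the smaller of the
  two degrees is then \<open>h\<close>, so that \<open>|m - n|\<close> detects membership.
\<close>

lemma membership_degrees:
  assumes "m \<le> n" "H \<in> ideal_gen {F, G}" "h \<le> f + g"
  shows "n - m = f + g - h"
proof -
  obtain A B where AB: "H = A * F + B * G" using assms(2) by (auto simp: in_ideal_gen2)
  have "H = homog_comp (h - f) A * F + homog_comp (h - g) B * G"
    using homog_comp_id[OF deg_H] unfolding AB
    by (simp only: homog_comp_add homog_comp_mult[OF deg_F] homog_comp_mult[OF deg_G])
  then have "homog_comp (h - f) A * F + homog_comp (h - g) B * G + (- 1) * H = 0" by simp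
  moreover have "- 1 \<in> homog_part (h - h)" using homog_part_1 homog_part_uminus by simp
  ultimately obtain r s where rs: "r \<in> homog_part (h - m)" "s \<in> homog_part (h - n)" "- 1 = r * C1 + s * C2"
    using spanning_homog[of "homog_comp (h - f) A" "homog_comp (h - g) B" "- 1" h] homog_comp_in by metis
  have mh: "m \<le> h"
    using rs(3) homog_part_neg[OF rs(1)] homog_part_neg[OF rs(2)] assms(1) by fastforce
  moreover have "\<not> m < h"
  proof
    assume "m < h"
    then have "C1 = 0" using homog_part_neg[OF C1] by simp
    then show False using C1_nonzero \<open>m < h\<close> assms(3) by linarith
  qed
  ultimately show ?thesis using sum_deg by linarith
qed

lemma degrees_membership:
  assumes "m \<le> n" "f + g - h \<le> n - m" "h < f + g"
  shows "H \<in> ideal_gen {F, G}"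
proof -
  have mh: "m \<le> h" using assms sum_deg by linarith
  then have "C1 \<noteq> 0" using C1_nonzero assms(3) by linarith
  then have "m = h" using homog_part_nonneg[OF C1] mh by linarith
  then obtain c where c: "C1 = [:[:c:]:]" using C1 homog_part_zeroD by auto
  then have "c \<noteq> 0" using \<open>C1 \<noteq> 0\<close> by auto
  have "[:[:1 / c:]:] * C1 = 1" using \<open>c \<noteq> 0\<close> c by (simp add: one_pCons)
  moreover have "C1 \<in> ideal_gen {C1, C2}" by (auto intro: module.span_base[OF module_mult])
  ultimately have "1 \<in> ideal_gen {C1, C2}" using ideal_gen2_mult by metis
  then show ?thesis unfolding colon[symmetric] by (simp add: ideal_colon_def)
qed

end

definition hb :: "'k::field bipoly \<Rightarrow> 'k bipoly \<Rightarrow> 'k bipoly \<Rightarrow> int \<Rightarrow> int \<Rightarrow> int \<Rightarrow> int \<Rightarrow> int \<Rightarrow> bool" where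
  "hb F G H f g h m n \<longleftrightarrow> (\<exists>A1 B1 C1 A2 B2 C2. hilbert_burch F G H f g h m n A1 B1 C1 A2 B2 C2)"

lemma hb_swap: "hb F G H f g h m n \<Longrightarrow> hb F G H f g h n m"
  unfolding hb_def using hilbert_burch.swap by blast

lemma hb_one: "F \<in> homog_part f \<Longrightarrow> G \<in> homog_part g \<Longrightarrow> hb F G 1 f g 0 f g"
proof -
  assume "F \<in> homog_part f" "G \<in> homog_part g"
  then have "hilbert_burch F G 1 f g 0 f g 1 0 (- F) 0 1 (- G)"
    by unfold_locales (auto simp: homog_part_1 homog_part_uminus)
  then show ?thesis unfolding hb_def by blast
qed

text \<open>
  Multiplying \<open>H\<close> by a linear form \<open>l\<close>: a column operation makes one of \<open>C\<^sub>1, C\<^sub>2\<close> divisible by \<open>l\<close>, and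
  the syzygies of \<open>(F, G, lH)\<close> are those of \<open>(F, G, H)\<close> whose last component is divisible by \<open>l\<close>.
\<close>

lemma hb_linear_step:
  assumes "hb F G H f g h m n" "linear_form l"
  shows "hb F G (l * H) f g (h + 1) (m + 1) n \<or> hb F G (l * H) f g (h + 1) m (n + 1)"
proof -
  have *: "hb F G (l * H) f g (h + 1) (m + 1) n \<or> hb F G (l * H) f g (h + 1) m (n + 1)"
    if hb: "hb F G H f g h m n" and mn: "m \<le> n" for m n
  proof -
    obtain A1 B1 C1 A2 B2 C2 where "hilbert_burch F G H f g h m n A1 B1 C1 A2 B2 C2"
      using hb unfolding hb_def by blast
    then interpret hilbert_burch F G H f g h m n A1 B1 C1 A2 B2 C2 .
    show ?thesis
    proof (cases "l dvd C1")
      case True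
      then obtain D where "- C1 = D * l" by (metis dvd_minus_iff dvdE mult.commute)
      from hilbert_burch.divide_column[OF swap linear_form_homog linear_form_nz this] assms(2)
      have "hb F G (l * H) f g (h + 1) (n + 1) m" unfolding hb_def by blast
      then show ?thesis using hb_swap by blast
    next
      case False
      then obtain w where w: "w \<in> homog_part (n - m)" "l dvd C2 - w * C1"
        using linear_form_eliminate[OF assms(2) C1 C2 _ False] mn by auto
      then obtain D where "C2 - w * C1 = D * l" by (metis dvdE mult.commute)
      from hilbert_burch.divide_column[OF eliminate[OF w(1)] linear_form_homog linear_form_nz this] assms(2)
      show ?thesis unfolding hb_def by blast
    qed
  qed
  show ?thesis
    using *[OF assms(1)] *[OF hb_swap[OF assms(1)]] hb_swap by (metis linear)
qed

section \<open>The syzygy gap\<close>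

text \<open>
  The images of \<open>(1, 0)\<close> and \<open>(0, 1)\<close> in a graded resolution.
\<close>

locale graded_basis =
  fixes F G H :: "'k::field bipoly" and f g h m n :: int and A1 B1 C1 A2 B2 C2 :: "'k bipoly"
  assumes A1: "A1 \<in> homog_part (m - f)" and B1: "B1 \<in> homog_part (m - g)" and C1: "C1 \<in> homog_part (m - h)"
    and A2: "A2 \<in> homog_part (n - f)" and B2: "B2 \<in> homog_part (n - g)" and C2: "C2 \<in> homog_part (n - h)"
    and syz1: "A1 * F + B1 * G + C1 * H = 0" and syz2: "A2 * F + B2 * G + C2 * H = 0"
    and span: "\<And>d A B C. A \<in> homog_part (d - f) \<Longrightarrow> B \<in> homog_part (d - g) \<Longrightarrow>
      C \<in> homog_part (d - h) \<Longrightarrow> A * F + B * G + C * H = 0 \<Longrightarrow>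
      \<exists>r s. r \<in> homog_part (d - m) \<and> s \<in> homog_part (d - n) \<and>
        A = r * A1 + s * A2 \<and> B = r * B1 + s * B2 \<and> C = r * C1 + s * C2"
    and ind: "\<And>r s. r * A1 + s * A2 = 0 \<Longrightarrow> r * B1 + s * B2 = 0 \<Longrightarrow> r * C1 + s * C2 = 0 \<Longrightarrow>
      r = 0 \<and> s = 0"

lemma graded_basis_swap:
  assumes "graded_basis F G H f g h m n A1 B1 C1 A2 B2 C2"
  shows "graded_basis F G H f g h n m A2 B2 C2 A1 B1 C1"
proof -
  interpret graded_basis F G H f g h m n A1 B1 C1 A2 B2 C2 by (rule assms)
  show ?thesis
  proof (unfold_locales; (fact A1 B1 C1 A2 B2 C2 syz1 syz2)?)
    fix d A B C
    assume "A \<in> homog_part (d - f)" "B \<in> homog_part (d - g)" "C \<in> homog_part (d - h)"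
      "A * F + B * G + C * H = 0"
    from span[OF this] show "\<exists>r s. r \<in> homog_part (d - n) \<and> s \<in> homog_part (d - m) \<and>
        A = r * A2 + s * A1 \<and> B = r * B2 + s * B1 \<and> C = r * C2 + s * C1"
      by (metis add.commute)
  next
    fix r s assume "r * A2 + s * A1 = 0" "r * B2 + s * B1 = 0" "r * C2 + s * C1 = 0"
    then show "r = 0 \<and> s = 0" using ind[of s r] by (simp add: add.commute)
  qed
qed

text \<open>The degrees are successive minima: of nonzero syzygies, and of syzygies outside the span of the first.\<close>

lemma graded_basis_minimal:
  assumes 1: "graded_basis F G H f g h m n A1 B1 C1 A2 B2 C2"
    and 2: "graded_basis F G H f g h m' n' A1' B1' C1' A2' B2' C2'"
    and le: "m \<le> n" "m' \<le> n'"
  shows "m \<le> m' \<and> n \<le> n'"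
proof -
  interpret X: graded_basis F G H f g h m n A1 B1 C1 A2 B2 C2 by (rule 1)
  interpret Y: graded_basis F G H f g h m' n' A1' B1' C1' A2' B2' C2' by (rule 2)
  obtain r1 s1 where rs1: "r1 \<in> homog_part (m' - m)" "s1 \<in> homog_part (m' - n)"
      "A1' = r1 * A1 + s1 * A2" "B1' = r1 * B1 + s1 * B2" "C1' = r1 * C1 + s1 * C2"
    using X.span[OF Y.A1 Y.B1 Y.C1 Y.syz1] by metis
  obtain r2 s2 where rs2: "r2 \<in> homog_part (n' - m)" "s2 \<in> homog_part (n' - n)"
      "A2' = r2 * A1 + s2 * A2" "B2' = r2 * B1 + s2 * B2" "C2' = r2 * C1 + s2 * C2"
    using X.span[OF Y.A2 Y.B2 Y.C2 Y.syz2] by metis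
  have nz1: "\<not> (r1 = 0 \<and> s1 = 0)"
    using Y.ind[of 1 0] rs1(3-) by auto
  have "m \<le> m'"
    using nz1 homog_part_nonneg[OF rs1(1)] homog_part_nonneg[OF rs1(2)] le by linarith
  moreover have "n \<le> n'"
  proof (rule ccontr)
    assume "\<not> n \<le> n'"
    then have "s1 = 0" "s2 = 0" using homog_part_neg[OF rs1(2)] homog_part_neg[OF rs2(2)] le by auto
    then have "r2 = 0 \<and> - r1 = 0"
      using rs1(3-) rs2(3-) by (intro Y.ind) (simp_all add: algebra_simps)
    then show False using nz1 \<open>s1 = 0\<close> by simp
  qed
  ultimately show ?thesis by simp
qed

lemma graded_basis_gap_unique:
  assumes "graded_basis F G H f g h m n A1 B1 C1 A2 B2 C2"
    and "graded_basis F G H f g h m' n' A1' B1' C1' A2' B2' C2'"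
  shows "\<bar>m - n\<bar> = \<bar>m' - n'\<bar>"
proof -
  note 1 = assms(1) graded_basis_swap[OF assms(1)] and 2 = assms(2) graded_basis_swap[OF assms(2)]
  note m = graded_basis_minimal
  show ?thesis
    using m[OF 1(1) 2(1)] m[OF 1(1) 2(2)] m[OF 1(2) 2(1)] m[OF 1(2) 2(2)]
      m[OF 2(1) 1(1)] m[OF 2(1) 1(2)] m[OF 2(2) 1(1)] m[OF 2(2) 1(2)]
    by (cases "m \<le> n"; cases "m' \<le> n'") auto
qed

lemma graded_resolution_basis:
  assumes "graded_resolution F G H m n \<phi>"
    and f: "int (total_degree F) = f" "int (total_degree G) = g" "int (total_degree H) = h"
  shows "\<exists>A1 B1 C1 A2 B2 C2. graded_basis F G H f g h m n A1 B1 C1 A2 B2 C2"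
proof -
  obtain A1 B1 C1 where z1: "\<phi> (1, 0) = (A1, B1, C1)" by (cases "\<phi> (1, 0)") auto
  obtain A2 B2 C2 where z2: "\<phi> (0, 1) = (A2, B2, C2)" by (cases "\<phi> (0, 1)") auto
  have hom: "module_hom (\<lambda>r (A, B). (r * A, r * B)) (\<lambda>r (A, B, C). (r * A, r * B, r * C)) \<phi>"
    and deg: "\<And>d. \<phi> ` (homog_part (d - m) \<times> homog_part (d - n)) \<subseteq>
        homog_part (d - f) \<times> homog_part (d - g) \<times> homog_part (d - h)"
    and inj: "inj \<phi>" and ran: "range \<phi> = {(A, B, C). A * F + B * G + C * H = 0}"
    using assms(1) f unfolding graded_resolution_def by auto
  have phi: "\<phi> (r, s) = (r * A1 + s * A2, r * B1 + s * B2, r * C1 + s * C2)" for r s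
  proof -
    have "\<phi> (r, s) = \<phi> ((case (1, 0) of (A, B) \<Rightarrow> (r * A, r * B)) + (case (0, 1) of (A, B) \<Rightarrow> (s * A, s * B)))"
      by simp
    also have "\<dots> = (r * A1 + s * A2, r * B1 + s * B2, r * C1 + s * C2)"
      unfolding module_hom.add[OF hom] module_hom.scale[OF hom] z1 z2 by simp
    finally show ?thesis .
  qed
  have d1: "A1 \<in> homog_part (m - f) \<and> B1 \<in> homog_part (m - g) \<and> C1 \<in> homog_part (m - h)"
  proof -
    have "\<phi> (1, 0) \<in> \<phi> ` (homog_part (m - m) \<times> homog_part (m - n))"
      by (rule imageI) (simp add: homog_part_1)
    from subsetD[OF deg[of m] this] show ?thesis unfolding z1 by simp
  qed
  have d2: "A2 \<in> homog_part (n - f) \<and> B2 \<in> homog_part (n - g) \<and> C2 \<in> homog_part (n - h)"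
  proof -
    have "\<phi> (0, 1) \<in> \<phi> ` (homog_part (n - m) \<times> homog_part (n - n))"
      by (rule imageI) (simp add: homog_part_1)
    from subsetD[OF deg[of n] this] show ?thesis unfolding z2 by simp
  qed
  have syz: "A1 * F + B1 * G + C1 * H = 0" "A2 * F + B2 * G + C2 * H = 0"
    using ran z1 z2 rangeI[of \<phi> "(1, 0)"] rangeI[of \<phi> "(0, 1)"] by auto
  have "graded_basis F G H f g h m n A1 B1 C1 A2 B2 C2"
  proof (unfold_locales; (use d1 d2 syz in blast)?)
    fix d A B C
    assume A: "A \<in> homog_part (d - f)" and B: "B \<in> homog_part (d - g)" and C: "C \<in> homog_part (d - h)"
      and s: "A * F + B * G + C * H = 0"
    have "(A, B, C) \<in> range \<phi>" using s unfolding ran by simp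
    then obtain r s where rs: "A = r * A1 + s * A2" "B = r * B1 + s * B2" "C = r * C1 + s * C2"
      by (auto simp: phi)
    have "A = homog_comp (d - m) r * A1 + homog_comp (d - n) s * A2"
      "B = homog_comp (d - m) r * B1 + homog_comp (d - n) s * B2"
      "C = homog_comp (d - m) r * C1 + homog_comp (d - n) s * C2"
      using homog_coefficients[OF rs(1) A] homog_coefficients[OF rs(2) B] homog_coefficients[OF rs(3) C]
        d1 d2 by blast+
    then show "\<exists>r s. r \<in> homog_part (d - m) \<and> s \<in> homog_part (d - n) \<and>
        A = r * A1 + s * A2 \<and> B = r * B1 + s * B2 \<and> C = r * C1 + s * C2"
      by (intro exI[of _ "homog_comp (d - m) r"] exI[of _ "homog_comp (d - n) s"] conjI homog_comp_in)
  next
    fix r s assume "r * A1 + s * A2 = 0" "r * B1 + s * B2 = 0" "r * C1 + s * C2 = 0"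
    then have "\<phi> (r, s) = \<phi> (0, 0)" by (simp add: phi)
    then show "r = 0 \<and> s = 0" using inj by (auto dest: injD)
  qed
  then show ?thesis by blast
qed

lemma (in syzygies) ex_graded_resolution: "\<exists>\<phi>. graded_resolution F G H m n \<phi>"
proof
  let ?phi = "\<lambda>(r, s). (r * A1 + s * A2, r * B1 + s * B2, r * C1 + s * C2)"
  have deg: "int (total_degree F) = f" "int (total_degree G) = g" "int (total_degree H) = h"
    using total_degree_homog deg_F deg_G deg_H nonzero by auto
  show "graded_resolution F G H m n ?phi"
    unfolding graded_resolution_def deg
  proof (intro conjI allI)
    show "module_hom (\<lambda>r (A, B). (r * A, r * B)) (\<lambda>r (A, B, C). (r * A, r * B, r * C)) ?phi"
      by unfold_locales (auto simp: algebra_simps)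
    show "?phi ` (homog_part (d - m) \<times> homog_part (d - n)) \<subseteq>
        homog_part (d - f) \<times> homog_part (d - g) \<times> homog_part (d - h)" for d
    proof -
      have "r * A1 + s * A2 \<in> homog_part (d - f) \<and> r * B1 + s * B2 \<in> homog_part (d - g) \<and>
          r * C1 + s * C2 \<in> homog_part (d - h)" if "r \<in> homog_part (d - m)" "s \<in> homog_part (d - n)" for r s
        by (intro conjI homog_part_add homog_part_mult'[OF that(1)] homog_part_mult'[OF that(2)])
          (rule A1 B1 C1 A2 B2 C2 | simp)+
      then show ?thesis by auto
    qed
    show "inj ?phi"
    proof (rule injI, clarify)
      fix r s r' s'
      assume "r * A1 + s * A2 = r' * A1 + s' * A2" "r * B1 + s * B2 = r' * B1 + s' * B2"
      then have "(r - r') * A1 + (s - s') * A2 = 0" "(r - r') * B1 + (s - s') * B2 = 0"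
        by (simp_all add: algebra_simps)
      then show "r = r' \<and> s = s'" using independent[of "r - r'" "s - s'"] by simp
    qed
    show "range ?phi = {(A, B, C). A * F + B * G + C * H = 0}"
    proof (rule antisym; rule subsetI)
      fix z assume "z \<in> range ?phi"
      then show "z \<in> {(A, B, C). A * F + B * G + C * H = 0}" using syz_combine by auto
    next
      fix z assume "z \<in> {(A, B, C). A * F + B * G + C * H = 0}"
      then obtain A B C where z: "z = (A, B, C)" "A * F + B * G + C * H = 0" by auto
      obtain r s where "A = r * A1 + s * A2" "B = r * B1 + s * B2" "C = r * C1 + s * C2"
        using spanning[OF z(2)] .
      then have "z = ?phi (r, s)" using z by simp
      then show "z \<in> range ?phi" by blast
    qed
  qed
qed

lemma (in syzygies) syzygy_gap: "syzygy_gap F G H = \<bar>m - n\<bar>"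
  unfolding syzygy_gap_def
proof (rule the_equality)
  show "\<exists>m' n' \<phi>. graded_resolution F G H m' n' \<phi> \<and> \<bar>m - n\<bar> = \<bar>m' - n'\<bar>"
    using ex_graded_resolution by blast
  have deg: "int (total_degree F) = f" "int (total_degree G) = g" "int (total_degree H) = h"
    using total_degree_homog deg_F deg_G deg_H nonzero by auto
  fix r assume "\<exists>m' n' \<phi>. graded_resolution F G H m' n' \<phi> \<and> r = \<bar>m' - n'\<bar>"
  then obtain m' n' \<phi> where res: "graded_resolution F G H m' n' \<phi>" "r = \<bar>m' - n'\<bar>" by blast
  then show "r = \<bar>m - n\<bar>"
    using ex_graded_resolution graded_resolution_basis[OF _ deg] graded_basis_gap_unique by metis
qed

section \<open>Products of powers of linear forms\<close>

definition wt :: "nat ^ 'n::finite \<Rightarrow> nat" where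
  "wt b = (\<Sum>i\<in>UNIV. b $ i)"

lemma wt_0 [simp]: "wt 0 = 0"
  by (simp add: wt_def)

lemma wt_add: "wt (a + b) = wt a + wt b"
  by (simp add: wt_def sum.distrib)

lemma wt_scale: "wt (c *s a) = c * wt a"
  by (simp add: wt_def sum_distrib_left)

lemma wt_axis: "wt (axis i 1) = 1"
  by (simp add: wt_def axis_def)

lemma wt_mono: "a \<le> b \<Longrightarrow> wt a \<le> wt b"
  by (auto simp: wt_def less_eq_vec_def intro: sum_mono)

lemma exponent_induct [case_names zero axis]:
  fixes a :: "nat ^ 'n::finite"
  assumes "P 0" "\<And>a i. P a \<Longrightarrow> P (a + axis i 1)"
  shows "P a"
proof (induction "wt a" arbitrary: a)
  case 0
  then have "a = 0" by (simp add: wt_def vec_eq_iff)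
  then show ?case using assms(1) by simp
next
  case (Suc k)
  then obtain i where i: "a $ i > 0" by (metis gr0I nat.distinct(1) sum.neutral wt_def)
  define b where "b = a - axis i 1"
  have a: "a = b + axis i 1" using i by (auto simp: b_def vec_eq_iff axis_def)
  then have "wt b = k" using Suc(2) wt_add[of b "axis i 1"] wt_axis[of i] by simp
  then show ?case using Suc(1)[of b] assms(2)[of b i] a by simp
qed

lemma ell_pow_0: "ell_pow ell 0 = 1"
  by (simp add: ell_pow_def)

lemma ell_pow_add: "ell_pow ell (a + b) = ell_pow ell a * ell_pow ell b"
  by (simp add: ell_pow_def power_add prod.distrib)

lemma ell_pow_scale: "ell_pow ell (c *s a) = ell_pow ell a ^ c"
  by (simp add: ell_pow_def power_mult[symmetric] prod_power_distrib mult.commute)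

lemma ell_pow_axis: "ell_pow ell (axis i c) = ell $ i ^ c"
proof -
  have "ell_pow ell (axis i c) = (\<Prod>j\<in>UNIV. if j = i then ell $ j ^ c else 1)"
    unfolding ell_pow_def by (intro prod.cong) (auto simp: axis_def)
  then show ?thesis by simp
qed

lemma ell_pow_mono: "a \<le> b \<Longrightarrow> ell_pow ell a dvd ell_pow ell b"
proof -
  assume "a \<le> b"
  then have "b = a + (b - a)" by (auto simp: vec_eq_iff less_eq_vec_def)
  then show ?thesis by (metis dvd_triv_left ell_pow_add)
qed

locale arrangement =
  fixes p :: nat and ell :: "('k::field) bipoly ^ 'n::finite"
  assumes char: "CHAR('k) = p" and p_pos: "p > 0"
    and linear: "\<And>i. linear_form (ell $ i)"
    and cop: "\<And>i j. i \<noteq> j \<Longrightarrow> coprime (ell $ i) (ell $ j)"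
begin

lemma prime_p: "prime p"
  using prime_CHAR_semidom[where 'a = 'k] char p_pos by simp

lemma prime_CHAR_bipoly: "prime CHAR('k bipoly)" and CHAR_bipoly: "CHAR('k bipoly) = p"
  using prime_p char by simp_all

lemma ell_pow_homog: "ell_pow ell a \<in> homog_part (int (wt a))" and ell_pow_nz: "ell_pow ell a \<noteq> 0"
proof (induction a rule: exponent_induct)
  case zero
  { case 1 show ?case by (simp add: ell_pow_0 homog_part_1) }
  { case 2 show ?case by (simp add: ell_pow_0) }
next
  case (axis a i)
  { case 1 show ?case
      unfolding ell_pow_add ell_pow_axis wt_add wt_axis
      using axis(1) linear_form_homog[OF linear, of i] by (auto elim: homog_part_mult') }
  { case 2 show ?case
      using axis(2) linear_form_nz[OF linear, of i] by (simp add: ell_pow_add ell_pow_axis) }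
qed

lemma dvd_ell_pow:
  assumes "ell $ i dvd ell_pow ell a"
  shows "a $ i > 0"
  using assms
proof (induction a rule: exponent_induct)
  case zero
  then show ?case using linear_form_not_unit[OF linear] by (simp add: ell_pow_0)
next
  case (axis a j)
  show ?case
  proof (cases "i = j")
    case False
    have "\<not> ell $ i dvd ell $ j"
    proof
      assume "ell $ i dvd ell $ j"
      from coprime_common_divisor[OF cop[OF False] dvd_refl this] show False
        using linear_form_not_unit[OF linear, of i] by simp
    qed
    then have "ell $ i dvd ell_pow ell a"
      using axis(2) linear_form_prime[OF linear, of i] by (auto simp: ell_pow_add ell_pow_axis)
    then show ?thesis using axis(1) by simp
  qed (simp add: axis_def)
qed

lemma ell_pow_dvd_1: "ell_pow ell a dvd 1 \<Longrightarrow> a = 0"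
proof -
  assume "ell_pow ell a dvd 1"
  have "\<not> a $ i > 0" for i
  proof
    assume "a $ i > 0"
    then have "axis i 1 \<le> a" by (simp add: less_eq_vec_def axis_def)
    then have "ell $ i dvd ell_pow ell a" using ell_pow_mono[of "axis i 1" a ell] by (simp add: ell_pow_axis)
    then show False using \<open>ell_pow ell a dvd 1\<close> linear_form_not_unit[OF linear] dvd_trans by blast
  qed
  then show ?thesis by (simp add: vec_eq_iff)
qed

text \<open>
  The linear forms in \<open>\<ell>\<^sup>u\<close> are primes which neither divide \<open>\<ell>\<^sup>w\<close> nor both \<open>A\<close> and \<open>B\<close>; they are cancelled one
  at a time.
\<close>

lemma ell_pow_dvd_cancel:
  assumes "\<And>i. \<not> (ell $ i dvd A \<and> ell $ i dvd B)" "\<And>i. u $ i = 0 \<or> w $ i = 0"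
    and "ell_pow ell u dvd C * ell_pow ell w * A" "ell_pow ell u dvd C * ell_pow ell w * B"
  shows "ell_pow ell u dvd C"
  using assms(2-)
proof (induction u arbitrary: C rule: exponent_induct)
  case zero
  then show ?case by (simp add: ell_pow_0)
next
  case (axis u i)
  have "w $ i = 0" using axis(2)[of i] by simp
  then have "\<not> ell $ i dvd ell_pow ell w" using dvd_ell_pow by force
  moreover have "ell $ i dvd ell_pow ell (u + axis i 1)" by (simp add: ell_pow_add ell_pow_axis)
  then have "ell $ i dvd C * ell_pow ell w * A" "ell $ i dvd C * ell_pow ell w * B"
    using axis(3,4) dvd_trans by blast+
  ultimately have "ell $ i dvd C" using assms(1)[of i] linear_form_prime[OF linear, of i] by blast
  then obtain C' where C: "C = ell $ i * C'" by (auto simp: dvd_def)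
  have "ell_pow ell u dvd C'"
  proof (rule axis(1))
    show "u $ j = 0 \<or> w $ j = 0" for j using axis(2)[of j] by auto
    show "ell_pow ell u dvd C' * ell_pow ell w * A" "ell_pow ell u dvd C' * ell_pow ell w * B"
      using axis(3,4) linear_form_nz[OF linear, of i]
      by (auto simp: C ell_pow_add ell_pow_axis mult.assoc mult.commute[of _ "ell $ i"])
  qed
  then show ?case by (simp add: C ell_pow_add ell_pow_axis mult.commute)
qed

end

section \<open>The syzygy gap as a function of the exponents\<close>

locale form_pair = arrangement p ell for p :: nat and ell :: "('k::field) bipoly ^ 'n::finite" +
  fixes F G :: "'k bipoly" and f g :: int
  assumes F: "F \<in> homog_part f" "F \<noteq> 0" and G: "G \<in> homog_part g" "G \<noteq> 0"
    and primary: "irrelevant_primary (ideal_gen {F, G})"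
begin

lemma reg: "regular_pair F G"
  by (rule irrelevant_primary_regular[OF primary])

abbreviation "gap a \<equiv> syzygy_gap F G (ell_pow ell a)"

lemma ex_hb: "\<exists>m n. hb F G (ell_pow ell a) f g (int (wt a)) m n"
proof (induction a rule: exponent_induct)
  case zero
  show ?case using hb_one[OF F(1) G(1)] by (auto simp: ell_pow_0)
next
  case (axis a i)
  then obtain m n where "hb F G (ell_pow ell a) f g (int (wt a)) m n" by blast
  from hb_linear_step[OF this linear[of i]] show ?case
    unfolding wt_add wt_axis ell_pow_add ell_pow_axis by (auto simp: mult.commute add.commute)
qed

lemma hb_syzygies:
  assumes "hb F G (ell_pow ell a) f g (int (wt a)) m n"
  obtains A1 B1 C1 A2 B2 C2 where
    "syzygies F G (ell_pow ell a) f g (int (wt a)) m n A1 B1 C1 A2 B2 C2"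
  using assms F G reg ell_pow_nz unfolding hb_def syzygies_def syzygies_axioms_def by blast

lemma obtain_syzygies:
  obtains m n A1 B1 C1 A2 B2 C2 where "m \<le> n"
    "syzygies F G (ell_pow ell a) f g (int (wt a)) m n A1 B1 C1 A2 B2 C2"
proof -
  obtain m n where "hb F G (ell_pow ell a) f g (int (wt a)) m n" using ex_hb by blast
  then have "hb F G (ell_pow ell a) f g (int (wt a)) (min m n) (max m n)"
    using hb_swap by (cases "m \<le> n") (auto simp: min_def max_def)
  then obtain A1 B1 C1 A2 B2 C2 where
    "syzygies F G (ell_pow ell a) f g (int (wt a)) (min m n) (max m n) A1 B1 C1 A2 B2 C2"
    using hb_syzygies by blast
  then show ?thesis using that[of "min m n" "max m n"] by simp
qed

lemma hb_gap: "hb F G (ell_pow ell a) f g (int (wt a)) m n \<Longrightarrow> gap a = \<bar>m - n\<bar>"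
  using hb_syzygies syzygies.syzygy_gap by metis

lemma gap_nonneg: "0 \<le> gap a"
proof -
  obtain m n where "hb F G (ell_pow ell a) f g (int (wt a)) m n" using ex_hb by blast
  then show ?thesis by (simp add: hb_gap)
qed

lemma gap_step: "\<bar>gap (a + axis i 1) - gap a\<bar> \<le> 1"
proof -
  obtain m n where mn: "hb F G (ell_pow ell a) f g (int (wt a)) m n" using ex_hb by blast
  have "hb F G (ell_pow ell (a + axis i 1)) f g (int (wt (a + axis i 1))) (m + 1) n \<or>
      hb F G (ell_pow ell (a + axis i 1)) f g (int (wt (a + axis i 1))) m (n + 1)"
    using hb_linear_step[OF mn linear[of i]]
    unfolding wt_add wt_axis ell_pow_add ell_pow_axis by (auto simp: mult.commute add.commute)
  then show ?thesis using hb_gap[OF mn] by (auto dest!: hb_gap)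
qed

lemma gap_add: "\<bar>gap (a + b) - gap a\<bar> \<le> int (wt b)"
proof (induction b rule: exponent_induct)
  case (axis b i)
  then show ?case
    using gap_step[of "a + b" i] by (simp only: wt_add wt_axis add.assoc[symmetric])
qed simp

lemma gap_lipschitz: "\<bar>gap a - gap b\<bar> \<le> int (wt (a - b) + wt (b - a))"
proof -
  have "a + (b - a) = b + (a - b)" by (auto simp: vec_eq_iff)
  then show ?thesis using gap_add[of a "b - a"] gap_add[of b "a - b"] by simp
qed

lemma gap_member:
  assumes "ell_pow ell a \<in> ideal_gen {F, G}" "int (wt a) \<le> f + g"
  shows "gap a = f + g - int (wt a)"
proof -
  obtain m n A1 B1 C1 A2 B2 C2 where *: "m \<le> n"
      "syzygies F G (ell_pow ell a) f g (int (wt a)) m n A1 B1 C1 A2 B2 C2" by (rule obtain_syzygies)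
  show ?thesis
    using syzygies.membership_degrees[OF *(2,1) assms] syzygies.syzygy_gap[OF *(2)] *(1) by simp
qed

lemma member_of_gap:
  assumes "f + g - int (wt a) \<le> gap a" "int (wt a) < f + g"
  shows "ell_pow ell a \<in> ideal_gen {F, G}"
proof -
  obtain m n A1 B1 C1 A2 B2 C2 where *: "m \<le> n"
      "syzygies F G (ell_pow ell a) f g (int (wt a)) m n A1 B1 C1 A2 B2 C2" by (rule obtain_syzygies)
  show ?thesis
    using syzygies.degrees_membership[OF *(2,1) _ assms(2)] syzygies.syzygy_gap[OF *(2)] * assms(1) by simp
qed

lemma gap_ge: "int (wt a) - f - g \<le> gap a"
proof -
  obtain m n A1 B1 C1 A2 B2 C2 where *: "m \<le> n"
      "syzygies F G (ell_pow ell a) f g (int (wt a)) m n A1 B1 C1 A2 B2 C2" by (rule obtain_syzygies)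
  then interpret syzygies F G "ell_pow ell a" f g "int (wt a)" m n A1 B1 C1 A2 B2 C2 by simp
  show ?thesis using min_degree_le[OF *(1)] syzygy_gap sum_deg *(1) by linarith
qed

end

text \<open>
  In degrees below \<open>f + g\<close> these are the minimal exponents \<open>a\<close> with \<open>\<ell>\<^sup>a \<in> \<langle>F, G\<rangle>\<close>
  (\<open>tight_of_minimal\<close>, \<open>lattice_critical_of_tight\<close>).  Stated through the coefficients, the property visibly
  passes to Frobenius powers.
\<close>

definition tight ::
  "'k::field bipoly ^ 'n::finite \<Rightarrow> 'k bipoly \<Rightarrow> 'k bipoly \<Rightarrow> int \<Rightarrow> int \<Rightarrow> nat ^ 'n \<Rightarrow> bool" where
  "tight ell F G f g a \<longleftrightarrow> (\<exists>A \<in> homog_part (int (wt a) - f). \<exists>B \<in> homog_part (int (wt a) - g).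
     ell_pow ell a = A * F + B * G \<and> (\<forall>i. \<not> (ell $ i dvd A \<and> ell $ i dvd B)))"

lemma Suc_0_smult [simp]: "Suc 0 *s a = a"
  by (simp add: vec_eq_iff)

context form_pair
begin

abbreviation "tight_exp \<equiv> tight ell F G f g"

lemma homog_representation:
  assumes "c * ell_pow ell a \<in> ideal_gen {F, G}" "c \<in> homog_part e"
  obtains A B where "A \<in> homog_part (e + int (wt a) - f)" "B \<in> homog_part (e + int (wt a) - g)"
    "c * ell_pow ell a = A * F + B * G"
proof -
  let ?d = "e + int (wt a)"
  obtain A B where AB: "c * ell_pow ell a = A * F + B * G" using assms(1) by (auto simp: in_ideal_gen2)
  have "c * ell_pow ell a \<in> homog_part ?d"
    using homog_part_mult[OF assms(2) ell_pow_homog] .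
  from homog_comp_id[OF this] have "c * ell_pow ell a = homog_comp (?d - f) A * F + homog_comp (?d - g) B * G"
    unfolding AB homog_comp_add homog_comp_mult[OF F(1)] homog_comp_mult[OF G(1)] by simp
  then show ?thesis using that homog_comp_in by blast
qed

lemma tight_member: "tight_exp a \<Longrightarrow> ell_pow ell a \<in> ideal_gen {F, G}"
  unfolding tight_def in_ideal_gen2 by blast

lemma member_mono: "ell_pow ell a \<in> ideal_gen {F, G} \<Longrightarrow> a \<le> b \<Longrightarrow> ell_pow ell b \<in> ideal_gen {F, G}"
  using ell_pow_mono[of a b ell] ideal_gen2_mult by (metis dvdE mult.commute)

text \<open>
  A linear form dividing both coefficients could be cancelled.
\<close>

lemma tight_of_minimal:
  assumes "ell_pow ell a \<in> ideal_gen {F, G}"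
    and "\<And>i. a $ i > 0 \<Longrightarrow> ell_pow ell (a - axis i 1) \<notin> ideal_gen {F, G}"
  shows "tight_exp a"
proof -
  obtain A B where AB: "A \<in> homog_part (0 + int (wt a) - f)" "B \<in> homog_part (0 + int (wt a) - g)"
      "1 * ell_pow ell a = A * F + B * G"
    using homog_representation[OF _ homog_part_1, of a] assms(1) by auto
  have "\<not> (ell $ i dvd A \<and> ell $ i dvd B)" for i
  proof
    assume dv: "ell $ i dvd A \<and> ell $ i dvd B"
    then obtain A' B' where AB': "A = ell $ i * A'" "B = ell $ i * B'" by (auto simp: dvd_def)
    have "ell $ i dvd ell_pow ell a" using AB(3) dv by auto
    then have i: "a $ i > 0" by (rule dvd_ell_pow)
    have "a = axis i 1 + (a - axis i 1)" using i by (auto simp: vec_eq_iff axis_def)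
    then have "ell_pow ell a = ell $ i * ell_pow ell (a - axis i 1)"
      by (metis ell_pow_add ell_pow_axis power_one_right)
    then have "ell $ i * ell_pow ell (a - axis i 1) = ell $ i * (A' * F + B' * G)"
      using AB(3) unfolding AB' by (simp add: algebra_simps)
    then have "ell_pow ell (a - axis i 1) = A' * F + B' * G"
      using linear_form_nz[OF linear, of i] mult_left_cancel by blast
    then show False using assms(2)[OF i] in_ideal_gen2 by blast
  qed
  then show ?thesis unfolding tight_def using AB by auto
qed

lemma ex_tight_below:
  assumes "ell_pow ell a \<in> ideal_gen {F, G}"
  obtains b where "b \<le> a" "tight_exp b"
proof -
  have "\<exists>b\<le>a. tight_exp b" using assms
  proof (induction "wt a" arbitrary: a rule: less_induct)
    case less
    show ?case
    proof (cases "\<exists>i. a $ i > 0 \<and> ell_pow ell (a - axis i 1) \<in> ideal_gen {F, G}")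
      case True
      then obtain i where i: "a $ i > 0" "ell_pow ell (a - axis i 1) \<in> ideal_gen {F, G}" by blast
      have a: "a = (a - axis i 1) + axis i 1" using i(1) by (auto simp: vec_eq_iff axis_def)
      then have "wt a = wt (a - axis i 1) + 1" by (metis wt_add wt_axis)
      then obtain b where "b \<le> a - axis i 1" "tight_exp b" using less(1)[OF _ i(2)] by auto
      moreover have "a - axis i 1 \<le> a" by (simp add: less_eq_vec_def)
      ultimately show ?thesis by (meson order_trans)
    next
      case False
      then show ?thesis using tight_of_minimal[OF less(2)] by blast
    qed
  qed
  then show ?thesis using that by blast
qed

text \<open>
  Writing the least common multiple of \<open>\<ell>\<^sup>a\<close> and \<open>\<ell>\<^sup>b\<close> (times \<open>c\<close>) in \<open>\<langle>F, G\<rangle>\<close> in two ways gives a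
  relation between \<open>F\<close> and \<open>G\<close>, which is trivial for reasons of degree; comparing coefficients, the
  part of \<open>\<ell>\<^sup>a\<close> prime to \<open>\<ell>\<^sup>b\<close> divides \<open>c\<close> times each coefficient of \<open>\<ell>\<^sup>a\<close>, hence divides \<open>c\<close>.
\<close>

lemma tight_dvd:
  assumes "tight_exp a" and c: "c \<in> homog_part e" "c * ell_pow ell b \<in> ideal_gen {F, G}"
    and deg: "e + int (wt b + wt (a - b)) < f + g"
  shows "ell_pow ell (a - b) dvd c"
proof -
  obtain A B where A: "A \<in> homog_part (int (wt a) - f)" and B: "B \<in> homog_part (int (wt a) - g)"
    and AB: "ell_pow ell a = A * F + B * G" "\<And>i. \<not> (ell $ i dvd A \<and> ell $ i dvd B)"
    using assms(1) unfolding tight_def by blast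
  obtain A' B' where A': "A' \<in> homog_part (e + int (wt b) - f)" and B': "B' \<in> homog_part (e + int (wt b) - g)"
    and AB': "c * ell_pow ell b = A' * F + B' * G"
    using homog_representation[OF c(2,1)] .
  let ?u = "ell_pow ell (a - b)" and ?w = "ell_pow ell (b - a)"
  have join: "b + (a - b) = a + (b - a)" by (auto simp: vec_eq_iff)
  then have wt: "wt b + wt (a - b) = wt a + wt (b - a)" by (metis wt_add)
  define d where "d = e + int (wt b + wt (a - b))"
  have u: "?u \<in> homog_part (int (wt (a - b)))" and w: "c * ?w \<in> homog_part (e + int (wt (b - a)))"
    using ell_pow_homog homog_part_mult[OF c(1) ell_pow_homog] by auto
  have "(?u * A' - c * ?w * A) * F + (?u * B' - c * ?w * B) * G
    = ?u * (A' * F + B' * G) - c * ?w * (A * F + B * G)" by (simp add: algebra_simps)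
  also have "\<dots> = c * (ell_pow ell b * ?u) - c * (ell_pow ell a * ?w)"
    unfolding AB(1)[symmetric] AB'[symmetric] by (simp add: algebra_simps)
  also have "\<dots> = 0" unfolding ell_pow_add[symmetric] join by simp
  finally have rel: "(?u * A' - c * ?w * A) * F + (?u * B' - c * ?w * B) * G = 0" .
  have "?u * A' \<in> homog_part (d - f)" "?u * B' \<in> homog_part (d - g)"
    by (rule homog_part_mult'[OF u A'] homog_part_mult'[OF u B'], simp add: d_def)+
  moreover have "c * ?w * A \<in> homog_part (d - f)" "c * ?w * B \<in> homog_part (d - g)"
    by (rule homog_part_mult'[OF w A] homog_part_mult'[OF w B], simp add: d_def wt)+
  ultimately have "?u * A' - c * ?w * A \<in> homog_part (d - f)" "?u * B' - c * ?w * B \<in> homog_part (d - g)"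
    by (auto intro: homog_part_diff)
  note degree = regular_pair_degree[OF reg rel this G(1,2)]
  have "\<not> f + g \<le> d" using deg by (simp add: d_def)
  then have "?u * A' - c * ?w * A = 0 \<and> ?u * B' - c * ?w * B = 0" using degree by blast
  then have "c * ?w * A = ?u * A'" "c * ?w * B = ?u * B'" by simp_all
  then have "?u dvd c * ?w * A" "?u dvd c * ?w * B" by simp_all
  moreover have "(a - b) $ i = 0 \<or> (b - a) $ i = 0" for i by simp linarith
  ultimately show ?thesis using ell_pow_dvd_cancel[OF AB(2), of "a - b" "b - a" c] by simp
qed

corollary tight_le_member:
  assumes "tight_exp a" "ell_pow ell b \<in> ideal_gen {F, G}" "int (wt b + wt (a - b)) < f + g"
  shows "a \<le> b"
proof -
  have "ell_pow ell (a - b) dvd 1"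
    using tight_dvd[OF assms(1) homog_part_1] assms(2,3) by simp
  then have "a - b = 0" by (rule ell_pow_dvd_1)
  then show ?thesis by (simp add: vec_eq_iff less_eq_vec_def)
qed

text \<open>
  If the gap at \<open>b\<close> were larger, the syzygy of smaller degree would have a last component too small to
  be divisible by the power of linear forms prescribed by \<open>tight_dvd\<close>.
\<close>

lemma tight_local_max:
  assumes "tight_exp a" "int (wt (a - b) + wt (b - a)) \<le> f + g - int (wt a)"
  shows "gap b \<le> f + g - int (wt a)"
proof (rule ccontr)
  assume gt: "\<not> ?thesis"
  obtain m n A1 B1 C1 A2 B2 C2 where mn: "m \<le> n"
    and "syzygies F G (ell_pow ell b) f g (int (wt b)) m n A1 B1 C1 A2 B2 C2" by (rule obtain_syzygies)
  then interpret syzygies F G "ell_pow ell b" f g "int (wt b)" m n A1 B1 C1 A2 B2 C2 by simp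
  have m: "2 * m < int (wt a) + int (wt b)"
    using gt syzygy_gap sum_deg mn by linarith
  have "b + (a - b) = a + (b - a)" by (auto simp: vec_eq_iff)
  then have wt: "int (wt b) + int (wt (a - b)) = int (wt a) + int (wt (b - a))"
    by (metis wt_add of_nat_add)
  have "C1 \<noteq> 0" using C1_nonzero m wt assms(2) by linarith
  have "C1 \<in> ideal_colon (ideal_gen {F, G}) (ell_pow ell b)"
    unfolding colon by (auto intro: module.span_base[OF module_mult])
  then have "C1 * ell_pow ell b \<in> ideal_gen {F, G}" by (simp add: ideal_colon_def)
  moreover have "m - int (wt b) + int (wt b + wt (a - b)) < f + g"
    using m wt assms(2) by simp
  ultimately have "ell_pow ell (a - b) dvd C1" using tight_dvd[OF assms(1) C1] by blast
  then obtain E where E: "C1 = E * ell_pow ell (a - b)" by (metis dvdE mult.commute)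
  then have "E \<in> homog_part (m - int (wt b) - int (wt (a - b)))"
    using homog_part_cancel[OF _ ell_pow_homog ell_pow_nz] C1 by blast
  then have "0 \<le> m - int (wt b) - int (wt (a - b))"
    using homog_part_nonneg E \<open>C1 \<noteq> 0\<close> by force
  then show False using m wt by linarith
qed

lemma power_pair: "form_pair p ell (F ^ p ^ t) (G ^ p ^ t) (int (p ^ t) * f) (int (p ^ t) * g)"
proof unfold_locales
  have q: "frob_power (p ^ t) (ideal_gen {F, G}) = ideal_gen {F ^ p ^ t, G ^ p ^ t}"
    using frob_power_gen2[OF prime_CHAR_bipoly, of "p ^ t" t] CHAR_bipoly by simp
  obtain N where "var_x ^ N \<in> ideal_gen {F, G}" "var_y ^ N \<in> ideal_gen {F, G}"
    using primary by (auto simp: irrelevant_primary_def)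
  then have "(var_x ^ N) ^ p ^ t \<in> ideal_gen {F ^ p ^ t, G ^ p ^ t}"
    "(var_y ^ N) ^ p ^ t \<in> ideal_gen {F ^ p ^ t, G ^ p ^ t}"
    unfolding q[symmetric] frob_power_def by (auto intro!: module.span_base[OF module_mult])
  then show "irrelevant_primary (ideal_gen {F ^ p ^ t, G ^ p ^ t})"
    unfolding irrelevant_primary_def power_mult[symmetric] by blast
qed (use F G in \<open>auto intro: homog_part_power simp del: of_nat_power\<close>)

lemma power_syzygies:
  assumes "syzygies F G (ell_pow ell a) f g (int (wt a)) m n A1 B1 C1 A2 B2 C2" "q = p ^ t"
  shows "syzygies (F ^ q) (G ^ q) (ell_pow ell (q *s a)) (int q * f) (int q * g) (int (wt (q *s a)))
    (int q * m) (int q * n) (A1 ^ q) (B1 ^ q) (C1 ^ q) (A2 ^ q) (B2 ^ q) (C2 ^ q)"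
proof -
  interpret syzygies F G "ell_pow ell a" f g "int (wt a)" m n A1 B1 C1 A2 B2 C2 by (rule assms)
  interpret q: form_pair p ell "F ^ q" "G ^ q" "int q * f" "int q * g"
    unfolding assms(2) by (rule power_pair)
  have "prime CHAR('k)" "q = CHAR('k) ^ t" using prime_p char assms(2) by auto
  from power[OF this] show ?thesis
    using q.F q.G q.reg ell_pow_nz
    by (simp add: syzygies_def syzygies_axioms_def ell_pow_scale wt_scale)
qed

lemma gap_power: "syzygy_gap (F ^ p ^ t) (G ^ p ^ t) (ell_pow ell (p ^ t *s a)) = int (p ^ t) * gap a"
proof -
  obtain m n A1 B1 C1 A2 B2 C2 where *: "m \<le> n"
    "syzygies F G (ell_pow ell a) f g (int (wt a)) m n A1 B1 C1 A2 B2 C2" by (rule obtain_syzygies)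
  show ?thesis
    unfolding syzygies.syzygy_gap[OF *(2)] syzygies.syzygy_gap[OF power_syzygies[OF *(2) refl]]
    by (simp add: abs_mult flip: right_diff_distrib)
qed

lemma tight_power:
  assumes "tight_exp a" "q = p ^ t"
  shows "tight ell (F ^ q) (G ^ q) (int q * f) (int q * g) (q *s a)"
proof -
  obtain A B where A: "A \<in> homog_part (int (wt a) - f)" and B: "B \<in> homog_part (int (wt a) - g)"
    and AB: "ell_pow ell a = A * F + B * G" "\<And>i. \<not> (ell $ i dvd A \<and> ell $ i dvd B)"
    using assms(1) unfolding tight_def by blast
  show ?thesis
    unfolding tight_def
  proof (intro bexI conjI allI)
    show "ell_pow ell (q *s a) = A ^ q * F ^ q + B ^ q * G ^ q"
      unfolding ell_pow_scale AB(1)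
      using freshmans_dream'[OF prime_CHAR_bipoly, of q t] assms(2) CHAR_bipoly
      by (simp add: power_mult_distrib)
    show "\<not> (ell $ i dvd A ^ q \<and> ell $ i dvd B ^ q)" for i
      using AB(2)[of i] linear_form_dvd_power[OF linear] by blast
    show "A ^ q \<in> homog_part (int (wt (q *s a)) - int q * f)"
      "B ^ q \<in> homog_part (int (wt (q *s a)) - int q * g)"
      using homog_part_power[OF A, of q] homog_part_power[OF B, of q]
      by (simp_all add: wt_scale right_diff_distrib)
  qed
qed

text \<open>
  The generators are the last components of the two basis syzygies, and the powers of these are the last
  components in the power of the Hilbert--Burch matrix.
\<close>

lemma colon_gen:
  obtains C1 C2 m n where
    "\<forall>t. ideal_colon (ideal_gen {F ^ p ^ t, G ^ p ^ t}) (ell_pow ell (p ^ t *s a)) = ideal_gen {C1 ^ p ^ t, C2 ^ p ^ t}"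
    "C1 \<in> homog_part m" "C2 \<in> homog_part n" "m + n = f + g - int (wt a)"
proof -
  obtain m n A1 B1 C1 A2 B2 C2 where
    *: "syzygies F G (ell_pow ell a) f g (int (wt a)) m n A1 B1 C1 A2 B2 C2"
    using obtain_syzygies by metis
  then interpret syzygies F G "ell_pow ell a" f g "int (wt a)" m n A1 B1 C1 A2 B2 C2 .
  show ?thesis
    using that[of C1 C2] syzygies.colon[OF power_syzygies[OF * refl]] C1 C2 sum_deg by simp
qed

lemma colon_frob_power:
  "ideal_colon (ideal_gen {F ^ p ^ t, G ^ p ^ t}) (ell_pow ell (p ^ t *s a)) =
    frob_power (p ^ t) (ideal_colon (ideal_gen {F, G}) (ell_pow ell a))"
proof -
  obtain C1 C2 m n where C: "\<forall>t. ideal_colon (ideal_gen {F ^ p ^ t, G ^ p ^ t}) (ell_pow ell (p ^ t *s a)) = ideal_gen {C1 ^ p ^ t, C2 ^ p ^ t}"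
    using colon_gen[of a] by metis
  show ?thesis
    using C[rule_format, of 0] C[rule_format, of t] frob_power_gen2[OF prime_CHAR_bipoly, of "p ^ t" t] CHAR_bipoly by simp
qed

lemma colon_dichotomy:
  assumes "ell_pow ell a \<notin> ideal_gen {F, G}"
  obtains U V u v where "form_pair p ell U V u v" "u > 0" "v > 0" "u + v = f + g - int (wt a)"
    "ideal_colon (ideal_gen {F, G}) (ell_pow ell a) = ideal_gen {U, V}"
proof -
  obtain U V u v where *: "\<forall>t. ideal_colon (ideal_gen {F ^ p ^ t, G ^ p ^ t}) (ell_pow ell (p ^ t *s a)) = ideal_gen {U ^ p ^ t, V ^ p ^ t}"
    and U: "U \<in> homog_part u" and V: "V \<in> homog_part v" and uv: "u + v = f + g - int (wt a)"
    using colon_gen[of a] .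
  have UV: "ideal_colon (ideal_gen {F, G}) (ell_pow ell a) = ideal_gen {U, V}" using *[rule_format, of 0] by simp
  have one: "1 \<notin> ideal_gen {U, V}" using assms by (simp add: UV[symmetric] ideal_colon_def)
  have "ideal_gen {F, G} \<subseteq> ideal_gen {U, V}"
    unfolding UV[symmetric] ideal_colon_def using ideal_gen2_mult by (auto simp: mult.commute)
  then have prim: "irrelevant_primary (ideal_gen {U, V})"
    using primary unfolding irrelevant_primary_def by blast
  have unit: "\<not> d dvd 1" if "d \<in> ideal_gen {U, V}" for d
  proof
    assume "d dvd 1"
    then obtain c where "c * d = 1" by (metis dvdE mult.commute)
    then show False using one ideal_gen2_mult[OF that, of c] by simp
  qed
  have mem: "U \<in> ideal_gen {U, V}" "V \<in> ideal_gen {U, V}" by (auto intro: module.span_base[OF module_mult])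
  have nz: "U \<noteq> 0" "V \<noteq> 0"
    using common_divisor_unit[OF prim, of V] common_divisor_unit[OF prim, of U] unit mem by auto
  have pos: "d > 0" if "D \<in> homog_part d" "D \<noteq> 0" "D \<in> ideal_gen {U, V}" for D d
  proof -
    have "d \<noteq> 0"
    proof
      assume "d = 0"
      then obtain c where "D = [:[:c:]:]" using homog_part_zeroD \<open>D \<in> homog_part d\<close> by blast
      then show False using unit[OF \<open>D \<in> ideal_gen {U, V}\<close>] \<open>D \<noteq> 0\<close> by (auto simp: is_unit_poly_iff dvd_field_iff)
    qed
    then show ?thesis using homog_part_nonneg[OF that(1,2)] by simp
  qed
  have "form_pair p ell U V u v"
    by unfold_locales (fact U V nz prim)+
  then show ?thesis using that pos U V nz mem uv UV by blast
qed

text \<open>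
  If \<open>\<ell>\<^sup>a\<close> is not in \<open>\<langle>F, G\<rangle>\<close>, its colon ideal is generated by two forms of positive degree, and the Frobenius
  power of that ideal is still proper.
\<close>

lemma member_power_iff:
  "ell_pow ell (p ^ t *s a) \<in> ideal_gen {F ^ p ^ t, G ^ p ^ t} \<longleftrightarrow> ell_pow ell a \<in> ideal_gen {F, G}"
proof
  assume l: "ell_pow ell (p ^ t *s a) \<in> ideal_gen {F ^ p ^ t, G ^ p ^ t}"
  show "ell_pow ell a \<in> ideal_gen {F, G}"
  proof (rule ccontr)
    assume "ell_pow ell a \<notin> ideal_gen {F, G}"
    then obtain U V u v where UV: "form_pair p ell U V u v" "u > 0" "v > 0"
      "ideal_colon (ideal_gen {F, G}) (ell_pow ell a) = ideal_gen {U, V}"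
      by (rule colon_dichotomy)
    have "1 \<in> ideal_colon (ideal_gen {F ^ p ^ t, G ^ p ^ t}) (ell_pow ell (p ^ t *s a))"
      using l by (simp add: ideal_colon_def)
    then have "1 \<in> ideal_gen {U ^ p ^ t, V ^ p ^ t}"
      using colon_frob_power[of t a] frob_power_gen2[OF prime_CHAR_bipoly, of "p ^ t" t U V] CHAR_bipoly
      unfolding UV(4) by simp
    then obtain r s where rs: "1 = r * U ^ p ^ t + s * V ^ p ^ t" by (auto simp: in_ideal_gen2)
    have "U ^ p ^ t \<in> homog_part (int (p ^ t) * u)" "V ^ p ^ t \<in> homog_part (int (p ^ t) * v)"
      using form_pair.F(1)[OF UV(1)] form_pair.G(1)[OF UV(1)] homog_part_power by blast+
    then have "homog_comp 0 (r * U ^ p ^ t + s * V ^ p ^ t) =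
        homog_comp (0 - int (p ^ t) * u) r * U ^ p ^ t + homog_comp (0 - int (p ^ t) * v) s * V ^ p ^ t"
      by (simp only: homog_comp_add homog_comp_mult)
    moreover have "homog_comp (0 - int (p ^ t) * u) r = 0" "homog_comp (0 - int (p ^ t) * v) s = 0"
      by (rule homog_part_neg[OF homog_comp_in], use UV(2,3) p_pos in \<open>simp add: zero_less_mult_iff\<close>)+
    ultimately have "homog_comp 0 1 = (0 :: 'k bipoly)" unfolding rs[symmetric] by simp
    then show False using homog_comp_id[OF homog_part_1] by (metis zero_neq_one)
  qed
next
  assume "ell_pow ell a \<in> ideal_gen {F, G}"
  then have "ell_pow ell a ^ p ^ t \<in> frob_power (p ^ t) (ideal_gen {F, G})"
    unfolding frob_power_def by (auto intro!: module.span_base[OF module_mult])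
  then show "ell_pow ell (p ^ t *s a) \<in> ideal_gen {F ^ p ^ t, G ^ p ^ t}"
    using frob_power_gen2[OF prime_CHAR_bipoly, of "p ^ t" t] CHAR_bipoly by (simp add: ell_pow_scale)
qed

text \<open>
  Otherwise the colon ideal would be generated by two forms of positive degrees with sum at most \<open>1\<close>.
\<close>

lemma member_of_degree:
  assumes "f + g \<le> int (wt a) + 1"
  shows "ell_pow ell a \<in> ideal_gen {F, G}"
proof (rule ccontr)
  assume "\<not> ?thesis"
  then obtain U V u v where "form_pair p ell U V u v" "u > 0" "v > 0" "u + v = f + g - int (wt a)"
    by (rule colon_dichotomy)
  then show False using assms by simp
qed

end

section \<open>Lattice points and the function \<open>\<Delta>\<close>\<close>

lemma norm1_nonneg_vec: "0 \<le> x \<Longrightarrow> norm1 x = (\<Sum>i\<in>UNIV. x $ i)"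
  unfolding norm1_def by (intro sum.cong) (auto simp: less_eq_vec_def)

lemma norm1_diff_le: "y \<le> x \<Longrightarrow> norm1 (x - y) = (\<Sum>i\<in>UNIV. x $ i) - (\<Sum>i\<in>UNIV. y $ i)"
  using norm1_nonneg_vec[of "x - y"] by (simp add: less_eq_vec_def sum_subtractf)

lemma norm1_le_norm: "norm1 (x :: real ^ 'n::finite) \<le> real CARD('n) * norm x"
  unfolding norm1_def using sum_bounded_above[of UNIV "\<lambda>i. \<bar>x $ i\<bar>" "norm x"] component_le_norm_cart[of x]
  by simp

lemma tendsto_norm1: "(X \<longlongrightarrow> x) F \<Longrightarrow> ((\<lambda>t. norm1 (X t)) \<longlongrightarrow> norm1 x) F"
  unfolding norm1_def by (intro tendsto_intros)

abbreviation lattice_point :: "nat \<Rightarrow> nat \<Rightarrow> nat ^ 'n::finite \<Rightarrow> real ^ 'n" where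
  "lattice_point p s a \<equiv> (1 / real (p ^ s)) *\<^sub>R real_vec a"

definition round_up :: "nat \<Rightarrow> nat \<Rightarrow> real ^ 'n::finite \<Rightarrow> nat ^ 'n" where
  "round_up p s x = (\<chi> i. nat \<lceil>x $ i * real p ^ s\<rceil>)"

lemma lattice_point_nth: "lattice_point p s a $ i = real (a $ i) / real p ^ s"
  by (simp add: real_vec_def)

lemma lattice_point_nonneg: "0 \<le> lattice_point p s a"
  by (simp add: less_eq_vec_def real_vec_def)

lemma norm1_lattice_point: "norm1 (lattice_point p s a) = real (wt a) / real p ^ s"
  unfolding norm1_nonneg_vec[OF lattice_point_nonneg] lattice_point_nth wt_def
  by (simp add: sum_divide_distrib)

lemma lattice_point_scale: "p > 0 \<Longrightarrow> lattice_point p (s + t) (p ^ t *s a) = lattice_point p s a"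
  by (simp add: vec_eq_iff real_vec_def power_add)

lemma norm1_lattice_point_diff:
  "norm1 (lattice_point p s a - lattice_point p s b) = real (wt (a - b) + wt (b - a)) / real p ^ s"
proof -
  have "norm1 (lattice_point p s a - lattice_point p s b) =
      (\<Sum>i\<in>UNIV. real ((a - b) $ i + (b - a) $ i) / real p ^ s)"
    unfolding norm1_def
  proof (intro sum.cong refl)
    fix i
    have "\<bar>real (a $ i) - real (b $ i)\<bar> = real ((a - b) $ i + (b - a) $ i)" by simp
    moreover have "(lattice_point p s a - lattice_point p s b) $ i = (real (a $ i) - real (b $ i)) / real p ^ s"
      by (simp add: real_vec_def diff_divide_distrib)
    ultimately show "\<bar>(lattice_point p s a - lattice_point p s b) $ i\<bar> = real ((a - b) $ i + (b - a) $ i) / real p ^ s"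
      by (simp add: abs_divide)
  qed
  then show ?thesis by (simp add: wt_def sum.distrib sum_divide_distrib[symmetric])
qed

lemma round_up_ge: "p > 0 \<Longrightarrow> x \<le> lattice_point p s (round_up p s x)"
proof -
  assume p: "p > 0"
  have "x $ i \<le> real (nat \<lceil>x $ i * real p ^ s\<rceil>) / real p ^ s" for i
    using p by (simp add: pos_le_divide_eq) linarith
  then show ?thesis by (simp add: less_eq_vec_def real_vec_def round_up_def)
qed

lemma round_up_tendsto:
  assumes "p > 1" "0 \<le> x"
  shows "(\<lambda>s. lattice_point p s (round_up p s x)) \<longlonglongrightarrow> x"
proof (rule vec_tendstoI)
  fix i
  show "(\<lambda>s. lattice_point p s (round_up p s x) $ i) \<longlonglongrightarrow> x $ i"
  proof (rule tendsto_sandwich)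
    show "(\<lambda>s. x $ i) \<longlonglongrightarrow> x $ i" by simp
    have *: "(\<lambda>s. inverse (real p ^ s)) \<longlonglongrightarrow> 0"
      using assms(1) by (intro LIMSEQ_inverse_realpow_zero) simp
    show "(\<lambda>s. x $ i + inverse (real p ^ s)) \<longlonglongrightarrow> x $ i"
      using tendsto_add[OF tendsto_const *] by simp
    show "\<forall>\<^sub>F s in sequentially. x $ i \<le> lattice_point p s (round_up p s x) $ i"
      using round_up_ge[of p x] assms(1) by (simp add: less_eq_vec_def)
    have "real (nat \<lceil>x $ i * real p ^ s\<rceil>) / real p ^ s \<le> x $ i + inverse (real p ^ s)" for s
    proof -
      have "0 \<le> x $ i * real p ^ s" using assms(2) by (simp add: less_eq_vec_def)
      then have "real (nat \<lceil>x $ i * real p ^ s\<rceil>) \<le> x $ i * real p ^ s + 1" by linarith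
      then show ?thesis using assms(1) by (simp add: field_simps)
    qed
    then show "\<forall>\<^sub>F s in sequentially. lattice_point p s (round_up p s x) $ i \<le> x $ i + inverse (real p ^ s)"
      unfolding lattice_point_nth round_up_def by simp
  qed
qed

lemma (in arrangement) p_gt_1: "p > 1"
  using prime_p prime_gt_1_nat by blast

context form_pair
begin

definition level_gap :: "nat \<Rightarrow> nat ^ 'n \<Rightarrow> int" where
  "level_gap s a = syzygy_gap (F ^ p ^ s) (G ^ p ^ s) (ell_pow ell a)"

lemma level_gap_scale: "level_gap (s + t) (p ^ t *s a) = int (p ^ t) * level_gap s a"
proof -
  interpret q: form_pair p ell "F ^ p ^ s" "G ^ p ^ s" "int (p ^ s) * f" "int (p ^ s) * g"
    by (rule power_pair)
  show ?thesis using q.gap_power[of t a] by (simp add: level_gap_def power_add power_mult)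
qed

lemma level_gap_lipschitz:
  "\<bar>real_of_int (level_gap s a) / real (p ^ s) - real_of_int (level_gap s b) / real (p ^ s)\<bar>
    \<le> norm1 (lattice_point p s a - lattice_point p s b)"
proof -
  interpret q: form_pair p ell "F ^ p ^ s" "G ^ p ^ s" "int (p ^ s) * f" "int (p ^ s) * g"
    by (rule power_pair)
  have "real_of_int \<bar>level_gap s a - level_gap s b\<bar> \<le> real (wt (a - b) + wt (b - a))"
    using q.gap_lipschitz[of a b] unfolding level_gap_def by (metis of_int_le_iff of_int_of_nat_eq)
  then have "real_of_int \<bar>level_gap s a - level_gap s b\<bar> / real (p ^ s) \<le> real (wt (a - b) + wt (b - a)) / real (p ^ s)"
    by (intro divide_right_mono) auto
  then show ?thesis
    unfolding norm1_lattice_point_diff by (simp add: abs_divide diff_divide_distrib[symmetric] del: of_nat_add)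
qed

lemma level_gap_well_defined:
  assumes "lattice_point p s a = lattice_point p t b"
  shows "real_of_int (level_gap s a) / real (p ^ s) = real_of_int (level_gap t b) / real (p ^ t)"
proof -
  have "p ^ t *s a = p ^ s *s b"
  proof (simp add: vec_eq_iff, intro allI)
    fix i
    have "real (a $ i) / real p ^ s = real (b $ i) / real p ^ t"
      using assms unfolding vec_eq_iff lattice_point_nth by blast
    then have "real (p ^ t * a $ i) = real (p ^ s * b $ i)" using p_pos by (simp add: field_simps)
    then show "p ^ t * a $ i = p ^ s * b $ i" by (simp only: of_nat_eq_iff)
  qed
  then have "int (p ^ t) * level_gap s a = int (p ^ s) * level_gap t b"
    using level_gap_scale[of s t a] level_gap_scale[of t s b] by (simp add: add.commute)
  then have "real_of_int (int (p ^ t) * level_gap s a) = real_of_int (int (p ^ s) * level_gap t b)" by simp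
  then show ?thesis using p_pos by (simp add: field_simps)
qed

text \<open>Being \<open>1\<close>-Lipschitz on a dense set of points, the normalized gap extends continuously.\<close>

lemma ex_Delta: "\<exists>D. is_Delta p ell F G D"
proof -
  define L :: "(real ^ 'n) set" where "L = {lattice_point p s a | s a. True}"
  define d where "d x = (SOME y. \<exists>s a. x = lattice_point p s a \<and> y = real_of_int (level_gap s a) / real (p ^ s))" for x
  have d: "d (lattice_point p s a) = real_of_int (level_gap s a) / real (p ^ s)" for s a
    unfolding d_def by (rule some_equality) (blast, metis level_gap_well_defined)
  have lip: "\<bar>d x - d y\<bar> \<le> norm1 (x - y)" if "x \<in> L" "y \<in> L" for x y
  proof -
    obtain s a t b where "x = lattice_point p s a" "y = lattice_point p t b"
      using \<open>x \<in> L\<close> \<open>y \<in> L\<close> unfolding L_def by blast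
    then have "x = lattice_point p (s + t) (p ^ t *s a)" "y = lattice_point p (s + t) (p ^ s *s b)"
      using lattice_point_scale[OF p_pos, of s t a] lattice_point_scale[OF p_pos, of t s b]
      by (simp_all add: add.commute)
    then show ?thesis using level_gap_lipschitz by (simp only: d)
  qed
  have "uniformly_continuous_on L d"
    unfolding uniformly_continuous_on_def
  proof (intro allI impI)
    fix e :: real assume e: "e > 0"
    show "\<exists>\<delta>>0. \<forall>x\<in>L. \<forall>x'\<in>L. dist x' x < \<delta> \<longrightarrow> dist (d x') (d x) < e"
    proof (intro exI[of _ "e / real CARD('n)"] conjI ballI impI)
      show "e / real CARD('n) > 0" using e by simp
      fix x x' assume x: "x \<in> L" "x' \<in> L" "dist x' x < e / real CARD('n)"
      have "\<bar>d x' - d x\<bar> \<le> real CARD('n) * norm (x' - x)"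
        using lip[OF x(2,1)] norm1_le_norm[of "x' - x"] by linarith
      also have "\<dots> < e" using x(3) by (simp add: dist_norm field_simps)
      finally show "dist (d x') (d x) < e" by (simp add: dist_real_def)
    qed
  qed
  then obtain D where D: "uniformly_continuous_on (closure L) D" "\<And>x. x \<in> L \<Longrightarrow> d x = D x"
    using uniformly_continuous_on_extension_on_closure by metis
  have "orthant \<subseteq> closure L"
  proof
    fix x :: "real ^ 'n" assume "x \<in> orthant"
    then have lim: "(\<lambda>s. lattice_point p s (round_up p s x)) \<longlonglongrightarrow> x" using round_up_tendsto[OF p_gt_1] by simp
    show "x \<in> closure L"
      unfolding closure_sequential
      by (intro exI[of _ "\<lambda>s. lattice_point p s (round_up p s x)"] conjI lim) (auto simp: L_def)
  qed
  then have "continuous_on orthant D"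
    using uniformly_continuous_imp_continuous[OF D(1)] continuous_on_subset by blast
  moreover have "D (lattice_point p s a) = real_of_int (level_gap s a) / real (p ^ s)" for s a
    using D(2)[of "lattice_point p s a"] d unfolding L_def by force
  ultimately show ?thesis unfolding is_Delta_def level_gap_def by blast
qed

end

locale delta = form_pair p ell F G f g
  for p :: nat and ell :: "('k::field) bipoly ^ 'n::finite" and F G f g +
  fixes D :: "real ^ 'n \<Rightarrow> real"
  assumes D: "is_Delta p ell F G D"
begin

lemma D_lattice: "D (lattice_point p s a) = real_of_int (level_gap s a) / real (p ^ s)"
  using D unfolding is_Delta_def level_gap_def by blast

lemma D_limit: "0 \<le> x \<Longrightarrow> (\<lambda>s. D (lattice_point p s (round_up p s x))) \<longlonglongrightarrow> D x"
  by (rule continuous_on_tendsto_compose[of orthant, OF _ round_up_tendsto[OF p_gt_1]])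
    (use D lattice_point_nonneg in \<open>auto simp only: is_Delta_def eventually_sequentially\<close>)

lemma D_lipschitz: "0 \<le> x \<Longrightarrow> 0 \<le> y \<Longrightarrow> D x - D y \<le> norm1 (x - y)"
proof -
  assume x: "0 \<le> x" and y: "0 \<le> y"
  have "(\<lambda>s. D (lattice_point p s (round_up p s x)) - D (lattice_point p s (round_up p s y))) \<longlonglongrightarrow> D x - D y"
    by (intro tendsto_diff D_limit x y)
  moreover have "(\<lambda>s. norm1 (lattice_point p s (round_up p s x) - lattice_point p s (round_up p s y))) \<longlonglongrightarrow> norm1 (x - y)"
    by (intro tendsto_norm1 tendsto_diff round_up_tendsto p_gt_1 x y)
  moreover have "D (lattice_point p s a) - D (lattice_point p s b) \<le> norm1 (lattice_point p s a - lattice_point p s b)" for s a b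
    using level_gap_lipschitz[of s a b] unfolding D_lattice by linarith
  ultimately show ?thesis by (intro tendsto_le[OF sequentially_bot]) auto
qed

lemma D_ge: "0 \<le> x \<Longrightarrow> norm1 x - real_of_int (f + g) \<le> D x" and D_nonneg: "0 \<le> x \<Longrightarrow> 0 \<le> D x"
proof -
  assume x: "0 \<le> x"
  have *: "real (wt a) / real p ^ s - real_of_int (f + g) \<le> D (lattice_point p s a) \<and> 0 \<le> D (lattice_point p s a)" for s a
  proof -
    interpret q: form_pair p ell "F ^ p ^ s" "G ^ p ^ s" "int (p ^ s) * f" "int (p ^ s) * g"
      by (rule power_pair)
    have "real_of_int (int (wt a) - int (p ^ s) * f - int (p ^ s) * g) \<le> real_of_int (level_gap s a)"
      using q.gap_ge[of a] unfolding level_gap_def of_int_le_iff .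
    then have "(real (wt a) - real p ^ s * real_of_int (f + g)) / real (p ^ s) \<le> D (lattice_point p s a)"
      unfolding D_lattice by (intro divide_right_mono) (simp_all add: algebra_simps)
    moreover have "0 \<le> D (lattice_point p s a)"
      unfolding D_lattice using q.gap_nonneg[of a] by (simp add: level_gap_def)
    ultimately show ?thesis using p_pos by (simp add: diff_divide_distrib)
  qed
  have lim: "(\<lambda>s. norm1 (lattice_point p s (round_up p s x)) - real_of_int (f + g)) \<longlonglongrightarrow> norm1 x - real_of_int (f + g)"
    by (intro tendsto_diff tendsto_const tendsto_norm1 round_up_tendsto p_gt_1 x)
  show "norm1 x - real_of_int (f + g) \<le> D x"
    by (rule tendsto_le[OF sequentially_bot D_limit[OF x] lim])
      (intro always_eventually allI, unfold norm1_lattice_point, use * in blast)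
  show "0 \<le> D x"
    by (rule tendsto_le[OF sequentially_bot D_limit[OF x] tendsto_const]) (use * in simp)
qed

lemma D_member:
  assumes "ell_pow ell a \<in> ideal_gen {F ^ p ^ s, G ^ p ^ s}" "norm1 (lattice_point p s a) \<le> real_of_int (f + g)"
  shows "D (lattice_point p s a) = real_of_int (f + g) - norm1 (lattice_point p s a)"
proof -
  interpret q: form_pair p ell "F ^ p ^ s" "G ^ p ^ s" "int (p ^ s) * f" "int (p ^ s) * g"
    by (rule power_pair)
  have "real (wt a) \<le> real p ^ s * real_of_int (f + g)"
    using assms(2) p_pos unfolding norm1_lattice_point by (simp add: field_simps)
  then have "real_of_int (int (wt a)) \<le> real_of_int (int (p ^ s) * f + int (p ^ s) * g)"
    by (simp add: algebra_simps)
  then have "level_gap s a = int (p ^ s) * f + int (p ^ s) * g - int (wt a)"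
    unfolding level_gap_def of_int_le_iff by (rule q.gap_member[OF assms(1)])
  then have "real_of_int (level_gap s a) = real_of_int (int (p ^ s) * f + int (p ^ s) * g - int (wt a))"
    by (simp only:)
  then show ?thesis
    unfolding D_lattice norm1_lattice_point using p_pos by (simp add: field_simps)
qed

lemma member_of_D:
  assumes "real_of_int (f + g) - norm1 (lattice_point p s a) \<le> D (lattice_point p s a)"
    "norm1 (lattice_point p s a) < real_of_int (f + g)"
  shows "ell_pow ell a \<in> ideal_gen {F ^ p ^ s, G ^ p ^ s}"
proof -
  interpret q: form_pair p ell "F ^ p ^ s" "G ^ p ^ s" "int (p ^ s) * f" "int (p ^ s) * g"
    by (rule power_pair)
  have "real_of_int (int (wt a)) < real_of_int (int (p ^ s) * f + int (p ^ s) * g)"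
    using assms(2) p_pos unfolding norm1_lattice_point by (simp add: field_simps)
  moreover have "real_of_int (int (p ^ s) * f + int (p ^ s) * g - int (wt a)) \<le> real_of_int (level_gap s a)"
  proof -
    have "real p ^ s * (real_of_int (f + g) - real (wt a) / real p ^ s) \<le>
        real p ^ s * (real_of_int (level_gap s a) / real p ^ s)"
      using assms(1) unfolding norm1_lattice_point D_lattice by (intro mult_left_mono) simp_all
    then show ?thesis using p_pos by (simp add: right_diff_distrib distrib_left)
  qed
  ultimately show ?thesis
    unfolding level_gap_def of_int_le_iff of_int_less_iff by (intro q.member_of_gap)
qed

end

section \<open>Critical points are lattice points\<close>

text \<open>
  The property of the numerator of a critical point (\<open>critical_point_lattice\<close>) that can be transported from
  one ideal \<open>b\<^sub>j\<close> to another, because it is about membership only.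
\<close>

definition lattice_critical ::
  "nat \<Rightarrow> 'k::field bipoly ^ 'n::finite \<Rightarrow> 'k bipoly set \<Rightarrow> nat \<Rightarrow> nat ^ 'n \<Rightarrow> bool" where
  "lattice_critical p ell b s a \<longleftrightarrow> ell_pow ell a \<in> frob_power (p ^ s) b \<and>
     (\<forall>i. a $ i > 0 \<longrightarrow> ell_pow ell (a - axis i 1) \<notin> frob_power (p ^ s) b)"

context form_pair
begin

abbreviation "level_tight s \<equiv> tight ell (F ^ p ^ s) (G ^ p ^ s) (int (p ^ s) * f) (int (p ^ s) * g)"

lemma frob_gens: "frob_power (p ^ s) (ideal_gen {F, G}) = ideal_gen {F ^ p ^ s, G ^ p ^ s}"
  using frob_power_gen2[OF prime_CHAR_bipoly, of "p ^ s" s] CHAR_bipoly by simp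

lemma level_tight_scale: "level_tight s a \<Longrightarrow> level_tight (s + t) (p ^ t *s a)"
proof -
  interpret q: form_pair p ell "F ^ p ^ s" "G ^ p ^ s" "int (p ^ s) * f" "int (p ^ s) * g"
    by (rule power_pair)
  assume "level_tight s a"
  from q.tight_power[OF this refl, of t] show ?thesis
    by (simp add: power_mult[symmetric] power_add mult_ac)
qed

lemma level_bound_iff:
  "norm1 (lattice_point p s a) < real_of_int (f + g) \<longleftrightarrow> int (wt a) < int (p ^ s) * f + int (p ^ s) * g"
proof -
  have "norm1 (lattice_point p s a) < real_of_int (f + g) \<longleftrightarrow> real (wt a) < real p ^ s * real_of_int (f + g)"
    unfolding norm1_lattice_point using p_pos by (simp add: field_simps)
  also have "\<dots> \<longleftrightarrow> real_of_int (int (wt a)) < real_of_int (int (p ^ s) * f + int (p ^ s) * g)"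
    by (simp add: algebra_simps)
  finally show ?thesis by (simp only: of_int_less_iff)
qed

lemma lattice_critical_of_tight:
  assumes "level_tight s a" "norm1 (lattice_point p s a) < real_of_int (f + g)"
  shows "lattice_critical p ell (ideal_gen {F, G}) s a"
proof -
  interpret q: form_pair p ell "F ^ p ^ s" "G ^ p ^ s" "int (p ^ s) * f" "int (p ^ s) * g"
    by (rule power_pair)
  have "ell_pow ell (a - axis i 1) \<notin> ideal_gen {F ^ p ^ s, G ^ p ^ s}" if i: "a $ i > 0" for i
  proof
    assume mem: "ell_pow ell (a - axis i 1) \<in> ideal_gen {F ^ p ^ s, G ^ p ^ s}"
    have "a - (a - axis i 1) = axis i 1" and a: "a = (a - axis i 1) + axis i 1"
      using i by (auto simp: vec_eq_iff axis_def)
    then have "wt (a - axis i 1) + wt (a - (a - axis i 1)) = wt a" by (metis wt_add)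
    then have "a \<le> a - axis i 1"
      using q.tight_le_member[OF assms(1) mem] assms(2) unfolding level_bound_iff by simp
    then have "a $ i \<le> (a - axis i 1) $ i" unfolding less_eq_vec_def by blast
    then show False using i by (simp add: axis_def)
  qed
  then show ?thesis
    using q.tight_member[OF assms(1)] by (simp add: lattice_critical_def frob_gens)
qed

lemma ex_lattice_critical_below:
  assumes "ell_pow ell a \<in> frob_power (p ^ s) (ideal_gen {F, G})"
    "norm1 (lattice_point p s a) < real_of_int (f + g)"
  obtains b where "b \<le> a" "level_tight s b" "norm1 (lattice_point p s b) < real_of_int (f + g)"
proof -
  interpret q: form_pair p ell "F ^ p ^ s" "G ^ p ^ s" "int (p ^ s) * f" "int (p ^ s) * g"
    by (rule power_pair)
  obtain b where b: "b \<le> a" "level_tight s b"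
    using q.ex_tight_below assms(1) unfolding frob_gens by blast
  then have "norm1 (lattice_point p s b) < real_of_int (f + g)"
    using assms(2) wt_mono[OF b(1)] unfolding level_bound_iff by linarith
  then show ?thesis using that b by blast
qed

end

context delta
begin

lemma tight_D:
  assumes "level_tight s a" "norm1 (lattice_point p s a) < real_of_int (f + g)"
  shows "D (lattice_point p s a) = real_of_int (f + g) - norm1 (lattice_point p s a)"
  using D_member form_pair.tight_member[OF power_pair assms(1)] assms(2) by simp

text \<open>
  Apply \<open>tight_local_max\<close> at all finer levels: the lattice points of these levels are dense.
\<close>

lemma tight_local_max_D:
  assumes tight: "level_tight s a" and less: "norm1 (lattice_point p s a) < real_of_int (f + g)"
  shows "\<forall>\<^sub>F u in at (lattice_point p s a) within orthant. D u \<le> D (lattice_point p s a)"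
proof -
  let ?c = "lattice_point p s a"
  define e where "e = real_of_int (f + g) - norm1 ?c"
  have e: "e > 0" using less by (simp add: e_def)
  have lattice: "D (lattice_point p (s + t) b) \<le> D ?c" if b: "norm1 (?c - lattice_point p (s + t) b) \<le> e" for t b
  proof -
    let ?a = "p ^ t *s a" and ?q = "p ^ (s + t)"
    interpret q: form_pair p ell "F ^ ?q" "G ^ ?q" "int ?q * f" "int ?q * g"
      by (rule power_pair)
    have c: "?c = lattice_point p (s + t) ?a" using lattice_point_scale[OF p_pos, of s t a] by simp
    have q: "real ?q > 0" using p_pos by simp
    have e': "e = (real_of_int (int ?q * f + int ?q * g - int (wt ?a))) / real ?q"
      unfolding e_def c norm1_lattice_point using q by (simp add: field_simps)
    have cancel: "x \<le> y" if "x / real ?q \<le> y / real ?q" for x y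
      using that q by (simp only: divide_le_cancel)
    have "real (wt (?a - b) + wt (b - ?a)) / real ?q \<le> e"
      using b unfolding c norm1_lattice_point_diff by simp
    then have "real_of_int (int (wt (?a - b) + wt (b - ?a))) \<le> real_of_int (int ?q * f + int ?q * g - int (wt ?a))"
      unfolding e' of_int_of_nat_eq by (rule cancel)
    then have "q.gap b \<le> int ?q * f + int ?q * g - int (wt ?a)"
      unfolding of_int_le_iff by (rule q.tight_local_max[OF level_tight_scale[OF tight]])
    then have "real_of_int (level_gap (s + t) b) \<le> real_of_int (int ?q * f + int ?q * g - int (wt ?a))"
      unfolding level_gap_def of_int_le_iff .
    then have "D (lattice_point p (s + t) b) \<le> e"
      unfolding D_lattice e' by (intro divide_right_mono) auto
    then show ?thesis using tight_D[OF tight less] by (simp add: e_def)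
  qed
  \<comment> \<open>The norms are compared by \<open>norm1_le_norm\<close>, whence the factor \<open>CARD('n)\<close>.\<close>
  have near: "D u \<le> D ?c" if u: "u \<in> orthant" and d: "dist u ?c < e / real CARD('n)" for u
  proof (rule tendsto_le[OF sequentially_bot tendsto_const])
    have u0: "0 \<le> u" using u by simp
    have lim: "(\<lambda>t. lattice_point p (s + t) (round_up p (s + t) u)) \<longlonglongrightarrow> u"
      using LIMSEQ_ignore_initial_segment[OF round_up_tendsto[OF p_gt_1 u0], of s] by (simp only: add.commute)
    show "(\<lambda>t. D (lattice_point p (s + t) (round_up p (s + t) u))) \<longlonglongrightarrow> D u"
      using LIMSEQ_ignore_initial_segment[OF D_limit[OF u0], of s] by (simp only: add.commute)
    have "norm1 (?c - u) \<le> real CARD('n) * dist u ?c"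
      using norm1_le_norm[of "?c - u"] by (simp add: dist_norm norm_minus_commute)
    also have "\<dots> < e" using d by (simp add: field_simps)
    finally have "norm1 (?c - u) < e" .
    then have "\<forall>\<^sub>F t in sequentially. norm1 (?c - lattice_point p (s + t) (round_up p (s + t) u)) < e"
      by (intro order_tendstoD(2)[OF tendsto_norm1[OF tendsto_diff[OF tendsto_const lim]]])
    then show "\<forall>\<^sub>F t in sequentially. D (lattice_point p (s + t) (round_up p (s + t) u)) \<le> D ?c"
      by (rule eventually_mono) (rule lattice, simp)
  qed
  show ?thesis
    unfolding eventually_at using near e by (intro exI[of _ "e / real CARD('n)"]) simp
qed

text \<open>
  By the Lipschitz property, equality \<open>\<Delta>(c) = f + g - \<parallel>c\<parallel>\<close> persists above \<open>c\<close>, and at lattice points of total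
  degree less than \<open>f + g\<close> it means membership.
\<close>

lemma member_above:
  assumes "0 \<le> c" "D c = real_of_int (f + g) - norm1 c"
    "norm1 (lattice_point p s (round_up p s c)) < real_of_int (f + g)"
  shows "ell_pow ell (round_up p s c) \<in> ideal_gen {F ^ p ^ s, G ^ p ^ s}"
proof (rule member_of_D)
  let ?x = "lattice_point p s (round_up p s c)"
  have cx: "c \<le> ?x" by (rule round_up_ge[OF p_pos])
  have x0: "0 \<le> ?x" by (rule lattice_point_nonneg)
  have "D c - D ?x \<le> norm1 (c - ?x)" by (rule D_lipschitz[OF assms(1) x0])
  also have "norm1 (c - ?x) = norm1 (?x - c)" by (simp add: norm1_def abs_minus_commute)
  also have "\<dots> = norm1 ?x - norm1 c"
    unfolding norm1_diff_le[OF cx] using norm1_nonneg_vec[OF x0] norm1_nonneg_vec[OF assms(1)] by simp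
  finally show "real_of_int (f + g) - norm1 ?x \<le> D ?x" using assms(2) by simp
qed (fact assms(3))

text \<open>
  Above total degree \<open>f + g\<close> the function \<open>\<Delta>\<close> is positive, so it has no local maximum of value \<open>0\<close> on
  the boundary of that region.
\<close>

lemma critical_norm_less:
  assumes c: "0 \<le> c" and max: "\<forall>\<^sub>F u in at c within orthant. D u \<le> D c"
    and Dc: "D c = real_of_int (f + g) - norm1 c"
  shows "norm1 c < real_of_int (f + g)"
proof (rule ccontr)
  assume "\<not> ?thesis"
  then have zero: "D c = 0" "norm1 c = real_of_int (f + g)" using Dc D_nonneg[OF c] by linarith+
  obtain d where d: "d > 0" "\<And>u. u \<in> orthant \<Longrightarrow> u \<noteq> c \<Longrightarrow> dist u c < d \<Longrightarrow> D u \<le> D c"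
    using max unfolding eventually_at by blast
  define u where "u = c + axis undefined (d / 2)"
  have cu: "c \<le> u" using d(1) by (simp add: u_def less_eq_vec_def axis_def)
  then have u0: "0 \<le> u" using c by (rule order_trans[rotated])
  have "norm1 u - norm1 c = (\<Sum>i\<in>UNIV. (u - c) $ i)"
    using norm1_nonneg_vec[OF u0] norm1_nonneg_vec[OF c] by (simp add: sum_subtractf)
  also have "\<dots> = d / 2" by (simp add: u_def axis_def)
  finally have "norm1 u > norm1 c" using d(1) by simp
  then have "D u > D c" using D_ge[OF u0] zero by linarith
  moreover have "u \<noteq> c" using \<open>norm1 u > norm1 c\<close> by auto
  moreover have "dist u c < d"
    using norm_le_l1_cart[of "u - c"] d(1) by (simp add: u_def dist_norm axis_def)
  ultimately show False using d(2)[of u] u0 by simp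
qed

text \<open>
  Let \<open>a / p\<^sup>s\<close> be tight and below the rounded \<open>c\<close>.  It lies below \<open>c\<close> itself by \<open>tight_le_member\<close> at a
  finer level, and if it were different from \<open>c\<close>, then \<open>\<Delta>\<close> would increase from \<open>c\<close> towards it.
\<close>

lemma critical_is_tight:
  assumes c: "0 \<le> c" and max: "\<forall>\<^sub>F u in at c within orthant. D u \<le> D c"
    and Dc: "D c = real_of_int (f + g) - norm1 c"
  obtains s a where "c = lattice_point p s a" "level_tight s a" "norm1 c < real_of_int (f + g)"
proof -
  have less: "norm1 c < real_of_int (f + g)" by (rule critical_norm_less[OF assms])
  note lim = round_up_tendsto[OF p_gt_1 c]
  have "\<forall>\<^sub>F s in sequentially. norm1 (lattice_point p s (round_up p s c)) < real_of_int (f + g)"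
    by (rule order_tendstoD(2)[OF tendsto_norm1[OF lim] less])
  then obtain s where s: "norm1 (lattice_point p s (round_up p s c)) < real_of_int (f + g)"
    unfolding eventually_sequentially by blast
  obtain a where a: "a \<le> round_up p s c" "level_tight s a" "norm1 (lattice_point p s a) < real_of_int (f + g)"
    using ex_lattice_critical_below[OF _ s] member_above[OF c Dc s] unfolding frob_gens by blast
  let ?x = "lattice_point p s a"
  have x0: "0 \<le> ?x" by (rule lattice_point_nonneg)
  have xc: "?x \<le> c"
    unfolding less_eq_vec_def
  proof (rule allI, rule ccontr)
    fix i assume i: "\<not> ?x $ i \<le> c $ i"
    have "(\<lambda>s. lattice_point p s (round_up p s c) $ i) \<longlonglongrightarrow> c $ i" by (intro tendsto_vec_nth lim)
    then have "\<forall>\<^sub>F t in sequentially. lattice_point p t (round_up p t c) $ i < ?x $ i"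
      using i by (intro order_tendstoD(2)) auto
    then obtain N where "\<And>t. t \<ge> N \<Longrightarrow> lattice_point p t (round_up p t c) $ i < ?x $ i"
      unfolding eventually_sequentially by blast
    then have small: "lattice_point p (s + N) (round_up p (s + N) c) $ i < lattice_point p (s + N) (p ^ N *s a) $ i"
      unfolding lattice_point_scale[OF p_pos] by simp
    let ?q = "p ^ (s + N)" and ?a = "p ^ N *s a" and ?b = "round_up p (s + N) c"
    interpret q: form_pair p ell "F ^ ?q" "G ^ ?q" "int ?q * f" "int ?q * g"
      by (rule power_pair)
    let ?r = "p ^ N *s round_up p s c"
    have br: "?b \<le> ?r"
      unfolding less_eq_vec_def
    proof
      fix j
      have c0: "0 \<le> c $ j" using c by (simp add: less_eq_vec_def)
      have "c $ j * real p ^ (s + N) \<le> real_of_int (\<lceil>c $ j * real p ^ s\<rceil> * int p ^ N)"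
        using mult_right_mono[OF le_of_int_ceiling[of "c $ j * real p ^ s"], of "real p ^ N"]
        by (simp add: power_add mult.assoc)
      then have "\<lceil>c $ j * real p ^ (s + N)\<rceil> \<le> \<lceil>c $ j * real p ^ s\<rceil> * int p ^ N" by (simp only: ceiling_le_iff)
      then have "nat \<lceil>c $ j * real p ^ (s + N)\<rceil> \<le> nat (\<lceil>c $ j * real p ^ s\<rceil> * int p ^ N)" by (rule nat_mono)
      also have "\<dots> = p ^ N * nat \<lceil>c $ j * real p ^ s\<rceil>"
        using c0 by (simp add: nat_mult_distrib nat_power_eq mult.commute)
      finally show "?b $ j \<le> ?r $ j" by (simp add: round_up_def)
    qed
    have ar: "?a \<le> ?r" using a(1) by (simp add: less_eq_vec_def)
    have r: "norm1 (lattice_point p (s + N) ?r) < real_of_int (f + g)"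
      using s unfolding lattice_point_scale[OF p_pos] .
    have "norm1 (lattice_point p (s + N) ?b) < real_of_int (f + g)"
      using r wt_mono[OF br] unfolding level_bound_iff by linarith
    then have mem: "ell_pow ell ?b \<in> ideal_gen {F ^ ?q, G ^ ?q}" by (rule member_above[OF c Dc])
    have "?b + (?a - ?b) \<le> ?r" using br ar unfolding less_eq_vec_def vector_add_component vector_minus_component
      by (metis le_diff_conv2 le_add_diff_inverse nat_le_linear diff_is_0_eq add_0_right)
    then have "int (wt ?b + wt (?a - ?b)) < int ?q * f + int ?q * g"
      using r wt_mono unfolding level_bound_iff wt_add[symmetric] by fastforce
    then have "?a \<le> ?b" by (rule q.tight_le_member[OF level_tight_scale[OF a(2)] mem])
    then have "?a $ i \<le> ?b $ i" unfolding less_eq_vec_def by blast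
    then have "lattice_point p (s + N) ?a $ i \<le> lattice_point p (s + N) ?b $ i"
      unfolding lattice_point_nth
      by (intro divide_right_mono of_nat_mono) simp_all
    then show False using small by simp
  qed
  have "c = ?x"
  proof (rule ccontr)
    assume "c \<noteq> ?x"
    obtain d where d: "d > 0" "\<And>u. u \<in> orthant \<Longrightarrow> u \<noteq> c \<Longrightarrow> dist u c < d \<Longrightarrow> D u \<le> D c"
      using max unfolding eventually_at by blast
    \<comment> \<open>A point of the segment from \<open>c\<close> to the lattice point, inside the neighbourhood of the local maximum.\<close>
    define \<tau> where "\<tau> = min 1 (d / (2 * dist ?x c))"
    have dist: "dist ?x c > 0" using \<open>c \<noteq> ?x\<close> by simp
    then have \<tau>: "0 < \<tau>" "\<tau> \<le> 1" "\<tau> * dist ?x c < d"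
      using d(1) by (auto simp: \<tau>_def min_def field_simps)
    define u where "u = c + \<tau> *\<^sub>R (?x - c)"
    have xu: "?x \<le> u" and uc: "u \<le> c"
    proof -
      have mid: "y \<le> z + \<tau> * (y - z) \<and> z + \<tau> * (y - z) \<le> z" if "y \<le> z" for y z :: real
      proof -
        have "0 \<le> (1 - \<tau>) * (z - y)" "0 \<le> \<tau> * (z - y)" using \<tau> that by simp_all
        then show ?thesis by (simp add: algebra_simps)
      qed
      have "u $ i = c $ i + \<tau> * (?x $ i - c $ i)" for i by (simp add: u_def)
      moreover have "?x $ i \<le> c $ i" for i using xc unfolding less_eq_vec_def by blast
      ultimately have "?x $ i \<le> u $ i \<and> u $ i \<le> c $ i" for i using mid[of "?x $ i" "c $ i"] by presburger
      then show "?x \<le> u" "u \<le> c" by (auto simp: less_eq_vec_def)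
    qed
    have u0: "0 \<le> u" using x0 xu by (rule order_trans)
    have "c \<noteq> u" using \<tau>(1) \<open>c \<noteq> ?x\<close> by (simp add: u_def)
    then obtain i where i: "c $ i \<noteq> u $ i" by (auto simp: vec_eq_iff)
    have "norm1 u < norm1 c"
      unfolding norm1_nonneg_vec[OF u0] norm1_nonneg_vec[OF c]
      using uc i[symmetric] by (intro sum_strict_mono_ex1) (auto simp: less_eq_vec_def order_less_le)
    moreover have "D ?x - D u \<le> norm1 u - norm1 ?x"
    proof -
      have "norm1 (?x - u) = norm1 (u - ?x)" by (simp add: norm1_def abs_minus_commute)
      then show ?thesis
        using D_lipschitz[OF x0 u0] norm1_diff_le[OF xu] norm1_nonneg_vec[OF x0] norm1_nonneg_vec[OF u0] by simp
    qed
    moreover have "D ?x = real_of_int (f + g) - norm1 ?x" by (rule tight_D[OF a(2,3)])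
    ultimately have "D u > D c" using Dc by linarith
    moreover have "dist u c < d" using \<tau> by (simp add: u_def dist_norm)
    ultimately show False using d(2)[of u] u0 \<open>c \<noteq> u\<close> by force
  qed
  then show ?thesis using that a(2) less by blast
qed

end

lemma (in form_pair) critical_point_of_tight:
  assumes "f > 0" "g > 0" "level_tight s a" "norm1 (lattice_point p s a) < real_of_int (f + g)"
  shows "critical_point p ell (ideal_gen {F, G}) (lattice_point p s a)"
proof -
  obtain D where "is_Delta p ell F G D" using ex_Delta by blast
  then interpret delta p ell F G f g D by unfold_locales
  have deg: "int (total_degree F) = f" "int (total_degree G) = g" "int (total_degree (F * G)) = f + g"
    using total_degree_homog[OF F] total_degree_homog[OF G] F G
      total_degree_homog[OF homog_part_mult[OF F(1) G(1)]] by auto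
  have "coprime F G"
    using common_divisor_unit[OF primary] by (intro coprimeI) auto
  moreover have "is_form F" "is_form G" using F G by (auto simp: is_form_def)
  moreover have "total_degree F > 0" "total_degree G > 0" using deg assms(1,2) by auto
  moreover have "D (lattice_point p s a) = real (total_degree (F * G)) - norm1 (lattice_point p s a)"
    using tight_D[OF assms(3,4)] deg(3) by (metis of_int_of_nat_eq)
  moreover have "lattice_point p s a \<in> orthant" using lattice_point_nonneg by blast
  ultimately show ?thesis
    unfolding critical_point_def using D tight_local_max_D[OF assms(3,4)] by blast
qed

lemma (in arrangement) critical_point_lattice:
  assumes "critical_point p ell b c" "irrelevant_primary b"
  obtains s a where "c = lattice_point p s a" "lattice_critical p ell b s a"
proof -
  obtain U V D where UV: "is_form U" "is_form V" and b: "b = ideal_gen {U, V}" and D: "is_Delta p ell U V D"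
    and c: "c \<in> orthant" "\<forall>\<^sub>F u in at c within orthant. D u \<le> D c"
    and Dc: "D c = real (total_degree (U * V)) - norm1 c"
    using assms(1) unfolding critical_point_def by blast
  obtain u v where u: "U \<in> homog_part u" "U \<noteq> 0" and v: "V \<in> homog_part v" "V \<noteq> 0"
    using UV by (auto simp: is_form_def)
  interpret form_pair p ell U V u v
    using u v assms(2) by unfold_locales (simp_all add: b)
  interpret delta p ell U V u v D using D by unfold_locales
  have "int (total_degree (U * V)) = u + v"
    using total_degree_homog[OF homog_part_mult[OF u(1) v(1)]] u v by simp
  then have "D c = real_of_int (u + v) - norm1 c" using Dc by (metis of_int_of_nat_eq)
  then obtain s a where *: "c = lattice_point p s a" "level_tight s a" "norm1 c < real_of_int (u + v)"
    using critical_is_tight[of c] c by auto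
  then have "lattice_critical p ell b s a" unfolding b using lattice_critical_of_tight by blast
  then show ?thesis using that * by blast
qed

section \<open>Frobenius powers of the maximal ideal\<close>

lemma frob_power_mono: "I \<subseteq> J \<Longrightarrow> frob_power q I \<subseteq> frob_power q (J :: 'a::comm_ring_1 set)"
  unfolding frob_power_def by (intro module.span_mono[OF module_mult]) auto

lemma homog_part_in_max_ideal:
  assumes "F \<in> homog_part d" "d > 0"
  shows "F \<in> max_ideal"
proof -
  obtain c F' where F: "F = pCons c F'" by (cases F)
  obtain k c' where c: "c = pCons k c'" by (cases c)
  have "coeff (coeff F 0) 0 = 0" using assms by (intro homog_partD[OF assms(1)]) simp
  then have "F = [:c':] * var_x + F' * var_y"
    by (simp add: F c var_x_def var_y_def)
  then show ?thesis unfolding max_ideal_def in_ideal_gen2 by blast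
qed

context arrangement
begin

lemma xy_pair: "form_pair p ell var_x var_y 1 1"
proof unfold_locales
  show "irrelevant_primary (ideal_gen {var_x :: 'k bipoly, var_y})"
    unfolding irrelevant_primary_def by (intro exI[of _ 1]) (auto intro: module.span_base[OF module_mult])
qed (auto simp: var_x_homog var_y_homog, simp_all add: var_x_def var_y_def)

lemma xy_power_pair: "form_pair p ell (var_x ^ p ^ s) (var_y ^ p ^ s) (int (p ^ s)) (int (p ^ s))"
  using form_pair.power_pair[OF xy_pair, of s] by simp

lemma frob_max: "frob_power (p ^ s) max_ideal = ideal_gen {var_x ^ p ^ s, var_y ^ p ^ s :: 'k bipoly}"
  unfolding max_ideal_def by (rule form_pair.frob_gens[OF xy_pair])

definition mem :: "nat \<Rightarrow> nat ^ 'n \<Rightarrow> bool" where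
  "mem s a \<longleftrightarrow> ell_pow ell a \<in> frob_power (p ^ s) max_ideal"

lemma mem_iff: "mem s a \<longleftrightarrow> ell_pow ell a \<in> ideal_gen {var_x ^ p ^ s, var_y ^ p ^ s}"
  by (simp add: mem_def frob_max)

lemma mem_mono: "mem s a \<Longrightarrow> a \<le> b \<Longrightarrow> mem s b"
  unfolding mem_iff by (rule form_pair.member_mono[OF xy_power_pair])

lemma mem_scale: "mem (s + t) (p ^ t *s a) \<longleftrightarrow> mem s a"
  using form_pair.member_power_iff[OF xy_power_pair, where s1 = s and t = t and a = a]
  unfolding mem_iff by (simp add: power_add power_mult)

lemma mem_upward:
  assumes "mem s a" "\<And>i. real (a $ i) / real p ^ s \<le> real (b $ i) / real p ^ t"
  shows "mem t b"
proof -
  have "p ^ t *s a \<le> p ^ s *s b"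
    unfolding less_eq_vec_def
  proof
    fix i
    have "real (p ^ t * a $ i) \<le> real (p ^ s * b $ i)" using assms(2)[of i] p_pos by (simp add: field_simps)
    then show "(p ^ t *s a) $ i \<le> (p ^ s *s b) $ i" by (simp only: of_nat_le_iff vector_smult_component)
  qed
  moreover have "mem (s + t) (p ^ t *s a)" using assms(1) by (simp add: mem_scale)
  ultimately have "mem (t + s) (p ^ s *s b)" using mem_mono by (simp add: add.commute)
  then show ?thesis by (simp only: mem_scale)
qed

lemma mem_of_degree: "2 * p ^ s \<le> wt a + 1 \<Longrightarrow> mem s a"
  unfolding mem_iff by (rule form_pair.member_of_degree[OF xy_power_pair]) (simp flip: of_nat_power)

lemma not_mem_zero: "\<not> mem 0 0"
proof
  assume "mem 0 0"
  then obtain r s where rs: "1 = r * var_x + s * (var_y :: 'k bipoly)"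
    by (auto simp: mem_iff ell_pow_0 in_ideal_gen2)
  have "coeff (coeff (r * var_x + s * (var_y :: 'k bipoly)) 0) 0 = 0"
    by (simp add: var_x_def var_y_def coeff_mult)
  then show False unfolding rs[symmetric] by simp
qed

text \<open>
  The membership of \<open>\<ell>\<^sup>a\<close> in Frobenius powers of the colon ideals of the algorithm reduces to
  membership in Frobenius powers of the maximal ideal.
\<close>

definition level_ideal :: "nat \<Rightarrow> nat ^ 'n \<Rightarrow> 'k bipoly set" where
  "level_ideal s a = ideal_colon (frob_power (p ^ s) max_ideal) (ell_pow ell a)"

lemma frob_level_ideal: "frob_power (p ^ t) (level_ideal s a) = level_ideal (s + t) (p ^ t *s a)"
  using form_pair.colon_frob_power[OF xy_power_pair, where s1 = s and t = t and a = a]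
  unfolding level_ideal_def frob_max by (simp add: power_add power_mult)

lemma colon_level_ideal: "ideal_colon (level_ideal s a) (ell_pow ell b) = level_ideal s (a + b)"
  by (auto simp: level_ideal_def ideal_colon_def ell_pow_add mult_ac)

lemma in_level_ideal: "ell_pow ell b \<in> level_ideal s a \<longleftrightarrow> mem s (a + b)"
  by (simp add: level_ideal_def ideal_colon_def mem_def ell_pow_add mult.commute)

lemma level_ideal_unit: "level_ideal s a = ideal_gen {1} \<longleftrightarrow> mem s a"
proof
  assume "level_ideal s a = ideal_gen {1}"
  then have "ell_pow ell 0 \<in> level_ideal s a" by (simp add: ideal_gen_1)
  then show "mem s a" by (simp add: in_level_ideal)
next
  assume "mem s a"
  then show "level_ideal s a = ideal_gen {1}"
    unfolding level_ideal_def mem_iff frob_max ideal_gen_1 ideal_colon_def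
    using ideal_gen2_mult by blast
qed

lemma level_ideal_pair:
  assumes "\<not> mem s a"
  obtains U V u v where "form_pair p ell U V u v" "u > 0" "v > 0" "u + v = 2 * int (p ^ s) - int (wt a)"
    "level_ideal s a = ideal_gen {U, V}"
  using form_pair.colon_dichotomy[OF xy_power_pair, where s1 = s and a = a] assms
  unfolding level_ideal_def mem_iff frob_max by (metis mult_2)

lemma level_ideal_primary: "irrelevant_primary (level_ideal s a)"
proof -
  have "ideal_gen {var_x ^ p ^ s, var_y ^ p ^ s} \<subseteq> level_ideal s a"
    unfolding level_ideal_def frob_max ideal_colon_def using ideal_gen2_mult
    by (auto simp: mult.commute)
  moreover have "{var_x ^ p ^ s, var_y ^ p ^ s} \<subseteq> ideal_gen {var_x ^ p ^ s, var_y ^ p ^ s :: 'k bipoly}"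
    by (auto intro: module.span_base[OF module_mult])
  ultimately show ?thesis unfolding irrelevant_primary_def by blast
qed

lemma level_ideal_subset_max:
  assumes "\<not> mem s a"
  shows "level_ideal s a \<subseteq> max_ideal"
proof -
  obtain U V u v where UV: "form_pair p ell U V u v" "u > 0" "v > 0" "level_ideal s a = ideal_gen {U, V}"
    using level_ideal_pair[OF assms] by metis
  then have "U \<in> max_ideal" "V \<in> max_ideal"
    using homog_part_in_max_ideal form_pair.F(1)[OF UV(1)] form_pair.G(1)[OF UV(1)] by blast+
  then show ?thesis
    unfolding UV(4) max_ideal_def
    by (intro module.span_minimal[OF module_mult _ module.subspace_span[OF module_mult]]) auto
qed

text \<open>
  The numerical hypothesis says that \<open>b/p\<^sup>t\<close> has norm less than the sum of the degrees of the two generators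
  of the colon ideal.
\<close>

lemma level_ideal_critical:
  assumes "\<not> mem s a" "mem (s + t) (b + p ^ t *s a)" "wt b + p ^ t * wt a < 2 * p ^ (s + t)"
  obtains c where "critical_point_under p ell (level_ideal s a) (lattice_point p t b) c"
proof -
  obtain U V u v where UV: "form_pair p ell U V u v" "u > 0" "v > 0" "u + v = 2 * int (p ^ s) - int (wt a)"
      "level_ideal s a = ideal_gen {U, V}"
    using level_ideal_pair[OF assms(1)] .
  interpret form_pair p ell U V u v by (rule UV(1))
  have 1: "ell_pow ell b \<in> frob_power (p ^ t) (ideal_gen {U, V})"
    using assms(2) unfolding UV(5)[symmetric] frob_level_ideal in_level_ideal by (simp add: add.commute)
  have "int (wt b) + int (p ^ t) * int (wt a) < int (p ^ t) * (2 * int (p ^ s))"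
    using assms(3) unfolding power_add by (metis (no_types, lifting) mult.left_commute mult.commute of_nat_add of_nat_less_iff of_nat_mult of_nat_numeral)
  then have "int (wt b) < int (p ^ t) * u + int (p ^ t) * v"
    unfolding distrib_left[symmetric] UV(4) by (simp add: right_diff_distrib)
  then have 2: "norm1 (lattice_point p t b) < real_of_int (u + v)"
    unfolding level_bound_iff .
  obtain c where c: "c \<le> b" "level_tight t c" "norm1 (lattice_point p t c) < real_of_int (u + v)"
    using ex_lattice_critical_below[OF 1 2] .
  have "lattice_point p t c \<le> lattice_point p t b"
    using c(1) unfolding less_eq_vec_def lattice_point_nth by (simp add: divide_right_mono)
  then show ?thesis
    using that critical_point_of_tight[OF UV(2,3) c(2,3)] unfolding critical_point_under_def UV(5) by blast
qed

lemma lattice_critical_level_ideal: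
  "lattice_critical p ell (level_ideal s a) t b \<longleftrightarrow> mem (s + t) (b + p ^ t *s a) \<and>
     (\<forall>i. b $ i > 0 \<longrightarrow> \<not> mem (s + t) (b - axis i 1 + p ^ t *s a))"
  by (simp add: lattice_critical_def frob_level_ideal in_level_ideal add.commute)

end

section \<open>Base \<open>p\<close> expansions\<close>

context
  fixes p :: nat and t :: real
  assumes p: "p > 1" and t: "0 < t" "t \<le> 1"
begin

text \<open>The numerator of \<open>\<langle>t\<rangle>\<^sub>e\<close>.\<close>

definition ceil_num :: "nat \<Rightarrow> int" where
  "ceil_num e = \<lceil>t * real p ^ e\<rceil> - 1"

lemma ceil_num_bounds: "real_of_int (ceil_num e) < t * real p ^ e" "t * real p ^ e \<le> real_of_int (ceil_num e) + 1"
  unfolding ceil_num_def by linarith+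

lemma ceil_num_unique: "real_of_int m < t * real p ^ e \<Longrightarrow> t * real p ^ e \<le> real_of_int m + 1 \<Longrightarrow> ceil_num e = m"
  unfolding ceil_num_def by linarith

lemma ceil_num_0: "ceil_num 0 = 0"
  using t by (intro ceil_num_unique) auto

lemma ceil_num_step: "0 \<le> ceil_num (Suc e) - int p * ceil_num e" "ceil_num (Suc e) - int p * ceil_num e < int p"
proof -
  have "real p * real_of_int (ceil_num e) < t * real p ^ Suc e" "t * real p ^ Suc e \<le> real p * (real_of_int (ceil_num e) + 1)"
    using ceil_num_bounds[of e] p by (simp_all add: mult.left_commute)
  then have "real_of_int (int p * ceil_num e) < real_of_int (ceil_num (Suc e) + 1)"
    "real_of_int (ceil_num (Suc e)) < real_of_int (int p * (ceil_num e + 1))"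
    using ceil_num_bounds[of "Suc e"] by simp_all
  then have "int p * ceil_num e < ceil_num (Suc e) + 1" "ceil_num (Suc e) < int p * (ceil_num e + 1)"
    unfolding of_int_less_iff .
  then show "0 \<le> ceil_num (Suc e) - int p * ceil_num e" "ceil_num (Suc e) - int p * ceil_num e < int p"
    by (simp_all add: algebra_simps)
qed

lemma ceil_num_nonneg: "0 \<le> ceil_num e"
proof (induction e)
  case (Suc e)
  then show ?case using ceil_num_step(1)[of e] mult_nonneg_nonneg[of "int p" "ceil_num e"] by linarith
qed (simp add: ceil_num_0)

lemma ceil_num_tendsto: "(\<lambda>e. real_of_int (ceil_num e) / real p ^ e) \<longlonglongrightarrow> t"
proof (rule tendsto_sandwich)
  have "(\<lambda>s. inverse (real p ^ s)) \<longlonglongrightarrow> 0"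
    using p by (intro LIMSEQ_inverse_realpow_zero) simp
  from tendsto_diff[OF tendsto_const[of t] this]
  show "(\<lambda>e. t - inverse (real p ^ e)) \<longlonglongrightarrow> t" by simp
  show "(\<lambda>e. t) \<longlonglongrightarrow> t" by simp
  have "t - inverse (real p ^ e) \<le> real_of_int (ceil_num e) / real p ^ e" for e
  proof -
    have "(t * real p ^ e - 1) / real p ^ e \<le> real_of_int (ceil_num e) / real p ^ e"
      using ceil_num_bounds(2)[of e] by (intro divide_right_mono) auto
    then show ?thesis using p by (simp add: diff_divide_distrib inverse_eq_divide)
  qed
  then show "\<forall>\<^sub>F e in sequentially. t - inverse (real p ^ e) \<le> real_of_int (ceil_num e) / real p ^ e" by simp
  have "real_of_int (ceil_num e) / real p ^ e \<le> t" for e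
    using ceil_num_bounds(1)[of e] p by (simp add: field_simps)
  then show "\<forall>\<^sub>F e in sequentially. real_of_int (ceil_num e) / real p ^ e \<le> t" by simp
qed

definition expansion :: "nat \<Rightarrow> nat" where
  "expansion s = (case s of 0 \<Rightarrow> 0 | Suc e \<Rightarrow> nat (ceil_num (Suc e) - int p * ceil_num e))"

lemma expansion_partial_sum:
  "(\<Sum>s<e. real (expansion (Suc s)) / real p ^ Suc s) = real_of_int (ceil_num e) / real p ^ e"
proof (induction e)
  case (Suc e)
  have "real (expansion (Suc e)) = real_of_int (ceil_num (Suc e)) - real p * real_of_int (ceil_num e)"
    using ceil_num_step(1)[of e] by (simp add: expansion_def of_nat_nat)
  then show ?case using Suc p by (simp add: diff_divide_distrib)
qed (simp add: ceil_num_0)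

lemma nonterm_expansion_ex: "nonterm_expansion p t expansion"
  unfolding nonterm_expansion_def
proof (intro conjI allI)
  show "expansion 0 = 0" by (simp add: expansion_def)
  show "expansion s < p" for s
    using ceil_num_step p by (auto simp: expansion_def nat_less_iff split: nat.split)
  show "(\<lambda>s. real (expansion (Suc s)) / real p ^ Suc s) sums t"
    unfolding sums_def expansion_partial_sum by (rule ceil_num_tendsto)
  show "infinite {s. expansion s \<noteq> 0}"
  proof
    assume "finite {s. expansion s \<noteq> 0}"
    then obtain N where N: "\<And>s. s > N \<Longrightarrow> expansion s = 0"
      using finite_nat_set_iff_bounded_le by (metis (mono_tags, lifting) mem_Collect_eq not_le)
    have const: "real_of_int (ceil_num (N + k)) / real p ^ (N + k) = real_of_int (ceil_num N) / real p ^ N" for k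
    proof (induction k)
      case (Suc k)
      have "real_of_int (ceil_num (Suc (N + k))) / real p ^ Suc (N + k) =
          real_of_int (ceil_num (N + k)) / real p ^ (N + k)"
        unfolding expansion_partial_sum[symmetric] using N[of "Suc (N + k)"] by simp
      then show ?case using Suc by simp
    qed simp
    have "(\<lambda>k. real_of_int (ceil_num (N + k)) / real p ^ (N + k)) \<longlonglongrightarrow> t"
      using LIMSEQ_ignore_initial_segment[OF ceil_num_tendsto, of N] by (simp add: add.commute)
    then have "t = real_of_int (ceil_num N) / real p ^ N"
      unfolding const using LIMSEQ_unique tendsto_const by blast
    then have "t * real p ^ N = real_of_int (ceil_num N)" using p by (simp add: nonzero_eq_divide_eq)
    then show False using ceil_num_bounds(1)[of N] by linarith
  qed
qed

text \<open>
  The tail of a non-terminating expansion after the first \<open>e\<close> digits lies in the half-open interval from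
  \<open>0\<close> (excluded) to \<open>1 / p\<^sup>e\<close> (included), so these digits are those of \<open>\<lceil>t p\<^sup>e\<rceil> - 1\<close>.
\<close>

lemma nonterm_expansion_unique:
  assumes "nonterm_expansion p t f"
  shows "f = expansion"
proof -
  have f: "f 0 = 0" "\<And>s. f s < p" "infinite {s. f s \<noteq> 0}" "(\<lambda>s. real (f (Suc s)) / real p ^ Suc s) sums t"
    using assms by (auto simp: nonterm_expansion_def)
  define M where "M = rec_nat 0 (\<lambda>e M. p * M + f (Suc e))"
  have M: "M 0 = 0" "M (Suc e) = p * M e + f (Suc e)" for e by (simp_all add: M_def)
  have psum: "(\<Sum>s<e. real (f (Suc s)) / real p ^ Suc s) = real (M e) / real p ^ e" for e
  proof (induction e)
    case (Suc e)
    then show ?case using p by (simp add: M(2) add_divide_distrib)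
  qed (simp add: M(1))
  have lim: "(\<lambda>e. real (M e) / real p ^ e) \<longlonglongrightarrow> t"
    using f(4) unfolding sums_def psum .
  have mono: "real (M e) / real p ^ e \<le> real (M e') / real p ^ e'" if "e \<le> e'" for e e'
    unfolding psum[symmetric] using that by (intro sum_mono2) auto
  have "ceil_num e = int (M e)" for e
  proof (rule ceil_num_unique)
    obtain s where s: "s > e" "f s \<noteq> 0"
      using f(3) unfolding infinite_nat_iff_unbounded by blast
    then obtain s' where s': "s = Suc s'" by (cases s) auto
    have "real (M e) / real p ^ e \<le> real (M s') / real p ^ s'" using s(1) s' by (intro mono) simp
    also have "\<dots> < real (M s) / real p ^ s"
      unfolding psum[symmetric] s' using s(2) s' p by simp
    also have "\<dots> \<le> t"
      by (rule LIMSEQ_le_const[OF lim]) (use mono in blast)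
    finally show "real_of_int (int (M e)) < t * real p ^ e" using p by (simp add: field_simps)
    have "M (e + k) + 1 \<le> p ^ k * (M e + 1)" for k
    proof (induction k)
      case (Suc k)
      have "M (e + Suc k) + 1 \<le> p * (M (e + k) + 1)" using f(2)[of "Suc (e + k)"] by (simp add: M(2))
      also have "\<dots> \<le> p * (p ^ k * (M e + 1))" by (rule mult_le_mono2[OF Suc])
      finally show ?case by (simp only: power_Suc mult.assoc)
    qed simp
    then have bound: "M (e + k) \<le> p ^ k * (M e + 1)" for k by (meson add_leD1)
    have le: "real (M (e + k)) / real p ^ (e + k) \<le> real (M e + 1) / real p ^ e" for k
    proof -
      have "real (M (e + k)) / real p ^ (e + k) \<le> real (p ^ k * (M e + 1)) / real p ^ (e + k)"
        by (intro divide_right_mono of_nat_mono bound) simp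
      also have "\<dots> = real (M e + 1) / real p ^ e" using p by (simp add: power_add field_simps)
      finally show ?thesis .
    qed
    have "t \<le> real (M e + 1) / real p ^ e"
    proof (rule LIMSEQ_le_const2[OF lim], intro exI allI impI)
      fix n assume "e \<le> n"
      then show "real (M n) / real p ^ n \<le> real (M e + 1) / real p ^ e" using le[of "n - e"] by simp
    qed
    then show "t * real p ^ e \<le> real_of_int (int (M e)) + 1" using p by (simp add: field_simps)
  qed
  then have "f (Suc e) = expansion (Suc e)" for e
    by (simp add: expansion_def M(2))
  then show ?thesis using f(1) by (auto simp: fun_eq_iff expansion_def split: nat.split)
qed

lemma ex1_nonterm_expansion: "\<exists>!f. nonterm_expansion p t f"
  using nonterm_expansion_ex nonterm_expansion_unique by blast

lemma digit_eq: "int (digit p t (Suc e)) = ceil_num (Suc e) - int p * ceil_num e"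
proof -
  have "digit p t = expansion"
    unfolding digit_def using nonterm_expansion_ex nonterm_expansion_unique by (rule the_equality)
  then show ?thesis using ceil_num_step(1)[of e] by (simp add: expansion_def)
qed

end

section \<open>The F-pure threshold of a product of powers of linear forms\<close>

lemma norm1_real_vec: "norm1 (real_vec a) = real (wt a)"
  by (simp add: norm1_def real_vec_def wt_def)

context arrangement
begin

definition critical_mem :: "nat \<Rightarrow> nat ^ 'n \<Rightarrow> bool" where
  "critical_mem s a \<longleftrightarrow> mem s a \<and> (\<forall>i. a $ i > 0 \<longrightarrow> \<not> mem s (a - axis i 1))"

text \<open>
  The lemma \<open>tight_le_member\<close> for the maximal ideal, with both exponents brought to a common level.
\<close>

lemma critical_mem_le:
  assumes "critical_mem s a" "mem (s + t) b" "wt b + wt (p ^ t *s a - b) < 2 * p ^ (s + t)"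
  shows "p ^ t *s a \<le> b"
proof -
  interpret q: form_pair p ell "var_x ^ p ^ s" "var_y ^ p ^ s" "int (p ^ s)" "int (p ^ s)"
    by (rule xy_power_pair)
  interpret r: form_pair p ell "var_x ^ p ^ (s + t)" "var_y ^ p ^ (s + t)" "int (p ^ (s + t))" "int (p ^ (s + t))"
    by (rule xy_power_pair)
  have "q.tight_exp a"
    using assms(1) unfolding critical_mem_def mem_iff by (intro q.tight_of_minimal) auto
  from q.tight_power[OF this refl, of t] have tight: "r.tight_exp (p ^ t *s a)"
    by (simp add: power_mult[symmetric] power_add mult.commute)
  have "int (wt b + wt (p ^ t *s a - b)) < int (p ^ (s + t)) + int (p ^ (s + t))"
    using assms(3) by linarith
  with tight assms(2) show ?thesis unfolding mem_iff by (rule r.tight_le_member)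
qed

lemma mem_axis: "p ^ s \<le> k \<Longrightarrow> mem s (axis i k)"
proof -
  assume k: "p ^ s \<le> k"
  have "ell $ i \<in> max_ideal"
    using homog_part_in_max_ideal[OF linear_form_homog[OF linear]] by simp
  then have "ell $ i ^ p ^ s \<in> frob_power (p ^ s) max_ideal"
    unfolding frob_power_def by (auto intro!: module.span_base[OF module_mult])
  then have "mem s (axis i (p ^ s))" by (simp add: mem_def ell_pow_axis)
  then show ?thesis by (rule mem_mono) (use k in \<open>simp add: less_eq_vec_def axis_def\<close>)
qed

lemma critical_mem_axis: "critical_mem 0 (axis i 1)"
proof -
  have "axis i 1 - axis i 1 = (0 :: nat ^ 'n)" by simp
  then show ?thesis
    unfolding critical_mem_def using mem_axis[of 0 1 i] not_mem_zero by (auto simp: axis_def vec_eq_iff split: if_splits)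
qed

lemma fpt_alt: "fpt p (ell_pow ell a) = Inf {real k / real (p ^ s) | k s. mem s (k *s a)}"
  by (simp add: fpt_def mem_def ell_pow_scale)

lemma fpt_le: "mem s (k *s a) \<Longrightarrow> fpt p (ell_pow ell a) \<le> real k / real p ^ s"
  unfolding fpt_alt by (rule cInf_lower) (auto intro!: bdd_belowI[of _ 0])

lemma fpt_eqI:
  assumes "wt a > 0" "0 \<le> r"
    and lower: "\<And>s k. mem s (k *s a) \<Longrightarrow> r \<le> real k / real p ^ s"
    and upper: "\<And>s k. r \<le> real k / real p ^ s \<Longrightarrow> mem s (k *s a)"
  shows "fpt p (ell_pow ell a) = r"
proof (rule antisym)
  have "fpt p (ell_pow ell a) \<le> r + inverse (real p ^ s)" for s
  proof -
    have ps: "real p ^ s > 0" using p_pos by simp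
    have "r * real p ^ s \<le> real (nat \<lceil>r * real p ^ s\<rceil>)" by linarith
    then have "r \<le> real (nat \<lceil>r * real p ^ s\<rceil>) / real p ^ s" using ps by (simp add: pos_le_divide_eq)
    then have "fpt p (ell_pow ell a) \<le> real (nat \<lceil>r * real p ^ s\<rceil>) / real p ^ s" by (intro fpt_le upper)
    also have "\<dots> \<le> (r * real p ^ s + 1) / real p ^ s"
    proof (rule divide_right_mono)
      have "0 \<le> r * real p ^ s" using assms(2) by simp
      then show "real (nat \<lceil>r * real p ^ s\<rceil>) \<le> r * real p ^ s + 1" by linarith
    qed simp
    also have "\<dots> = r + inverse (real p ^ s)" using ps by (simp add: add_divide_distrib inverse_eq_divide)
    finally show ?thesis .
  qed
  moreover have "(\<lambda>s. r + inverse (real p ^ s)) \<longlonglongrightarrow> r + 0"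
    using p_gt_1 by (intro tendsto_add tendsto_const LIMSEQ_inverse_realpow_zero) simp
  ultimately show "fpt p (ell_pow ell a) \<le> r"
    using LIMSEQ_le_const[of _ "r + 0"] by auto
  have "mem 0 (2 *s a)" using assms(1) by (intro mem_of_degree) (simp add: wt_scale)
  then show "r \<le> fpt p (ell_pow ell a)"
    unfolding fpt_alt using lower by (intro cInf_greatest) auto
qed

text \<open>
  The exponent of \<open>\<ell>\<^sub>i\<^sup>q\<close> is minimal in \<open>\<mm>\<^sup>[\<^sup>q\<^sup>]\<close>.  If \<open>k a\<^sub>i < q\<close>, the least common multiple of \<open>\<ell>\<^sub>i\<^sup>q\<close> and \<open>G\<^sup>k\<close> has
  degree less than \<open>2q\<close>, as \<open>a\<^sub>i\<close> is at least half of the total; so \<open>critical_mem_le\<close> excludes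
  \<open>G\<^sup>k \<in> \<mm>\<^sup>[\<^sup>q\<^sup>]\<close>.
\<close>

lemma fpt_large_exponent:
  assumes "real (a $ i) \<ge> norm1 (real_vec a) / 2" "a $ i > 0"
  shows "fpt p (ell_pow ell a) = 1 / real (a $ i)"
proof (rule fpt_eqI)
  have wt: "wt a \<le> 2 * a $ i" using assms(1) unfolding norm1_real_vec by linarith
  have "a $ i \<le> wt a" unfolding wt_def by (rule member_le_sum) auto
  then show "wt a > 0" using assms(2) by linarith
  show "0 \<le> 1 / real (a $ i)" by simp
  have iff: "1 / real (a $ i) \<le> real k / real p ^ s \<longleftrightarrow> p ^ s \<le> k * a $ i" for k s
  proof -
    have "1 / real (a $ i) \<le> real k / real p ^ s \<longleftrightarrow> real (p ^ s) \<le> real (k * a $ i)"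
      using assms(2) p_pos by (simp add: field_simps)
    then show ?thesis by (simp only: of_nat_le_iff)
  qed
  show "mem s (k *s a)" if "1 / real (a $ i) \<le> real k / real p ^ s" for s k
    by (rule mem_mono[OF mem_axis[of s "k * a $ i" i]])
      (use that[unfolded iff] in \<open>simp_all add: less_eq_vec_def axis_def\<close>)
  show "1 / real (a $ i) \<le> real k / real p ^ s" if mem: "mem s (k *s a)" for s k
    unfolding iff
  proof (rule ccontr)
    assume less: "\<not> p ^ s \<le> k * a $ i"
    have "p ^ s *s axis i 1 - k *s a = axis i (p ^ s - k * a $ i)"
      by (simp add: vec_eq_iff axis_def)
    moreover have "wt (axis i (p ^ s - k * a $ i)) = p ^ s - k * a $ i"
      by (simp add: wt_def axis_def)
    moreover have "k * wt a \<le> 2 * (k * a $ i)" using mult_le_mono2[OF wt, of k] by simp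
    moreover have "B + (P - A) < 2 * P" if "B \<le> 2 * A" "\<not> P \<le> A" for A B P :: nat
      using that by linarith
    ultimately have "wt (k *s a) + wt (p ^ s *s axis i 1 - k *s a) < 2 * p ^ (0 + s)"
      using less unfolding wt_scale by (metis add_0)
    then have "p ^ s *s axis i 1 \<le> k *s a"
      using critical_mem_le[OF critical_mem_axis, of s] mem by simp
    then have "(p ^ s *s axis i 1) $ i \<le> (k *s a) $ i" unfolding less_eq_vec_def by blast
    then show False using less by (simp add: axis_def)
  qed
qed

end

section \<open>No exponent reaches half of the total\<close>

locale balanced = arrangement p ell for p :: nat and ell :: "('k::field) bipoly ^ 'n::finite" +
  fixes a :: "nat ^ 'n"
  assumes a_pos: "\<And>i. a $ i > 0" and small: "\<And>i. real (a $ i) < norm1 (real_vec a) / 2"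
begin

abbreviation "x i \<equiv> lam a * real (a $ i)"

lemma wt_pos: "wt a > 0"
  using small[of undefined] unfolding norm1_real_vec by (cases "wt a") auto

lemma lam_alt: "lam a = 2 / real (wt a)"
  by (simp add: lam_def norm1_real_vec)

lemma x_pos: "0 < x i" and x_le: "x i \<le> 1"
  using a_pos[of i] small[of i] wt_pos unfolding lam_alt norm1_real_vec by (simp_all add: field_simps)

lemma sum_x: "(\<Sum>i\<in>UNIV. x i) = 2"
proof -
  have "(\<Sum>i\<in>UNIV. x i) = lam a * real (wt a)" unfolding wt_def by (simp add: sum_distrib_left)
  then show ?thesis using wt_pos by (simp add: lam_alt)
qed

text \<open>The numerators of \<open>\<langle>\<lambda>a\<rangle>\<^sub>e\<close>.\<close>

definition T :: "nat \<Rightarrow> nat ^ 'n" where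
  "T e = (\<chi> i. nat (ceil_num p (x i) e))"

lemma T_nth: "int (T e $ i) = ceil_num p (x i) e"
  unfolding T_def using ceil_num_nonneg[OF p_gt_1 x_pos x_le] by simp

lemma T_bounds: "real (T e $ i) < x i * real p ^ e" "x i * real p ^ e \<le> real (T e $ i) + 1"
  using ceil_num_bounds[OF p_gt_1 x_pos x_le, of i e] unfolding T_nth[symmetric] by simp_all

lemma T_quotient_less: "real (T e $ i) / real p ^ e < x i"
  using T_bounds(1)[of e i] p_pos by (simp add: divide_less_eq)

lemma T_0: "T 0 = 0"
  by (simp add: T_def vec_eq_iff ceil_num_0[OF p_gt_1 x_pos x_le])

lemma T_Suc: "T (Suc e) = p *s T e + digit_vec p a (Suc e)"
proof -
  have "int (T (Suc e) $ i) = int ((p *s T e + digit_vec p a (Suc e)) $ i)" for i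
    unfolding T_nth digit_vec_def using digit_eq[OF p_gt_1 x_pos x_le, of i e] T_nth[of e i] by simp
  then show ?thesis unfolding of_nat_eq_iff vec_eq_iff by blast
qed

lemma T_nth_tendsto: "(\<lambda>e. real (T e $ i) / real p ^ e) \<longlonglongrightarrow> x i"
  using ceil_num_tendsto[OF p_gt_1 x_pos x_le, of i] unfolding T_nth[symmetric] by simp

lemma trunc_T: "trunc p e (lam a *\<^sub>R real_vec a) = lattice_point p e (T e)"
proof (unfold vec_eq_iff, rule allI)
  fix i
  have "real (T e $ i) = real_of_int (ceil_num p (x i) e)" using T_nth[of e i] by (metis of_int_of_nat_eq)
  then show "trunc p e (lam a *\<^sub>R real_vec a) $ i = lattice_point p e (T e) $ i"
    unfolding lattice_point_nth by (simp add: trunc_def ceil_num_def[OF p_gt_1 x_pos x_le] real_vec_def)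
qed

lemma sum_less:
  assumes "\<And>i. real (b $ i) / real p ^ e < x i"
  shows "wt b < 2 * p ^ e"
proof -
  have "real (b $ i) < x i * real p ^ e" for i using assms[of i] p_pos by (simp add: field_simps)
  then have "(\<Sum>i\<in>UNIV. real (b $ i)) < (\<Sum>i\<in>UNIV. x i * real p ^ e)"
    by (intro sum_strict_mono) auto
  also have "\<dots> = real (2 * p ^ e)" unfolding sum_distrib_right[symmetric] sum_x by simp
  finally show ?thesis unfolding wt_def of_nat_sum[symmetric] by (simp only: of_nat_less_iff)
qed

lemma b_ideal_eq: "b_ideal p ell a e = level_ideal e (T e)"
proof (induction e)
  case 0
  show ?case
    by (simp add: T_0 level_ideal_def ell_pow_0 ideal_colon_def frob_power_def max_ideal_def
        module.span_span[OF module_mult])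
next
  case (Suc e)
  then show ?case
    using frob_level_ideal[of 1 e "T e"] by (simp add: colon_level_ideal T_Suc)
qed

abbreviation "unit_level e \<equiv> mem e (T e)"

lemma b_ideal_unit: "b_ideal p ell a e = ideal_gen {1} \<longleftrightarrow> unit_level e"
  unfolding b_ideal_eq by (rule level_ideal_unit)

lemma unit_level_mono: "unit_level e \<Longrightarrow> e \<le> e' \<Longrightarrow> unit_level e'"
proof -
  assume u: "unit_level e" and "e \<le> e'"
  from this(2) show ?thesis
  proof (induction rule: dec_induct)
    case (step e')
    then have "mem (e' + 1) (p ^ 1 *s T e')" by (simp only: mem_scale)
    then show ?case using mem_mono[of "Suc e'" "p *s T e'"] by (simp add: T_Suc less_eq_vec_def)
  qed (rule u)
qed

text \<open>
  If \<open>G\<^sup>k \<in> \<mm>\<^sup>[\<^sup>q\<^sup>]\<close> with \<open>k/q < \<lambda>\<close>, then \<open>\<langle>\<lambda>a\<rangle>\<^sub>e\<close> exceeds \<open>(k/q) a\<close> for large \<open>e\<close>.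
\<close>

lemma fpt_eq_lam:
  assumes "\<And>e. \<not> unit_level e"
  shows "fpt p (ell_pow ell a) = lam a"
proof (rule fpt_eqI)
  show "wt a > 0" by (rule wt_pos)
  show "0 \<le> lam a" by (simp add: lam_alt)
  show "mem s (k *s a)" if le: "lam a \<le> real k / real p ^ s" for s k
  proof (rule mem_of_degree)
    have "real (2 * p ^ s) \<le> real (k * wt a)"
      using le wt_pos p_pos unfolding lam_alt by (simp add: field_simps)
    then show "2 * p ^ s \<le> wt (k *s a) + 1" unfolding wt_scale of_nat_le_iff by simp
  qed
  show "lam a \<le> real k / real p ^ s" if mem: "mem s (k *s a)" for s k
  proof (rule ccontr)
    assume "\<not> ?thesis"
    then have "real k / real p ^ s * real (a $ i) < x i" for i
      using a_pos[of i] by (intro mult_strict_right_mono) auto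
    then have "\<forall>\<^sub>F e in sequentially. real k / real p ^ s * real (a $ i) < real (T e $ i) / real p ^ e" for i
      by (intro order_tendstoD(1)[OF T_nth_tendsto])
    then have "\<forall>\<^sub>F e in sequentially. \<forall>i. real k / real p ^ s * real (a $ i) < real (T e $ i) / real p ^ e"
      by (intro eventually_all_finite)
    then obtain e where "\<And>i. real k / real p ^ s * real (a $ i) < real (T e $ i) / real p ^ e"
      unfolding eventually_sequentially by blast
    then have "unit_level e" by (intro mem_upward[OF mem]) (simp add: less_imp_le)
    then show False using assms by blast
  qed
qed

text \<open>
  If \<open>(p\<^sup>\<mu> - 1) \<lambda>\<close> is an integer then the expansions of \<open>\<lambda>a\<close> are periodic of period \<open>\<mu>\<close>, and the ideal
  at level \<open>(k + 1) \<mu>\<close> is a colon of a Frobenius power of the one at level \<open>\<mu>\<close>.  The latter being inside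
  the maximal ideal, no ideal at a multiple of \<open>\<mu>\<close> can become the unit ideal later.
\<close>

lemma periodic_not_unit:
  assumes period: "(real p ^ \<mu> - 1) * lam a \<in> \<int>" and "\<mu> > 0" and nu: "\<not> unit_level \<mu>"
  shows "\<not> unit_level e"
proof -
  have int: "\<exists>z. x i * (real p ^ (k * \<mu>) - 1) = of_int z" for i k
  proof (induction k)
    case (Suc k)
    then obtain z where z: "x i * (real p ^ (k * \<mu>) - 1) = of_int z" by blast
    obtain y where y: "(real p ^ \<mu> - 1) * lam a = of_int y" using period by (auto elim: Ints_cases)
    have "x i * (real p ^ (Suc k * \<mu>) - 1) =
        x i * (real p ^ (k * \<mu>) - 1) + real p ^ (k * \<mu>) * ((real p ^ \<mu> - 1) * lam a) * real (a $ i)"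
      by (simp add: power_add algebra_simps)
    also have "\<dots> = of_int (z + int p ^ (k * \<mu>) * y * int (a $ i))" unfolding z y by simp
    finally show ?case by blast
  qed simp
  have T: "real (T (k * \<mu>) $ i) = x i * (real p ^ (k * \<mu>) - 1)" for i k
  proof -
    obtain z where z: "x i * (real p ^ (k * \<mu>) - 1) = of_int z" using int by blast
    have "ceil_num p (x i) (k * \<mu>) = z"
      by (rule ceil_num_unique[OF p_gt_1 x_pos x_le])
        (use z[symmetric] x_pos[of i] x_le[of i] in \<open>simp_all add: right_diff_distrib\<close>)
    then have "real_of_int (int (T (k * \<mu>) $ i)) = real_of_int z" unfolding T_nth by simp
    then show ?thesis using z by simp
  qed
  have T_step: "T (\<mu> + k * \<mu>) = p ^ (k * \<mu>) *s T \<mu> + T (k * \<mu>)" for k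
  proof -
    have "real (T (\<mu> + k * \<mu>) $ i) = real ((p ^ (k * \<mu>) *s T \<mu> + T (k * \<mu>)) $ i)" for i
    proof -
      have "real (T (\<mu> + k * \<mu>) $ i) = x i * (real p ^ \<mu> * real p ^ (k * \<mu>) - 1)"
        using T[of "Suc k" i] by (simp add: power_add)
      also have "\<dots> = real p ^ (k * \<mu>) * (x i * (real p ^ \<mu> - 1)) + x i * (real p ^ (k * \<mu>) - 1)"
        by (simp add: algebra_simps)
      also have "\<dots> = real ((p ^ (k * \<mu>) *s T \<mu> + T (k * \<mu>)) $ i)"
        using T[of k i] T[of 1 i] by simp
      finally show ?thesis .
    qed
    then show ?thesis unfolding of_nat_eq_iff vec_eq_iff by blast
  qed
  have "\<not> unit_level (k * \<mu>)" for k
  proof (induction k)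
    case 0
    show ?case by (simp add: T_0 not_mem_zero)
  next
    case (Suc k)
    show ?case
    proof
      assume "unit_level (Suc k * \<mu>)"
      then have "mem (\<mu> + k * \<mu>) (p ^ (k * \<mu>) *s T \<mu> + T (k * \<mu>))" by (simp add: T_step)
      then have "ell_pow ell (T (k * \<mu>)) \<in> frob_power (p ^ (k * \<mu>)) (level_ideal \<mu> (T \<mu>))"
        unfolding frob_level_ideal in_level_ideal .
      then have "unit_level (k * \<mu>)"
        using frob_power_mono[OF level_ideal_subset_max[OF nu]] unfolding mem_def by blast
      then show False using Suc by blast
    qed
  qed
  moreover have "e \<le> e * \<mu>" using \<open>\<mu> > 0\<close> by simp
  ultimately show ?thesis using unit_level_mono by blast
qed

lemma good_denominator:
  assumes "\<not> p dvd min_denom (lam a)"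
  shows "ord (min_denom (lam a)) p > 0"
    and "\<not> unit_level (ord (min_denom (lam a)) p) \<Longrightarrow> \<not> unit_level e"
proof -
  let ?m = "min_denom (lam a)"
  let ?\<mu> = "ord ?m p"
  have "wt a > 0 \<and> real (wt a) * lam a \<in> \<int>" using wt_pos by (simp add: lam_alt)
  then have m: "?m > 0 \<and> real ?m * lam a \<in> \<int>" unfolding min_denom_def by (rule LeastI)
  have "coprime ?m p" using assms prime_p prime_imp_coprime coprime_commute by blast
  then show pos: "?\<mu> > 0" by simp
  have "[p ^ ?\<mu> = 1] (mod ?m)" by (rule ord)
  then have "?m dvd p ^ ?\<mu> - 1" using p_pos by (simp add: cong_altdef_nat)
  then obtain k where k: "p ^ ?\<mu> - 1 = ?m * k" by (auto simp: dvd_def)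
  have "real (p ^ ?\<mu> - 1) = real (?m * k)" unfolding k ..
  then have "real p ^ ?\<mu> - 1 = real ?m * real k" using p_pos by (simp add: of_nat_diff)
  then have "(real p ^ ?\<mu> - 1) * lam a = real k * (real ?m * lam a)" by simp
  also have "\<dots> \<in> \<int>" using m by (intro Ints_mult[of "real k"]) auto
  finally show "\<not> unit_level ?\<mu> \<Longrightarrow> \<not> unit_level e" using periodic_not_unit pos by blast
qed

text \<open>
  The exponents of \<open>G\<^sup>k\<close> that lie beyond the critical point \<open>c\<close> are members.  Conversely, a member just
  below \<open>c\<^sub>i\<close> in the extremal coordinate may be raised in the other coordinates to just below \<open>\<lambda>a\<close>; then
  \<open>critical_mem_le\<close> applies, since \<open>c < \<lambda>a\<close> keeps the join below total degree \<open>2\<close>.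
\<close>

lemma fpt_of_critical:
  assumes crit: "critical_mem S c" and less: "\<And>i. real (c $ i) / real p ^ S < x i"
  shows "fpt p (ell_pow ell a) = Max (range (\<lambda>i. real (c $ i) / real p ^ S / real (a $ i)))"
proof -
  define r where "r = Max (range (\<lambda>i. real (c $ i) / real p ^ S / real (a $ i)))"
  have fin: "finite (range (\<lambda>i. real (c $ i) / real p ^ S / real (a $ i)))" by simp
  have r_ge: "real (c $ i) / real p ^ S / real (a $ i) \<le> r" for i
    unfolding r_def by (rule Max_ge[OF fin]) blast
  have "r \<in> range (\<lambda>i. real (c $ i) / real p ^ S / real (a $ i))"
    unfolding r_def by (rule Max_in[OF fin]) blast
  then obtain i where r: "r = real (c $ i) / real p ^ S / real (a $ i)" by blast
  have "fpt p (ell_pow ell a) = r"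
  proof (rule fpt_eqI)
    show "wt a > 0" by (rule wt_pos)
    show "0 \<le> r" unfolding r by simp
    show "mem s (k *s a)" if le: "r \<le> real k / real p ^ s" for s k
    proof (rule mem_upward)
      show "mem S c" using crit by (simp add: critical_mem_def)
      show "real (c $ j) / real p ^ S \<le> real ((k *s a) $ j) / real p ^ s" for j
      proof -
        have "real (c $ j) / real p ^ S / real (a $ j) \<le> real k / real p ^ s" using r_ge[of j] le by linarith
        then have "real (c $ j) / real p ^ S \<le> real k / real p ^ s * real (a $ j)"
          using a_pos[of j] by (simp only: pos_divide_le_eq of_nat_0_less_iff)
        then show ?thesis by simp
      qed
    qed
    show "r \<le> real k / real p ^ s" if mem: "mem s (k *s a)" for s k
    proof (rule ccontr)
      assume "\<not> ?thesis"
      then have kr: "real k / real p ^ s < r" by simp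
      then have ki: "real k / real p ^ s * real (a $ i) < real (c $ i) / real p ^ S"
        using a_pos[of i] unfolding r by (simp only: pos_less_divide_eq of_nat_0_less_iff)
      have ci: "c $ i > 0"
      proof (rule ccontr)
        assume "\<not> c $ i > 0"
        then have "real (c $ i) / real p ^ S = 0" by simp
        moreover have "0 \<le> real k / real p ^ s * real (a $ i)" by simp
        ultimately show False using ki by linarith
      qed
      have "r * real (a $ i) < x i" using less[of i] a_pos[of i] unfolding r by simp
      then have "r < lam a" using a_pos[of i] by simp
      then have kx: "real k / real p ^ s * real (a $ j) < x j" for j
        using kr a_pos[of j] by (intro mult_strict_right_mono) auto
      have 1: "\<forall>\<^sub>F t in sequentially. \<forall>j. real k / real p ^ s * real (a $ j) < real (T (S + t) $ j) / real p ^ (S + t)"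
      proof (intro eventually_all_finite)
        fix j
        have "(\<lambda>t. real (T (S + t) $ j) / real p ^ (S + t)) \<longlonglongrightarrow> x j"
          using LIMSEQ_ignore_initial_segment[OF T_nth_tendsto[of j], of S] by (simp only: add.commute)
        then show "\<forall>\<^sub>F t in sequentially. real k / real p ^ s * real (a $ j) < real (T (S + t) $ j) / real p ^ (S + t)"
          by (rule order_tendstoD(1)) (rule kx)
      qed
      have "(\<lambda>t. real (c $ i) / real p ^ S - inverse (real p ^ (t + S))) \<longlonglongrightarrow> real (c $ i) / real p ^ S - 0"
        using p_gt_1 by (intro tendsto_diff tendsto_const LIMSEQ_ignore_initial_segment LIMSEQ_inverse_realpow_zero) simp
      then have 2: "\<forall>\<^sub>F t in sequentially. real k / real p ^ s * real (a $ i) < real (c $ i) / real p ^ S - inverse (real p ^ (t + S))"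
        by (rule order_tendstoD(1)) (use ki in simp)
      obtain t where t1: "\<And>j. real k / real p ^ s * real (a $ j) < real (T (S + t) $ j) / real p ^ (S + t)"
        and t2: "real k / real p ^ s * real (a $ i) < real (c $ i) / real p ^ S - inverse (real p ^ (S + t))"
        using eventually_conj[OF 1 2] unfolding eventually_sequentially by (auto simp: add.commute)
      \<comment> \<open>Just below \<open>c\<close> in the extremal coordinate, just below \<open>\<lambda>a\<close> in the others.\<close>
      define u :: "nat ^ 'n" where "u = (\<chi> j. if j = i then p ^ t * c $ i - 1 else T (S + t) $ j)"
      have c_scale: "real (p ^ t * c $ j) / real p ^ (S + t) = real (c $ j) / real p ^ S" for j
        using p_pos by (simp add: power_add)
      have u_i: "real (u $ i) / real p ^ (S + t) = real (c $ i) / real p ^ S - inverse (real p ^ (S + t))"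
      proof -
        have "real (u $ i) = real (p ^ t * c $ i) - 1"
          using ci p_pos by (simp add: u_def of_nat_diff Suc_leI)
        then show ?thesis
          unfolding c_scale[symmetric] by (simp add: diff_divide_distrib inverse_eq_divide)
      qed
      have "mem (S + t) u"
      proof (rule mem_upward[OF mem])
        show "real ((k *s a) $ j) / real p ^ s \<le> real (u $ j) / real p ^ (S + t)" for j
        proof (cases "j = i")
          case True
          then show ?thesis using t2 u_i by simp
        next
          case False
          then show ?thesis using t1[of j] by (simp add: u_def)
        qed
      qed
      moreover have "wt u + wt (p ^ t *s c - u) < 2 * p ^ (S + t)"
        unfolding wt_add[symmetric]
      proof (rule sum_less)
        fix j
        have "(u + (p ^ t *s c - u)) $ j = p ^ t * c $ j \<or> (u + (p ^ t *s c - u)) $ j = T (S + t) $ j"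
          using ci by (auto simp: u_def)
        moreover have "real (T (S + t) $ j) / real p ^ (S + t) < x j"
          by (rule T_quotient_less)
        ultimately show "real ((u + (p ^ t *s c - u)) $ j) / real p ^ (S + t) < x j"
          using c_scale[of j] less[of j] by metis
      qed
      ultimately have "p ^ t *s c \<le> u" using critical_mem_le[OF crit] by blast
      then have "(p ^ t *s c) $ i \<le> u $ i" unfolding less_eq_vec_def by blast
      moreover have "(p ^ t *s c) $ i = p ^ t * c $ i" "u $ i = p ^ t * c $ i - 1" by (simp_all add: u_def)
      moreover have "p ^ t * c $ i > 0" using ci p_pos by simp
      ultimately show False by linarith
    qed
  qed
  then show ?thesis unfolding r_def .
qed

end

section \<open>The algorithm\<close>

context balanced
begin

definition admissible :: "enat \<Rightarrow> bool" where
  "admissible \<mu> \<longleftrightarrow> (\<mu> = \<infinity> \<and> fpt p (ell_pow ell a) \<noteq> lam a) \<or>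
     (\<mu> = enat (ord (min_denom (lam a)) p) \<and> \<not> p dvd min_denom (lam a))"

text \<open>
  The inequality says that \<open>c/p\<^sup>j + \<langle>\<lambda>a\<rangle>\<^sub>j < \<lambda>a\<close>.
\<close>

definition descent_point :: "nat \<Rightarrow> real ^ 'n \<Rightarrow> bool" where
  "descent_point j c \<longleftrightarrow>
     (\<exists>t b. c = lattice_point p t b \<and> lattice_critical p ell (level_ideal j (T j)) t b) \<and>
     (\<forall>i. (c $ i + real (T j $ i)) / real p ^ j < x i)"

text \<open>
  At \<open>Exit e\<close>, a proper ideal means that \<open>e\<close> has reached a finite \<open>\<mu>\<close>, and then all ideals are proper.
\<close>

definition state_inv :: "(real ^ 'n) state \<Rightarrow> bool" where
  "state_inv s = (case s of
      Start \<Rightarrow> True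
    | Setup \<Rightarrow> True
    | Ascend \<mu> e \<Rightarrow> admissible \<mu> \<and> (\<forall>e'<e. \<not> unit_level e') \<and> enat e \<le> \<mu>
    | Exit e \<Rightarrow> e > 0 \<and> (\<forall>e'<e. \<not> unit_level e') \<and> (\<not> unit_level e \<longrightarrow> fpt p (ell_pow ell a) = lam a)
    | Descend j c \<Rightarrow> (\<forall>e'\<le>j. \<not> unit_level e') \<and> descent_point j c
    | Return r \<Rightarrow> r = fpt p (ell_pow ell a))"

lemma exit_inv:
  assumes adm: "admissible \<mu>" and before: "\<forall>e'<e. \<not> unit_level e'" and le: "enat e \<le> \<mu>"
    and exit: "unit_level e \<or> \<not> enat e < \<mu>"
  shows "state_inv (Exit e)"
proof (cases "unit_level e")
  case True
  then have "e \<noteq> 0" using not_mem_zero by (metis T_0)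
  then show ?thesis using True before by (simp add: state_inv_def)
next
  case False
  then have "enat e = \<mu>" using exit le by (simp add: order.order_iff_strict)
  then have e: "e = ord (min_denom (lam a)) p" and good: "\<not> p dvd min_denom (lam a)"
    using adm by (auto simp: admissible_def)
  have "\<not> unit_level e'" for e'
    using good_denominator(2)[OF good] False unfolding e by blast
  then have "fpt p (ell_pow ell a) = lam a" by (rule fpt_eq_lam)
  then show ?thesis using before good_denominator(1)[OF good] unfolding e by (simp add: state_inv_def)
qed

lemma descent_pointI:
  assumes crit: "critical_point_under p ell (b_ideal p ell a j) v c"
    and less: "\<And>i. (v $ i + real (T j $ i)) / real p ^ j < x i"
  shows "descent_point j c"
proof -
  have cp: "critical_point p ell (level_ideal j (T j)) c" and cv: "c \<le> v"
    using crit by (simp_all add: critical_point_under_def b_ideal_eq)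
  obtain t b where "c = lattice_point p t b" "lattice_critical p ell (level_ideal j (T j)) t b"
    using critical_point_lattice[OF cp level_ideal_primary] .
  moreover have "(c $ i + real (T j $ i)) / real p ^ j < x i" for i
  proof -
    have "(c $ i + real (T j $ i)) / real p ^ j \<le> (v $ i + real (T j $ i)) / real p ^ j"
      using cv by (intro divide_right_mono) (simp_all add: less_eq_vec_def)
    then show ?thesis using less[of i] by linarith
  qed
  ultimately show ?thesis unfolding descent_point_def by blast
qed

lemma first_bound:
  "(((1 / real p) *\<^sub>R real_vec (digit_vec p a (Suc j))) $ i + real (T j $ i)) / real p ^ j < x i"
proof -
  have "(((1 / real p) *\<^sub>R real_vec (digit_vec p a (Suc j))) $ i + real (T j $ i)) / real p ^ j
    = real (T (Suc j) $ i) / real p ^ Suc j"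
    using p_pos by (simp add: T_Suc real_vec_def field_simps)
  also have "\<dots> < x i" by (rule T_quotient_less)
  finally show ?thesis .
qed

lemma next_bound:
  assumes "descent_point (Suc j) c"
  shows "(((1 / real p) *\<^sub>R (c + real_vec (digit_vec p a (Suc j)))) $ i + real (T j $ i)) / real p ^ j < x i"
proof -
  have "(((1 / real p) *\<^sub>R (c + real_vec (digit_vec p a (Suc j)))) $ i + real (T j $ i)) / real p ^ j
    = (c $ i + real (T (Suc j) $ i)) / real p ^ Suc j"
    using p_pos by (simp add: T_Suc real_vec_def field_simps)
  then show ?thesis using assms by (simp add: descent_point_def)
qed

text \<open>
  Rewritten at level \<open>0\<close>, the critical point is \<open>(b + p\<^sup>t T\<^sub>j) / p\<^sup>j\<^sup>+\<^sup>t\<close>.  It is critical for the maximal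
  ideal because lowering an exponent of \<open>b\<close> takes \<open>\<ell>\<^sup>b\<close> out of the Frobenius power of the colon ideal at
  level \<open>j\<close>, and the exponents of \<open>b\<close> are positive unless \<open>j = 0\<close>, when \<open>T\<^sub>j = 0\<close>.
\<close>

lemma descent_return:
  assumes "descent_point j c" "\<not> ((\<exists>i. c $ i = 0) \<and> j > 0)"
    and c': "c' = (1 / real p ^ j) *\<^sub>R c + trunc p j (lam a *\<^sub>R real_vec a)"
  shows "Max (range (\<lambda>i. c' $ i / real (a $ i))) = fpt p (ell_pow ell a)"
proof -
  obtain t b where c: "c = lattice_point p t b" and b: "lattice_critical p ell (level_ideal j (T j)) t b"
    and less: "\<And>i. (c $ i + real (T j $ i)) / real p ^ j < x i"
    using assms(1) unfolding descent_point_def by blast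
  define \<gamma> where "\<gamma> = b + p ^ t *s T j"
  have c'_nth: "c' $ i = real (\<gamma> $ i) / real p ^ (j + t)" "c' $ i = (c $ i + real (T j $ i)) / real p ^ j" for i
    unfolding c' trunc_T c \<gamma>_def using p_pos by (simp_all add: real_vec_def power_add field_simps)
  have "critical_mem (j + t) \<gamma>"
    unfolding critical_mem_def
  proof (intro conjI allI impI)
    show "mem (j + t) \<gamma>" using b unfolding lattice_critical_level_ideal \<gamma>_def by blast
    fix i assume "\<gamma> $ i > 0"
    have bi: "b $ i > 0"
    proof (rule ccontr)
      assume "\<not> b $ i > 0"
      then have bi: "b $ i = 0" by simp
      then have "c $ i = 0" by (simp add: c real_vec_def)
      then have "j = 0" using assms(2) by (metis gr0I)
      then show False using bi \<open>\<gamma> $ i > 0\<close> by (simp add: \<gamma>_def T_0)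
    qed
    then have "\<gamma> - axis i 1 = b - axis i 1 + p ^ t *s T j"
      by (auto simp: \<gamma>_def vec_eq_iff axis_def)
    then show "\<not> mem (j + t) (\<gamma> - axis i 1)"
      using b bi unfolding lattice_critical_level_ideal by simp
  qed
  then have "fpt p (ell_pow ell a) = Max (range (\<lambda>i. real (\<gamma> $ i) / real p ^ (j + t) / real (a $ i)))"
    by (rule fpt_of_critical) (use less in \<open>simp flip: c'_nth\<close>)
  then show ?thesis unfolding c'_nth(1) by simp
qed

lemma state_inv_step:
  assumes "step p ell a s s'" "state_inv s"
  shows "state_inv s'"
  using assms
proof cases
  case (large_exponent i)
  then show ?thesis using small[of i] by simp
next
  case no_large_exponent
  then show ?thesis by (simp add: state_inv_def)
next
  case bad_denom_equal
  then show ?thesis by (simp add: state_inv_def)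
next
  case bad_denom_unequal
  then show ?thesis by (simp add: state_inv_def admissible_def)
next
  case good_denom
  then show ?thesis by (simp add: state_inv_def admissible_def zero_enat_def[symmetric])
next
  case (ascend e \<mu>)
  then show ?thesis
    using assms(2) by (auto simp: state_inv_def b_ideal_unit less_Suc_eq Suc_ile_eq)
next
  case (ascend_exit e \<mu>)
  then show ?thesis
    using assms(2) exit_inv[of \<mu> e] by (simp add: state_inv_def b_ideal_unit)
next
  case (return_lam e)
  then show ?thesis
    using assms(2) by (simp add: state_inv_def b_ideal_unit)
next
  case (first_critical j c)
  then show ?thesis
    using assms(2) descent_pointI[OF first_critical(4) first_bound] by (simp add: state_inv_def less_Suc_eq_le)
next
  case (next_critical c j c')
  have d: "descent_point (Suc j) c" using assms(2) next_critical(1) by (simp add: state_inv_def)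
  show ?thesis
    using next_critical assms(2) descent_pointI[OF next_critical(4) next_bound[OF d]] by (simp add: state_inv_def)
next
  case (return_critical c j c')
  have d: "descent_point j c" using assms(2) return_critical(1) by (simp add: state_inv_def)
  show ?thesis
    unfolding return_critical(2) using descent_return[OF d return_critical(3,4)] by (simp add: state_inv_def)
qed

lemma first_critical_ex:
  assumes "\<not> unit_level j" "unit_level (Suc j)"
  obtains c where "critical_point_under p ell (b_ideal p ell a j)
       ((1 / real p) *\<^sub>R real_vec (digit_vec p a (Suc j))) c"
proof -
  let ?d = "digit_vec p a (Suc j)"
  have T: "?d + p ^ 1 *s T j = T (Suc j)" by (simp add: T_Suc add.commute)
  have "wt (T (Suc j)) < 2 * p ^ Suc j"
    by (rule sum_less) (rule T_quotient_less)
  then have "wt ?d + p ^ 1 * wt (T j) < 2 * p ^ (j + 1)"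
    unfolding T[symmetric] wt_add wt_scale by simp
  moreover have "mem (j + 1) (?d + p ^ 1 *s T j)" unfolding T using assms(2) by simp
  ultimately obtain c where "critical_point_under p ell (level_ideal j (T j)) (lattice_point p 1 ?d) c"
    using level_ideal_critical[OF assms(1)] by blast
  then show ?thesis using that by (simp add: b_ideal_eq)
qed

lemma next_critical_ex:
  assumes "\<not> unit_level j" "descent_point (Suc j) c"
  obtains c' where "critical_point_under p ell (b_ideal p ell a j)
       ((1 / real p) *\<^sub>R (c + real_vec (digit_vec p a (Suc j)))) c'"
proof -
  let ?d = "digit_vec p a (Suc j)"
  obtain t b where c: "c = lattice_point p t b" and b: "lattice_critical p ell (level_ideal (Suc j) (T (Suc j))) t b"
    and less: "\<And>i. (c $ i + real (T (Suc j) $ i)) / real p ^ Suc j < x i"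
    using assms(2) unfolding descent_point_def by blast
  let ?b = "b + p ^ t *s ?d"
  have v: "(1 / real p) *\<^sub>R (c + real_vec ?d) = lattice_point p (t + 1) ?b"
    using p_pos by (simp add: vec_eq_iff c real_vec_def field_simps)
  have T: "?b + p ^ (t + 1) *s T j = b + p ^ t *s T (Suc j)"
    by (simp add: vec_eq_iff T_Suc algebra_simps)
  have "wt (b + p ^ t *s T (Suc j)) < 2 * p ^ (Suc j + t)"
  proof (rule sum_less)
    fix i
    have "real ((b + p ^ t *s T (Suc j)) $ i) / real p ^ (Suc j + t) = (c $ i + real (T (Suc j) $ i)) / real p ^ Suc j"
      using p_pos by (simp add: c real_vec_def power_add field_simps)
    then show "real ((b + p ^ t *s T (Suc j)) $ i) / real p ^ (Suc j + t) < x i" using less[of i] by simp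
  qed
  then have "wt ?b + p ^ (t + 1) * wt (T j) < 2 * p ^ (j + (t + 1))"
    unfolding wt_scale[symmetric] wt_add[symmetric] T by (simp add: add.commute)
  moreover have "mem (j + (t + 1)) (?b + p ^ (t + 1) *s T j)"
    using b unfolding T lattice_critical_level_ideal by (simp add: add.commute)
  ultimately obtain c' where "critical_point_under p ell (level_ideal j (T j)) (lattice_point p (t + 1) ?b) c'"
    using level_ideal_critical[OF assms(1)] by blast
  then show ?thesis using that unfolding b_ideal_eq v by blast
qed

lemma progress:
  assumes "state_inv s"
  shows "(\<exists>r. s = Return r) \<or> (\<exists>s'. step p ell a s s')"
proof (cases s)
  case Start
  then show ?thesis using no_large_exponent[of a p ell] small by blast
next
  case Setup
  then show ?thesis using step.intros(3-5) by blast
next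
  case (Ascend \<mu> e)
  have "\<forall>i. \<exists>!f. nonterm_expansion p (lam a * real (a $ i)) f"
    using ex1_nonterm_expansion[OF p_gt_1 x_pos x_le] by blast
  then show ?thesis
    unfolding Ascend using ascend[of p ell a e \<mu>] ascend_exit[of p ell a e \<mu>] by metis
next
  case (Exit e)
  then obtain j where e: "e = Suc j" and before: "\<not> unit_level j"
    using assms by (cases e) (auto simp: state_inv_def)
  show ?thesis
  proof (cases "unit_level e")
    case True
    obtain c where "critical_point_under p ell (b_ideal p ell a j)
       ((1 / real p) *\<^sub>R real_vec (digit_vec p a (Suc j))) c"
      using first_critical_ex[OF before] True unfolding e by blast
    then show ?thesis
      unfolding Exit e using first_critical True b_ideal_unit e by metis
  next
    case False
    then show ?thesis unfolding Exit using return_lam b_ideal_unit by metis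
  qed
next
  case (Descend j c)
  have inv: "descent_point j c" "\<And>e'. e' \<le> j \<Longrightarrow> \<not> unit_level e'"
    using assms unfolding Descend by (auto simp: state_inv_def)
  show ?thesis
  proof (cases "(\<exists>i. c $ i = 0) \<and> j > 0")
    case True
    then obtain k where j: "j = Suc k" by (cases j) auto
    obtain c' where "critical_point_under p ell (b_ideal p ell a k)
       ((1 / real p) *\<^sub>R (c + real_vec (digit_vec p a (Suc k)))) c'"
      using next_critical_ex[of k c] inv unfolding j by auto
    then show ?thesis unfolding Descend j using next_critical True by blast
  next
    case False
    then show ?thesis unfolding Descend using return_critical by blast
  qed
qed simp

text \<open>
  When \<open>\<mu> = \<infinity>\<close>, the ascent ends because the threshold is not \<open>\<lambda>\<close>, so that some ideal is the unit ideal.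
\<close>

definition ascent_bound :: nat where
  "ascent_bound = (if \<exists>e. unit_level e then LEAST e. unit_level e else ord (min_denom (lam a)) p)"

lemma ascent_le:
  assumes "admissible \<mu>" "\<forall>e'<e. \<not> unit_level e'" "enat e \<le> \<mu>"
  shows "e \<le> ascent_bound"
proof (cases "\<exists>e. unit_level e")
  case True
  then have "unit_level (LEAST e. unit_level e)" by (rule LeastI_ex)
  then have "e \<le> (LEAST e. unit_level e)" using assms(2) not_le by blast
  then show ?thesis using True by (simp add: ascent_bound_def)
next
  case False
  then have "fpt p (ell_pow ell a) = lam a" using fpt_eq_lam by blast
  then have "e \<le> ord (min_denom (lam a)) p" using assms(1,3) by (auto simp: admissible_def)
  then show ?thesis using False by (simp add: ascent_bound_def)
qed

text \<open>
  The rank of \<open>Exit e\<close> has to grow with \<open>e\<close>, that of \<open>Ascend \<mu> e\<close> to fall; the factor \<open>2\<close> keeps the latter larger.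
\<close>

definition state_rank :: "(real ^ 'n) state \<Rightarrow> nat" where
  "state_rank s = (case s of
      Start \<Rightarrow> 5 + 2 * ascent_bound
    | Setup \<Rightarrow> 4 + 2 * ascent_bound
    | Ascend \<mu> e \<Rightarrow> 3 + 2 * ascent_bound - e
    | Exit e \<Rightarrow> 2 + e
    | Descend j c \<Rightarrow> 1 + j
    | Return r \<Rightarrow> 0)"

lemma state_rank_less:
  assumes "step p ell a s s'" "state_inv s"
  shows "state_rank s' < state_rank s"
proof -
  have inv': "state_inv s'" using state_inv_step[OF assms] .
  from assms(1) show ?thesis
  proof cases
    case (ascend e \<mu>)
    then have "Suc e \<le> ascent_bound" using inv' ascent_le[of \<mu> "Suc e"] by (simp add: state_inv_def)
    then show ?thesis by (simp add: ascend state_rank_def)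
  next
    case (ascend_exit e \<mu>)
    then have "e \<le> ascent_bound" using assms(2) ascent_le[of \<mu> e] by (simp add: state_inv_def)
    then show ?thesis by (simp add: ascend_exit state_rank_def)
  qed (simp_all add: state_rank_def)
qed

lemma algorithm_correct:
  "(\<forall>s. (step p ell a)\<^sup>*\<^sup>* Start s \<longrightarrow> (\<exists>r. s = Return r) \<or> (\<exists>s'. step p ell a s s')) \<and>
   \<not> (\<exists>run. run 0 = Start \<and> (\<forall>t. step p ell a (run t) (run (Suc t)))) \<and>
   (\<forall>r. (step p ell a)\<^sup>*\<^sup>* Start (Return r) \<longrightarrow> r = fpt p (ell_pow ell a))"
proof (intro conjI allI impI notI)
  have reach: "state_inv s" if "(step p ell a)\<^sup>*\<^sup>* Start s" for s
    using that by (induction rule: rtranclp_induct) (auto simp: state_inv_step, simp add: state_inv_def)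
  show "(\<exists>r. s = Return r) \<or> (\<exists>s'. step p ell a s s')" if "(step p ell a)\<^sup>*\<^sup>* Start s" for s
    using progress reach[OF that] by blast
  show "r = fpt p (ell_pow ell a)" if "(step p ell a)\<^sup>*\<^sup>* Start (Return r)" for r
    using reach[OF that] by (simp add: state_inv_def)
  assume "\<exists>run. run 0 = Start \<and> (\<forall>t. step p ell a (run t) (run (Suc t)))"
  then obtain run where run: "run 0 = Start" "\<And>t. step p ell a (run t) (run (Suc t))" by blast
  have inv: "state_inv (run t)" for t
    by (induction t) (use run state_inv_step in \<open>auto simp: state_inv_def[of Start]\<close>)
  have "state_rank (run t) + t \<le> state_rank (run 0)" for t
  proof (induction t)
    case (Suc t)
    then show ?case using state_rank_less[OF run(2)[of t] inv[of t]] by simp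
  qed simp
  from this[of "Suc (state_rank (run 0))"] show False by simp
qed

end

lemma (in arrangement) algorithm_large_exponent:
  assumes pos: "\<And>i. a $ i > 0" and large: "real (a $ i) \<ge> norm1 (real_vec a) / 2"
  shows "(\<forall>s. (step p ell a)\<^sup>*\<^sup>* Start s \<longrightarrow> (\<exists>r. s = Return r) \<or> (\<exists>s'. step p ell a s s')) \<and>
   \<not> (\<exists>run. run 0 = Start \<and> (\<forall>t. step p ell a (run t) (run (Suc t)))) \<and>
   (\<forall>r. (step p ell a)\<^sup>*\<^sup>* Start (Return r) \<longrightarrow> r = fpt p (ell_pow ell a))"
proof -
  have start: "s = Return (fpt p (ell_pow ell a))" if "step p ell a Start s" for s
    using that
  proof cases
    case (large_exponent k)
    then show ?thesis using fpt_large_exponent[of a k] pos by simp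
  next
    case no_large_exponent
    then show ?thesis using large by (meson not_le)
  qed
  have final: "\<not> step p ell a (Return r) s" for r s
    by (auto elim: step.cases)
  have reach: "s = Start \<or> s = Return (fpt p (ell_pow ell a))" if "(step p ell a)\<^sup>*\<^sup>* Start s" for s
    using that by (induction rule: rtranclp_induct) (use start final in auto)
  have "\<not> (\<exists>run. run 0 = Start \<and> (\<forall>t. step p ell a (run t) (run (Suc t))))"
  proof
    assume "\<exists>run. run 0 = Start \<and> (\<forall>t. step p ell a (run t) (run (Suc t)))"
    then obtain run where run: "run 0 = Start" "\<And>t. step p ell a (run t) (run (Suc t))" by blast
    then have "run (Suc 0) = Return (fpt p (ell_pow ell a))" using start run(2)[of 0] by simp
    then show False using run(2)[of "Suc 0"] final by simp
  qed
  moreover have "\<exists>s'. step p ell a Start s'" using step.large_exponent[OF large] by blast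
  ultimately show ?thesis using reach by blast
qed

theorem theoremA5:
  fixes p :: nat
    and ell :: "('k::field) bipoly ^ 'n::finite"
    and a :: "nat ^ 'n"
  assumes "CHAR('k) = p" and "p > 0"
    and "\<forall>i. linear_form (ell $ i)"
    and "\<forall>i j. i \<noteq> j \<longrightarrow> coprime (ell $ i) (ell $ j)"
    and "\<forall>i. a $ i > 0"
  shows
    "(\<forall>s. (step p ell a)\<^sup>*\<^sup>* Start s \<longrightarrow> (\<exists>r. s = Return r) \<or> (\<exists>s'. step p ell a s s')) \<and>
     \<not> (\<exists>run. run 0 = Start \<and> (\<forall>t. step p ell a (run t) (run (Suc t)))) \<and>
     (\<forall>r. (step p ell a)\<^sup>*\<^sup>* Start (Return r) \<longrightarrow> r = fpt p (ell_pow ell a))"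
proof -
  interpret arrangement p ell by unfold_locales (use assms in auto)
  show ?thesis
  proof (cases "\<exists>i. real (a $ i) \<ge> norm1 (real_vec a) / 2")
    case True
    then show ?thesis using algorithm_large_exponent assms(5) by blast
  next
    case False
    then interpret balanced p ell a by unfold_locales (use assms(5) in \<open>auto simp: not_le\<close>)
    show ?thesis by (rule algorithm_correct)
  qed
qed

end
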